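(* For any time horizon $t\ge 0$, any $N\ge 2$ and any bounded measurable function $F$ on $D_t(S)^N\times D_t(S)^N$ we have the almost sure formula $$\mathbb E\Big(F(\widehat\xi_t,\mathbb X_t)\,\exp\Big[-\int_0^t m(\mathbb X_s)(\widehat V_s)\,ds\Big]\Big)=\mathbb E\Big(F(\widehat\chi_t,\mathbb Y_t)\,\exp\Big[-\int_0^t\widehat V_s(\mathbb Y^{\mathcal I}_s)\,ds\Big]\;\Big|\;\mathcal I\Big).$$
   Context: Setting. $(S,d_S)$ is a metric space, $X=(X_t)_{t\ge0}$ is a (possibly time-inhomogeneous) càdlàg Markov process on $S$ with well-defined generators $L_t$, and $V_t\ge 0$ are measurable functions on $S$, uniformly bounded in $t$. $D_t(S)$ is the set of càdlàg paths from $[0,t]$ to $S$; $\widehat X_t=(X_s)_{s\le t}\in D_t(S)$ is the historical process; for $x=(x_s)_{s\le t}\in D_t(S)$ put $\widehat V_t(x):=V_t(x_t)$. $[N]=\{1,\dots,N\}$. For $x=(x^i)_{i\in[N]}$, $m(x):=\frac1N\sum_{i\in[N]}\delta_{x^i}$, and $\mu(f)=\int f\,d\mu$. Process $(\widehat\xi_t,\mathbb X_t)\in D_t(S)^N\times D_t(S)^N$ (complete ancestral tree and genealogical tree). Initially $\widehat\xi_0=\mathbb X_0=\xi_0=(\xi^i_0)_{i\in[N]}$ with $\xi_0^i$ i.i.d. copies of $X_0$. At every time the $i$-th paths $\widehat\xi^i_t$ and $\mathbb X^i_t$ have the same terminal value, denoted $\xi^i_t$. Between jumps, the terminal values $\xi^i_t$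 evolve as $N$ independent copies of $X$, and both families of paths are extended in time by these terminal values. For each ordered pair $(i,j)$ with $i\ne j$, at rate $\frac1N V_t(\xi^i_t)$ there is a jump: in $\widehat\xi_t$ only the terminal value at time $t$ of the $i$-th path is replaced by the terminal value of the $j$-th path (the past of every row is kept, so $\widehat\xi_t=(\xi_s)_{s\le t}$); in $\mathbb X_t$ the whole $i$-th path is replaced by a copy of the whole $j$-th path. Dual process $(\widehat\chi_t,\mathbb Y_t)\in D_t(S)^N\times D_t(S)^N$. $\mathcal I$ is uniform on $[N]$ and independent of $\xi_0$ and of the particle model $(\widehat\xi,\mathbb X)$. Given $\mathcal I=k$: $\widehat\chi_0=\mathbb Y_0=\xi_0$; the $i$-th paths of $\widehat\chi_t$ and $\mathbb Y_t$ always have the same terminal value, denoted $\zeta^i_t$; between jumps the $\zeta^i_t$ evolve as $N$ independent copies of $X$ and both families of paths are extended by them. The jumps are of two types. (1) For each $i\ne k$ and $j\ne i$, at rate $\frac1N V_t(\zeta^i_t)$, there is a jump for the pair $(i,j)$: in $\widehat\chi_t$ only the terminal value at time $t$ of row $i$ is replaced by that of row $j$ (the past of every row is kept); in $\mathbb Y_t$ the whole path $\mathbb Y^i_t$ is replaced by a copy of the whole path $\mathbb Y^j_t$. (2) In addition, for each $i\neq k$, at rate $\frac1N V_t(\zeta^i_t)$: in $\widehat\chi_t$ the rows $i$ and $k$ are exchanged on $[0,t)$, and at time $t$ the terminal values of both rows $i$ and $k$ are set equal to $\zeta^k_{t-}$ (the other rows are unchanged); in $\mathbb Y_t$ the path $\mathbb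 Y^i_t$ is replaced by a copy of $\mathbb Y^k_t$. In particular the $k$-th path $\mathbb Y^k_t$ is never modified by a jump (it is a "frozen" ancestral line). *)

theory Defs
  imports "HOL-Probability.Probability"
begin

type_synonym 'a path = "real \<Rightarrow> 'a"
type_synonym 'a rows = "nat \<Rightarrow> 'a path"

text \<open>A path indexed by a set \<open>A\<close> of times is a function that is \<open>undefined\<close> off \<open>A\<close>;
  at a point where the one-sided filter is trivial the corresponding condition is void.\<close>

definition cadlag_on :: "real set \<Rightarrow> 'a::metric_space path \<Rightarrow> bool" where
  "cadlag_on A x \<longleftrightarrow>
     (\<forall>s\<in>A. (x \<longlongrightarrow> x s) (at s within (A \<inter> {s<..})) \<and> (\<exists>l. (x \<longlongrightarrow> l) (at s within (A \<inter> {..<s}))))"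

text \<open>The sigma-algebra is generated by the evaluations at the times of \<open>A\<close>
  (for separable \<open>S\<close> this is the Borel sigma-algebra of the Skorokhod topology).
  The set \<open>D\<^sub>t(S)\<close> is \<open>path_space {0..t}\<close>.\<close>

definition path_space :: "real set \<Rightarrow> 'a::metric_space path measure" where
  "path_space A = restrict_space (\<Pi>\<^sub>M s\<in>A. borel) {x. cadlag_on A x}"

definition state_space :: "nat \<Rightarrow> real \<Rightarrow> ('a::metric_space rows \<times> 'a rows) measure" where
  "state_space N t =
     (\<Pi>\<^sub>M i\<in>{1..N}. path_space {0..t}) \<Otimes>\<^sub>M (\<Pi>\<^sub>M i\<in>{1..N}. path_space {0..t})"

definition past_algebra :: "real \<Rightarrow> 'a::metric_space path measure" where
  "past_algebra t =
     vimage_algebra (space (path_space {0..})) (\<lambda>w. restrict w {0..t}) (\<Pi>\<^sub>M s\<in>{0..t}. borel)"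

text \<open>\<open>P s x\<close> is the law of the process started from \<open>x\<close> at time \<open>s\<close>. So that all these laws live
  on the same path space, the trajectories are indexed by all times \<open>u \<ge> 0\<close> and rest at \<open>x\<close> up to
  time \<open>s\<close>; accordingly the future of \<open>w\<close> after time \<open>t\<close> is \<open>u \<mapsto> w (max t u)\<close>.\<close>

locale markov_laws =
  fixes P :: "real \<Rightarrow> 'a::metric_space \<Rightarrow> 'a path measure"
  assumes kernel:
      "(\<lambda>(s, x). P s x) \<in> restrict_space borel {0..} \<Otimes>\<^sub>M borel \<rightarrow>\<^sub>M prob_algebra (path_space {0..})"
    and start: "\<And>s x. 0 \<le> s \<Longrightarrow> AE w in P s x. \<forall>u\<in>{0..s}. w u = x"
    and markov: "\<And>s t x A. 0 \<le> s \<Longrightarrow> s \<le> t \<Longrightarrow> A \<in> sets (path_space {0..}) \<Longrightarrow>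
      AE w in P s x.
        real_cond_exp (P s x) (past_algebra t)
          (indicator {w \<in> space (P s x). (\<lambda>u\<in>{0..}. w (max t u)) \<in> A}) w
        = measure (P t (w t)) A"

text \<open>Generators in the sense of the martingale problem (Dynkin's formula), on a domain \<open>Dom\<close>.\<close>

definition has_generators ::
    "(real \<Rightarrow> 'a::metric_space \<Rightarrow> 'a path measure) \<Rightarrow> ('a \<Rightarrow> real) set
      \<Rightarrow> (real \<Rightarrow> ('a \<Rightarrow> real) \<Rightarrow> 'a \<Rightarrow> real) \<Rightarrow> bool" where
  "has_generators P Dom L \<longleftrightarrow>
     (\<forall>f\<in>Dom. f \<in> borel_measurable borel \<and> bounded (range f) \<and>
        (\<lambda>(t, x). L t f x) \<in> borel_measurable (restrict_space borel {0..} \<Otimes>\<^sub>M borel) \<and>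
        (\<forall>s t x. 0 \<le> s \<longrightarrow> s \<le> t \<longrightarrow>
           integrable (P s x \<Otimes>\<^sub>M restrict_space lborel {s..t}) (\<lambda>(w, u). L u f (w u)) \<and>
           (\<integral>w. f (w t) \<partial>P s x) = f x + (LINT u:{s..t}|lborel. (\<integral>w. L u f (w u) \<partial>P s x))))"

definition cadlag_markov_process ::
    "'v measure \<Rightarrow> (real \<Rightarrow> 'v \<Rightarrow> 'a::metric_space) \<Rightarrow> (real \<Rightarrow> 'a \<Rightarrow> 'a path measure) \<Rightarrow> bool" where
  "cadlag_markov_process \<Omega> X P \<longleftrightarrow>
     prob_space \<Omega> \<and> markov_laws P \<and>
     (\<lambda>v. \<lambda>t\<in>{0..}. X t v) \<in> \<Omega> \<rightarrow>\<^sub>M path_space {0..} \<and>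
     distr \<Omega> (path_space {0..}) (\<lambda>v. \<lambda>t\<in>{0..}. X t v) = distr \<Omega> borel (X 0) \<bind> P 0"

text \<open>\<open>Replace i j\<close>: row \<open>i\<close> is replaced by row \<open>j\<close>; \<open>Exchange i k\<close>: the second type of jump of
  the dual process.\<close>

datatype move = Replace nat nat | Exchange nat nat

definition particle_moves :: "nat \<Rightarrow> move set" where
  "particle_moves N = {Replace i j |i j. i \<in> {1..N} \<and> j \<in> {1..N} \<and> j \<noteq> i}"

definition dual_moves :: "nat \<Rightarrow> nat \<Rightarrow> move set" where
  "dual_moves N k =
     {Replace i j |i j. i \<in> {1..N} \<and> i \<noteq> k \<and> j \<in> {1..N} \<and> j \<noteq> i} \<union>
     {Exchange i k |i. i \<in> {1..N} \<and> i \<noteq> k}"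

fun move_rate :: "nat \<Rightarrow> (real \<Rightarrow> 'a \<Rightarrow> real) \<Rightarrow> move \<Rightarrow> real \<Rightarrow> (nat \<Rightarrow> 'a) \<Rightarrow> real" where
  "move_rate N V (Replace i j) t x = V t (x i) / N"
| "move_rate N V (Exchange i k) t x = V t (x i) / N"

text \<open>Effect of a jump at time \<open>t\<close> on (complete ancestral tree, genealogical tree), both given by
  paths on \<open>[0,t]\<close> whose value at \<open>t\<close> is the terminal value just before the jump.\<close>

fun jump :: "real \<Rightarrow> move \<Rightarrow> 'a rows \<times> 'a rows \<Rightarrow> 'a rows \<times> 'a rows" where
  "jump t (Replace i j) (h, g) = (h(i := (h i)(t := h j t)), g(i := g j))"
| "jump t (Exchange i k) (h, g) =
     (h(i := (h k)(t := h k t), k := (h i)(t := h k t)), g(i := g k))"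

definition prolong :: "nat \<Rightarrow> real \<Rightarrow> real \<Rightarrow> 'a rows \<Rightarrow> 'a rows \<Rightarrow> 'a rows" where
  "prolong N \<tau> t w x = (\<lambda>i\<in>{1..N}. \<lambda>s\<in>{0..t}. if s \<le> \<tau> then x i s else w i s)"

text \<open>The same, up to time \<open>t-\<close> only: the terminal values are the left limits at \<open>t\<close>.\<close>

definition prolong_left ::
    "nat \<Rightarrow> real \<Rightarrow> real \<Rightarrow> 'a::metric_space rows \<Rightarrow> 'a rows \<Rightarrow> 'a rows" where
  "prolong_left N \<tau> t w x = (\<lambda>i\<in>{1..N}. (prolong N \<tau> t w x i)(t := Lim (at_left t) (w i)))"

definition initial_rows :: "nat \<Rightarrow> (nat \<Rightarrow> 'a) \<Rightarrow> 'a rows" where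
  "initial_rows N x = (\<lambda>i\<in>{1..N}. \<lambda>s\<in>{0..0}. x i)"

text \<open>A state process \<open>Z\<close> (pairs of rows of paths) together with the data driving it.
  \<^item> \<open>T n\<close> is the time of the \<open>n\<close>-th jump (\<open>\<infinity>\<close> if there are fewer), \<open>J n\<close> the jump made at time
    \<open>T (Suc n)\<close>, and \<open>W n\<close> the free motion after \<open>T n\<close>, observed only up to \<open>T (Suc n)\<close>.
  \<^item> \<open>F n\<close> is the information available at time \<open>T n\<close>, and \<open>G n\<close> adds the free motion \<open>W n\<close>.
  \<^item> \<open>E\<close> is the set of possible jumps; it may be random through an initially known label.

  In \<open>jump_law\<close>, the next jump is the first one of competing jumps with rates
  \<open>r\<^sub>e(u) = move_rate N V e u (W n u)\<close>: given the free motion, it is the jump \<open>e\<close> and occurs at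
  \<open>u\<close> with density \<open>r\<^sub>e(u) exp (- \<integral>\<^bsub>T n\<^esub>\<^bsup>u\<^esup> \<Sum>\<^sub>e' r\<^sub>e'(v) dv)\<close>.
  As the rates are bounded, \<open>T_unbounded\<close> holds almost surely; requiring it everywhere makes \<open>Z\<close>
  a function of the driving data.\<close>

locale jump_driven = prob_space M for M :: "'w measure" +
  fixes N :: nat
    and P :: "real \<Rightarrow> 'a::metric_space \<Rightarrow> 'a path measure"
    and V :: "real \<Rightarrow> 'a \<Rightarrow> real"
    and E :: "'w \<Rightarrow> move set"
    and \<xi>0 :: "nat \<Rightarrow> 'w \<Rightarrow> 'a"
    and Z :: "real \<Rightarrow> 'w \<Rightarrow> 'a rows \<times> 'a rows"
    and T :: "nat \<Rightarrow> 'w \<Rightarrow> ereal"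
    and J :: "nat \<Rightarrow> 'w \<Rightarrow> move"
    and W :: "nat \<Rightarrow> 'w \<Rightarrow> 'a rows"
    and F G :: "nat \<Rightarrow> 'w measure"
  assumes F_sub: "\<And>n. subalgebra M (F n)"
    and G_sub: "\<And>n. subalgebra M (G n)"
    and F_G: "\<And>n. subalgebra (G n) (F n)"
    and G_F: "\<And>n. subalgebra (F (Suc n)) (G n)"
    and E_meas: "E \<in> F 0 \<rightarrow>\<^sub>M count_space UNIV"
    and \<xi>0_meas: "\<And>i. i \<in> {1..N} \<Longrightarrow> \<xi>0 i \<in> F 0 \<rightarrow>\<^sub>M borel"
    and T_meas: "\<And>n. T n \<in> F n \<rightarrow>\<^sub>M borel"
    and W_meas: "\<And>n. W n \<in> G n \<rightarrow>\<^sub>M (\<Pi>\<^sub>M i\<in>{1..N}. path_space {0..})"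
    and J_meas: "\<And>n. J n \<in> F (Suc n) \<rightarrow>\<^sub>M count_space UNIV"
    and Z_meas: "\<And>t. 0 \<le> t \<Longrightarrow> Z t \<in> M \<rightarrow>\<^sub>M state_space N t"
    and T_0: "\<And>\<omega>. \<omega> \<in> space M \<Longrightarrow> T 0 \<omega> = 0"
    and T_increasing: "\<And>n \<omega>. \<omega> \<in> space M \<Longrightarrow> T n \<omega> < \<infinity> \<Longrightarrow> T n \<omega> < T (Suc n) \<omega>"
    and T_infinite: "\<And>n \<omega>. \<omega> \<in> space M \<Longrightarrow> T n \<omega> = \<infinity> \<Longrightarrow> T (Suc n) \<omega> = \<infinity>"
    and T_unbounded: "\<And>\<omega>. \<omega> \<in> space M \<Longrightarrow> (\<lambda>n. T n \<omega>) \<longlonglongrightarrow> \<infinity>"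
    and J_possible: "\<And>n \<omega>. \<omega> \<in> space M \<Longrightarrow> T (Suc n) \<omega> < \<infinity> \<Longrightarrow> J n \<omega> \<in> E \<omega>"
    and initial: "\<And>\<omega>. \<omega> \<in> space M \<Longrightarrow>
      Z 0 \<omega> = (initial_rows N (\<lambda>i. \<xi>0 i \<omega>), initial_rows N (\<lambda>i. \<xi>0 i \<omega>))"
    and between_jumps: "\<And>n \<omega> \<tau> t. \<omega> \<in> space M \<Longrightarrow> T n \<omega> = ereal \<tau> \<Longrightarrow> \<tau> \<le> t \<Longrightarrow>
      ereal t < T (Suc n) \<omega> \<Longrightarrow>
      Z t \<omega> = map_prod (prolong N \<tau> t (W n \<omega>)) (prolong N \<tau> t (W n \<omega>)) (Z \<tau> \<omega>)"
    and at_jump: "\<And>n \<omega> \<tau> t. \<omega> \<in> space M \<Longrightarrow> T n \<omega> = ereal \<tau> \<Longrightarrow> T (Suc n) \<omega> = ereal t \<Longrightarrow>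
      Z t \<omega> = jump t (J n \<omega>)
        (map_prod (prolong_left N \<tau> t (W n \<omega>)) (prolong_left N \<tau> t (W n \<omega>)) (Z \<tau> \<omega>))"
    and free_motion_law: "\<And>n A. A \<in> sets (\<Pi>\<^sub>M i\<in>{1..N}. path_space {0..}) \<Longrightarrow>
      AE \<omega> in M. \<forall>\<tau>. T n \<omega> = ereal \<tau> \<longrightarrow>
        real_cond_exp M (F n) (indicator {\<omega> \<in> space M. W n \<omega> \<in> A}) \<omega>
        = measure (\<Pi>\<^sub>M i\<in>{1..N}. P \<tau> (fst (Z \<tau> \<omega>) i \<tau>)) A"
    and jump_law: "\<And>n e t. AE \<omega> in M. \<forall>\<tau>. T n \<omega> = ereal \<tau> \<longrightarrow> e \<in> E \<omega> \<longrightarrow>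
      real_cond_exp M (G n) (indicator {\<omega> \<in> space M. T (Suc n) \<omega> \<le> ereal t \<and> J n \<omega> = e}) \<omega>
      = (LINT u:{\<tau>..t}|lborel. move_rate N V e u (\<lambda>i. W n \<omega> i u) *
           exp (- (LINT v:{\<tau>..u}|lborel. (\<Sum>e'\<in>E \<omega>. move_rate N V e' v (\<lambda>i. W n \<omega> i v)))))"

definition interacting_jump_process ::
    "'w measure \<Rightarrow> nat \<Rightarrow> (real \<Rightarrow> 'a::metric_space \<Rightarrow> 'a path measure) \<Rightarrow> (real \<Rightarrow> 'a \<Rightarrow> real) \<Rightarrow>
     ('w \<Rightarrow> move set) \<Rightarrow> (nat \<Rightarrow> 'w \<Rightarrow> 'a) \<Rightarrow> (real \<Rightarrow> 'w \<Rightarrow> 'a rows \<times> 'a rows) \<Rightarrow> bool" where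
  "interacting_jump_process M N P V E \<xi>0 Z \<longleftrightarrow> (\<exists>T J W F G. jump_driven M N P V E \<xi>0 Z T J W F G)"

definition particle_model ::
    "'w measure \<Rightarrow> nat \<Rightarrow> (real \<Rightarrow> 'a::metric_space \<Rightarrow> 'a path measure) \<Rightarrow> (real \<Rightarrow> 'a \<Rightarrow> real) \<Rightarrow>
     (nat \<Rightarrow> 'w \<Rightarrow> 'a) \<Rightarrow> (real \<Rightarrow> 'w \<Rightarrow> 'a rows) \<Rightarrow> (real \<Rightarrow> 'w \<Rightarrow> 'a rows) \<Rightarrow> bool" where
  "particle_model M N P V \<xi>0 \<xi>h XX \<longleftrightarrow>
     interacting_jump_process M N P V (\<lambda>_. particle_moves N) \<xi>0 (\<lambda>t \<omega>. (\<xi>h t \<omega>, XX t \<omega>))"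

text \<open>The information initially available must contain the label \<open>I\<close>, since it contains the set
  of possible jumps, which (for \<open>N \<ge> 2\<close>) determines \<open>I\<close>.\<close>

definition dual_model ::
    "'w measure \<Rightarrow> nat \<Rightarrow> (real \<Rightarrow> 'a::metric_space \<Rightarrow> 'a path measure) \<Rightarrow> (real \<Rightarrow> 'a \<Rightarrow> real) \<Rightarrow>
     (nat \<Rightarrow> 'w \<Rightarrow> 'a) \<Rightarrow> ('w \<Rightarrow> nat) \<Rightarrow> (real \<Rightarrow> 'w \<Rightarrow> 'a rows) \<Rightarrow> (real \<Rightarrow> 'w \<Rightarrow> 'a rows) \<Rightarrow> bool" where
  "dual_model M N P V \<xi>0 I \<chi>h YY \<longleftrightarrow>
     interacting_jump_process M N P V (\<lambda>\<omega>. dual_moves N (I \<omega>)) \<xi>0 (\<lambda>t \<omega>. (\<chi>h t \<omega>, YY t \<omega>))"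

definition hist_potential :: "(real \<Rightarrow> 'a \<Rightarrow> real) \<Rightarrow> real \<Rightarrow> 'a path \<Rightarrow> real" where
  "hist_potential V t x = V t (x t)"

definition empirical :: "nat \<Rightarrow> (nat \<Rightarrow> 'b) \<Rightarrow> 'b pmf" where
  "empirical N x = map_pmf x (pmf_of_set {1..N})"

end

theory Submission
  imports Defs
begin

text \<open>Expand both sides over the successive jumps. The exponential weight turns the clock of the
  particle model, with total jump rate \<open>(1 - 1/N) \<Sum>\<^sub>i V(\<xi>\<^sup>i)\<close>, and that of the dual process, with total
  rate \<open>\<Sum>\<^sub>i\<^sub>\<noteq>\<^sub>k V(\<zeta>\<^sup>i)\<close>, into the same factor \<open>exp (- \<integral> \<Sum>\<^sub>i V)\<close>. What remains of each term is an
  initial law propagated by one operator per jump, and the two models differ only in the jumps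
  they allow: replacements of row \<open>k\<close> by row \<open>i\<close> in the first, exchanges of \<open>i\<close> and \<open>k\<close> in the second.
  An exchange is such a replacement after the labels \<open>i\<close> and \<open>k\<close> have been swapped, and the weighted
  law of the particle model is invariant under relabelling, so the terms agree one by one.\<close>

text \<open>In each model the discount supplies exactly what the jump rates lack of
  \<open>\<Sum> V\<close>: the share \<open>1/N\<close> of every potential for the particles, the
  potential of row \<open>k\<close> for the dual. Weights \<open>q\<close> for the discount and
  \<open>1 - q\<close> for the rates therefore let one argument serve both. Invariance under
  relabelling comes from i.i.d. initial values, a common kernel for all rows, and the fact that a
  permutation conjugates replacements into replacements. The dual moves single out row
  \<open>k\<close> and lack this symmetry, but it is needed for the particle law only. The obstacle
  is measurability: the state process is measurable at fixed times only, and the weight integrates a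
  path functional not known to be measurable. So the states at jump times are rebuilt from the
  driving data, and the weight is identified with a product of measurable factors. Nonnegative
  integrals make the series over the jumps harmless; the signed \<open>F\<close> enters only once
  the weighted laws are equal as measures. The constant \<open>1 / N\<close> is the probability of a
  label and cancels in the conditional expectation.\<close>

section \<open>Disintegration of an expectation along a conditional law\<close>

text \<open>Both sides are integrals of \<Phi> against measures on
  \<open>F \<Otimes>\<^sub>M Y\<close> that agree on rectangles \<open>B \<times> A\<close> with
  \<open>B\<close> in \<open>F\<close> and \<open>A\<close> in the generator: there the claim is the
  defining property of conditional expectation. The event \<open>H\<close> makes room for
  sub-probability kernels, as for a jump that is one among several or never occurs. Asking for a
  generator only, not all of \<open>Y\<close>, admits hypotheses that speak of distribution
  functions.\<close>

lemma (in prob_space) nn_integral_disintegration: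
  assumes sub: "subalgebra M F"
    and W[measurable]: "W \<in> M \<rightarrow>\<^sub>M Y"
    and S: "S \<in> sets F" and H[measurable]: "H \<in> sets M"
    and \<kappa>: "\<kappa> \<in> F \<rightarrow>\<^sub>M subprob_algebra Y"
    and gen: "sets Y = sigma_sets (space Y) \<G>" "Int_stable \<G>" "\<G> \<subseteq> Pow (space Y)"
    and C: "countable C" "C \<subseteq> \<G>" "\<Union>C = space Y"
    and cond: "\<And>A. A \<in> \<G> \<Longrightarrow> AE \<omega> in M. \<omega> \<in> S \<longrightarrow>
       real_cond_exp M F (indicator {\<omega> \<in> space M. \<omega> \<in> H \<and> W \<omega> \<in> A}) \<omega> = measure (\<kappa> \<omega>) A"
    and \<Phi>: "\<Phi> \<in> borel_measurable (F \<Otimes>\<^sub>M Y)"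
  shows "(\<integral>\<^sup>+\<omega>. indicator (S \<inter> H) \<omega> * \<Phi> (\<omega>, W \<omega>) \<partial>M)
    = (\<integral>\<^sup>+\<omega>. indicator S \<omega> * (\<integral>\<^sup>+y. \<Phi> (\<omega>, y) \<partial>\<kappa> \<omega>) \<partial>M)"
proof -
  interpret sub: finite_measure_subalgebra M F
    using sub by unfold_locales
  have sp: "space F = space M" and setsF: "\<And>A. A \<in> sets F \<Longrightarrow> A \<in> sets M"
    using sub by (auto simp: subalgebra_def)
  have FM: "f \<in> M \<rightarrow>\<^sub>M L" if "f \<in> F \<rightarrow>\<^sub>M L" for f and L :: "'z measure"
    using measurable_from_subalg[OF sub that] .
  have [measurable]: "S \<in> sets M" using S setsF by auto
  have GY: "A \<in> sets Y" if "A \<in> \<G>" for A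
    unfolding gen(1) using that by (rule sigma_sets.Basic)
  \<comment> \<open>The kernel is only \<open>F\<close>-measurable, so it is bound to the
    restriction of \<open>M\<close> to \<open>F\<close>; the density restricts to \<open>S\<close>,
    the only place where the conditional law is known.\<close>
  define MF where "MF = density (restr_to_subalg M F) (indicator S)"
  have setsMF: "sets MF = sets F" by (simp add: MF_def sets_restr_to_subalg[OF sub])
  have spMF: "space MF = space M" by (simp add: MF_def space_restr_to_subalg)
  have int_MF: "(\<integral>\<^sup>+\<omega>. f \<omega> \<partial>MF) = (\<integral>\<^sup>+\<omega>. indicator S \<omega> * f \<omega> \<partial>M)"
    if "f \<in> borel_measurable F" for f
  proof -
    have *: "f \<in> borel_measurable (restr_to_subalg M F)"
        "indicator S \<in> borel_measurable (restr_to_subalg M F)"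
      using that S by (auto simp: measurable_cong_sets[OF sets_restr_to_subalg[OF sub] refl])
    have "(\<integral>\<^sup>+\<omega>. f \<omega> \<partial>MF) = (\<integral>\<^sup>+\<omega>. indicator S \<omega> * f \<omega> \<partial>restr_to_subalg M F)"
      unfolding MF_def using * by (subst nn_integral_density) auto
    also have "\<dots> = (\<integral>\<^sup>+\<omega>. indicator S \<omega> * f \<omega> \<partial>M)"
      using that S by (intro nn_integral_subalgebra2[OF sub]) auto
    finally show ?thesis .
  qed
  \<comment> \<open>\<mu>1 is the joint law of the sample point and \<open>W\<close> on
    \<open>S \<inter> H\<close>, and \<mu>2 is the semidirect product of \<open>MF\<close> with
    \<kappa>.\<close>
  define \<mu>1 where "\<mu>1 = distr (density M (indicator (S \<inter> H))) (F \<Otimes>\<^sub>M Y) (\<lambda>\<omega>. (\<omega>, W \<omega>))"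
  define K where "K = (\<lambda>\<omega>. distr (\<kappa> \<omega>) (F \<Otimes>\<^sub>M Y) (\<lambda>y. (\<omega>, y)))"
  define \<mu>2 where "\<mu>2 = MF \<bind> K"
  have idF[measurable]: "(\<lambda>\<omega>. (\<omega>, W \<omega>)) \<in> M \<rightarrow>\<^sub>M F \<Otimes>\<^sub>M Y"
    by (intro measurable_Pair W FM[OF measurable_ident_sets[OF refl]])
  have K: "K \<in> F \<rightarrow>\<^sub>M subprob_algebra (F \<Otimes>\<^sub>M Y)"
    unfolding K_def by (rule measurable_distr2[OF _ \<kappa>]) simp
  have K': "K \<in> MF \<rightarrow>\<^sub>M subprob_algebra (F \<Otimes>\<^sub>M Y)"
    using K by (simp add: measurable_cong_sets[OF setsMF refl])
  have neM: "space MF \<noteq> {}" using spMF not_empty by auto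
  have Ksets: "sets (\<kappa> \<omega>) = sets Y" if "\<omega> \<in> space M" for \<omega>
    using \<kappa> that sp by (metis sets_kernel)
  have K_int: "(\<integral>\<^sup>+z. f z \<partial>K \<omega>) = (\<integral>\<^sup>+y. f (\<omega>, y) \<partial>\<kappa> \<omega>)"
    if "f \<in> borel_measurable (F \<Otimes>\<^sub>M Y)" "\<omega> \<in> space M" for f :: "_ \<Rightarrow> ennreal" and \<omega>
  proof -
    have "(\<lambda>y. (\<omega>, y)) \<in> \<kappa> \<omega> \<rightarrow>\<^sub>M F \<Otimes>\<^sub>M Y"
      using that(2) sp by (subst measurable_cong_sets[OF Ksets refl]) auto
    then show ?thesis unfolding K_def by (rule nn_integral_distr) (simp add: that)
  qed
  have sets2: "sets \<mu>2 = sets (F \<Otimes>\<^sub>M Y)"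
    unfolding \<mu>2_def by (rule sets_bind[OF sets_kernel[OF K'] neM])
  let ?E = "{B \<times> A |B A. B \<in> sets F \<and> A \<in> \<G>}"
  have "\<mu>1 = \<mu>2"
  proof (rule measure_eqI_generator_eq_countable)
    show "Int_stable ?E"
      unfolding Int_stable_def
    proof (intro ballI)
      fix a b assume "a \<in> ?E" "b \<in> ?E"
      then obtain B A B' A' where ab: "a = B \<times> A" "b = B' \<times> A'" "B \<in> sets F" "B' \<in> sets F" "A \<in> \<G>" "A' \<in> \<G>" by auto
      then have "a \<inter> b = (B \<inter> B') \<times> (A \<inter> A')" "B \<inter> B' \<in> sets F" "A \<inter> A' \<in> \<G>"
        using gen(2) by (auto simp: Int_stable_def)
      then show "a \<inter> b \<in> ?E" by blast
    qed
    show "?E \<subseteq> Pow (space F \<times> space Y)" using gen(3) sets.sets_into_space by blast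
    have "sets (F \<Otimes>\<^sub>M Y) = sigma_sets (space F \<times> space Y) ?E"
      (is "_ = sigma_sets ?Om ?E")
    proof -
      have "sets (F \<Otimes>\<^sub>M Y) = sets (sigma ?Om ?E)"
        by (rule sets_pair_eq[where Ca="{space F}", OF sets.space_closed sets.sigma_sets_eq[symmetric] _ _ _ gen(3,1) C])
          simp_all
      also have "\<dots> = sigma_sets ?Om ?E"
        using gen(3) sets.sets_into_space[of _ F] by (intro sets_measure_of) blast
      finally show ?thesis .
    qed
    then show "sets \<mu>1 = sigma_sets (space F \<times> space Y) ?E" "sets \<mu>2 = sigma_sets (space F \<times> space Y) ?E"
      using sets2 by (auto simp: \<mu>1_def)
    show "(\<lambda>A. space F \<times> A) ` C \<subseteq> ?E" using C by auto
    show "\<Union> ((\<lambda>A. space F \<times> A) ` C) = space F \<times> space Y" using C by auto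
    show "countable ((\<lambda>A. space F \<times> A) ` C)" using C by auto
    fix X assume "X \<in> ?E"
    then obtain B A where X: "X = B \<times> A" and B: "B \<in> sets F" and A: "A \<in> \<G>" by auto
    have [measurable]: "B \<in> sets M" "A \<in> sets Y" using B setsF A GY by auto
    define U where "U = {\<omega> \<in> space M. \<omega> \<in> H \<and> W \<omega> \<in> A}"
    have U[measurable]: "U \<in> sets M" unfolding U_def by measurable
    have XF: "X \<in> sets (F \<Otimes>\<^sub>M Y)" using X B \<open>A \<in> sets Y\<close> by auto
    have "emeasure \<mu>1 X = emeasure (density M (indicator (S \<inter> H))) ((\<lambda>\<omega>. (\<omega>, W \<omega>)) -` X \<inter> space M)"
      unfolding \<mu>1_def using XF by (subst emeasure_distr) auto
    also have "\<dots> = (\<integral>\<^sup>+\<omega>. indicator (S \<inter> B \<inter> U) \<omega> \<partial>M)"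
    proof -
      have "emeasure (density M (indicator (S \<inter> H))) ((\<lambda>\<omega>. (\<omega>, W \<omega>)) -` X \<inter> space M)
        = (\<integral>\<^sup>+\<omega>. indicator (S \<inter> H) \<omega> * indicator ((\<lambda>\<omega>. (\<omega>, W \<omega>)) -` X \<inter> space M) \<omega> \<partial>M)"
        by (rule emeasure_density[OF _ measurable_sets[OF idF XF]]) measurable
      also have "\<dots> = (\<integral>\<^sup>+\<omega>. indicator (S \<inter> B \<inter> U) \<omega> \<partial>M)"
        by (intro nn_integral_cong) (auto simp: X U_def split: split_indicator)
      finally show ?thesis .
    qed
    also have "\<dots> = ennreal (measure M ((S \<inter> B) \<inter> U))"
      by (subst nn_integral_indicator) (auto simp: emeasure_eq_measure)
    also have "measure M ((S \<inter> B) \<inter> U) = (LINT \<omega>:(S \<inter> B)|M. indicator U \<omega>)"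
    proof -
      have "(LINT \<omega>:(S \<inter> B)|M. indicat_real U \<omega>) = (LINT \<omega>|M. indicator ((S \<inter> B) \<inter> U) \<omega>)"
        unfolding set_lebesgue_integral_def by (intro Bochner_Integration.integral_cong) (auto split: split_indicator)
      then show ?thesis by (simp add: Int_absorb2)
    qed
    also have "\<dots> = (LINT \<omega>:(S \<inter> B)|M. real_cond_exp M F (indicator U) \<omega>)"
      using S B by (intro sub.real_cond_exp_intA integrable_real_indicator U sets.Int) (simp_all add: less_top[symmetric])
    \<comment> \<open>The hypothesis \<open>cond\<close> holds almost everywhere on \<open>S\<close>
      only; the indicator removes the rest.\<close>
    also have "\<dots> = (LINT \<omega>:(S \<inter> B)|M. measure (\<kappa> \<omega>) A)"
    proof (unfold set_lebesgue_integral_def, rule integral_cong_AE)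
      show "(\<lambda>\<omega>. indicat_real (S \<inter> B) \<omega> *\<^sub>R real_cond_exp M F (indicat_real U) \<omega>) \<in> borel_measurable M"
        by measurable
      show "(\<lambda>x. indicat_real (S \<inter> B) x *\<^sub>R Sigma_Algebra.measure (\<kappa> x) A) \<in> borel_measurable M"
        using measurable_compose[OF FM[OF \<kappa>] measurable_measure_subprob_algebra[OF \<open>A \<in> sets Y\<close>]] by measurable
      show "AE x in M. indicat_real (S \<inter> B) x *\<^sub>R real_cond_exp M F (indicat_real U) x
          = indicat_real (S \<inter> B) x *\<^sub>R Sigma_Algebra.measure (\<kappa> x) A"
        using cond[OF A] unfolding U_def[symmetric] by eventually_elim (auto split: split_indicator)
    qed
    also have "ennreal \<dots> = (\<integral>\<^sup>+\<omega>. indicator (S \<inter> B) \<omega> * emeasure (\<kappa> \<omega>) A \<partial>M)"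
    proof -
      have le1: "measure (\<kappa> \<omega>) A \<le> 1" "emeasure (\<kappa> \<omega>) A = ennreal (measure (\<kappa> \<omega>) A)" if "\<omega> \<in> space M" for \<omega>
      proof -
        interpret subprob_space "\<kappa> \<omega>" using \<kappa> that sp by (metis subprob_space_kernel)
        show "measure (\<kappa> \<omega>) A \<le> 1" by (rule subprob_measure_le_1)
        show "emeasure (\<kappa> \<omega>) A = ennreal (measure (\<kappa> \<omega>) A)" by (rule emeasure_eq_measure)
      qed
      have m: "(\<lambda>x. Sigma_Algebra.measure (\<kappa> x) A) \<in> borel_measurable M"
        using measurable_compose[OF FM[OF \<kappa>] measurable_measure_subprob_algebra[OF \<open>A \<in> sets Y\<close>]] .
      have "integrable M (\<lambda>\<omega>. indicator (S \<inter> B) \<omega> * measure (\<kappa> \<omega>) A)"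
        using m le1 by (intro integrable_const_bound[where B=1] AE_I2 borel_measurable_times borel_measurable_indicator) (auto split: split_indicator)
      then have "ennreal (LINT \<omega>:(S \<inter> B)|M. measure (\<kappa> \<omega>) A)
          = (\<integral>\<^sup>+\<omega>. ennreal (indicator (S \<inter> B) \<omega> * measure (\<kappa> \<omega>) A) \<partial>M)"
        by (simp add: set_lebesgue_integral_def nn_integral_eq_integral)
      also have "\<dots> = (\<integral>\<^sup>+\<omega>. indicator (S \<inter> B) \<omega> * emeasure (\<kappa> \<omega>) A \<partial>M)"
        using le1 by (intro nn_integral_cong) (auto split: split_indicator)
      finally show ?thesis .
    qed
    also have "\<dots> = (\<integral>\<^sup>+\<omega>. indicator S \<omega> * (indicator B \<omega> * emeasure (\<kappa> \<omega>) A) \<partial>M)"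
      by (intro nn_integral_cong) (auto split: split_indicator)
    also have "\<dots> = (\<integral>\<^sup>+\<omega>. indicator B \<omega> * emeasure (\<kappa> \<omega>) A \<partial>MF)"
      using measurable_compose[OF \<kappa> measurable_emeasure_subprob_algebra[OF \<open>A \<in> sets Y\<close>]] B
      by (intro int_MF[symmetric]) auto
    also have "\<dots> = (\<integral>\<^sup>+\<omega>. emeasure (K \<omega>) X \<partial>MF)"
    proof (rule nn_integral_cong)
      fix \<omega> assume w: "\<omega> \<in> space MF"
      have "emeasure (K \<omega>) X = (\<integral>\<^sup>+z. indicator X z \<partial>K \<omega>)"
        using XF by (simp add: K_def)
      also have "\<dots> = (\<integral>\<^sup>+y. indicator X (\<omega>, y) \<partial>\<kappa> \<omega>)"
        using w spMF by (intro K_int borel_measurable_indicator XF) simp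
      also have "\<dots> = (\<integral>\<^sup>+y. indicator B \<omega> * indicator A y \<partial>\<kappa> \<omega>)"
        by (intro nn_integral_cong) (auto simp: X split: split_indicator)
      also have "\<dots> = indicator B \<omega> * emeasure (\<kappa> \<omega>) A"
        using Ksets[of \<omega>] w spMF by (subst nn_integral_cmult_indicator) auto
      finally show "indicator B \<omega> * emeasure (\<kappa> \<omega>) A = emeasure (K \<omega>) X" by simp
    qed
    also have "\<dots> = emeasure \<mu>2 X"
      unfolding \<mu>2_def by (rule emeasure_bind[OF neM K' XF, symmetric])
    finally show "emeasure \<mu>1 X = emeasure \<mu>2 X" .
  next
    fix a assume "a \<in> (\<lambda>A. space F \<times> A) ` C"
    have "emeasure \<mu>1 a \<le> emeasure \<mu>1 (space \<mu>1)" by (rule emeasure_space)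
    also have "\<dots> \<le> emeasure (density M (indicator (S \<inter> H))) (space M)"
      unfolding \<mu>1_def by (subst emeasure_distr) (auto intro!: emeasure_mono)
    also have "\<dots> = (\<integral>\<^sup>+\<omega>. indicator (S \<inter> H) \<omega> * indicator (space M) \<omega> \<partial>M)"
      by (rule emeasure_density) auto
    also have "\<dots> \<le> (\<integral>\<^sup>+\<omega>. 1 \<partial>M)"
      by (intro nn_integral_mono) (auto split: split_indicator)
    also have "\<dots> < \<infinity>" by (simp add: emeasure_space_1)
    finally show "emeasure \<mu>1 a \<noteq> \<infinity>" by simp
  qed
  have \<Phi>K: "(\<lambda>\<omega>. \<integral>\<^sup>+y. \<Phi> (\<omega>, y) \<partial>\<kappa> \<omega>) \<in> borel_measurable F"
    using nn_integral_measurable_subprob_algebra2[OF _ \<kappa>, of "curry \<Phi>"] \<Phi> by (simp add: curry_def)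
  have 1: "(\<integral>\<^sup>+z. \<Phi> z \<partial>\<mu>1) = (\<integral>\<^sup>+\<omega>. indicator (S \<inter> H) \<omega> * \<Phi> (\<omega>, W \<omega>) \<partial>M)"
    unfolding \<mu>1_def using \<Phi> idF by (subst nn_integral_distr) (simp_all add: nn_integral_density)
  have 2: "(\<integral>\<^sup>+z. \<Phi> z \<partial>\<mu>2) = (\<integral>\<^sup>+\<omega>. \<integral>\<^sup>+z. \<Phi> z \<partial>K \<omega> \<partial>MF)"
    unfolding \<mu>2_def by (rule nn_integral_bind[OF \<Phi> K'])
  have 3: "(\<integral>\<^sup>+\<omega>. \<integral>\<^sup>+z. \<Phi> z \<partial>K \<omega> \<partial>MF) = (\<integral>\<^sup>+\<omega>. \<integral>\<^sup>+y. \<Phi> (\<omega>, y) \<partial>\<kappa> \<omega> \<partial>MF)"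
    by (rule nn_integral_cong) (rule K_int[OF \<Phi>], simp add: spMF)
  show ?thesis
    using 1 2 3 int_MF[OF \<Phi>K] \<open>\<mu>1 = \<mu>2\<close> by simp
qed

section \<open>Survival probabilities, product kernels and cadlag paths\<close>

lemma set_integrable_bounded:
  fixes f :: "real \<Rightarrow> real"
  assumes "f \<in> borel_measurable borel" "\<And>x. \<bar>f x\<bar> \<le> C" "A \<in> sets borel" "emeasure lborel A < \<infinity>"
  shows "set_integrable lborel A f"
  unfolding set_integrable_def using assms
  by (intro integrableI_bounded_set_indicator[where B=C]) auto

text \<open>Moving the endpoints into the integrand turns a varying domain into a fixed one, where
  parameter integrals are measurable.\<close>

lemma measurable_LINT_interval[measurable (raw)]:
  fixes f :: "'b \<Rightarrow> real \<Rightarrow> real"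
  assumes f: "(\<lambda>(x, v). f x v) \<in> borel_measurable (L \<Otimes>\<^sub>M borel)"
    and [measurable]: "a \<in> borel_measurable L" "b \<in> borel_measurable L"
  shows "(\<lambda>x. LINT v:{a x..b x}|lborel. f x v) \<in> borel_measurable L"
proof -
  have [measurable]: "(\<lambda>z. f (fst z) (snd z)) \<in> borel_measurable (L \<Otimes>\<^sub>M borel)"
    using f by (simp add: split_beta')
  have "(\<lambda>(x, v). if a x \<le> v \<and> v \<le> b x then f x v else 0) \<in> borel_measurable (L \<Otimes>\<^sub>M lborel)"
    unfolding measurable_cong_sets[OF sets_pair_measure_cong[OF refl sets_lborel] refl] split_beta' by measurable
  then have "(\<lambda>x. \<integral>v. (if a x \<le> v \<and> v \<le> b x then f x v else 0) \<partial>lborel) \<in> borel_measurable L"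
    by (rule lborel.borel_measurable_lebesgue_integral)
  moreover have "(LINT v:{a x..b x}|lborel. f x v) = (\<integral>v. (if a x \<le> v \<and> v \<le> b x then f x v else 0) \<partial>lborel)" for x
    unfolding set_lebesgue_integral_def by (intro Bochner_Integration.integral_cong) auto
  ultimately show ?thesis by simp
qed

text \<open>The rate is only measurable, so the integrand is not the derivative of the survival function
  everywhere. Instead, the increments of \<open>\<integral> r exp (- R) + exp (- R)\<close> are of second order.\<close>

lemma integral_rate_times_survival:
  fixes r :: "real \<Rightarrow> real"
  assumes r[measurable]: "r \<in> borel_measurable borel" and r0: "\<And>v. 0 \<le> r v" and rC: "\<And>v. r v \<le> C"
    and ab: "a \<le> b"
  shows "(LINT u:{a..b}|lborel. r u * exp (- (LINT v:{a..u}|lborel. r v)))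
    = 1 - exp (- (LINT v:{a..b}|lborel. r v))"
proof -
  define R where "R = (\<lambda>u. LINT v:{a..u}|lborel. r v)"
  define g where "g = (\<lambda>u. r u * exp (- R u))"
  define \<phi> where "\<phi> = (\<lambda>u. (LINT x:{a..u}|lborel. g x) + exp (- R u))"
  have C0: "0 \<le> C" using r0[of 0] rC[of 0] by simp
  have ri: "set_integrable lborel A r" if "A \<in> sets borel" "emeasure lborel A < \<infinity>" for A
    using r0 rC that by (intro set_integrable_bounded[where C=C]) auto
  have [measurable]: "R \<in> borel_measurable borel"
    unfolding R_def by measurable
  have R0: "0 \<le> R u" for u
    unfolding R_def set_lebesgue_integral_def using r0 by (intro integral_nonneg_AE) auto
  have g0: "0 \<le> g u" "g u \<le> C" for u
  proof -
    show "0 \<le> g u" using r0 by (simp add: g_def)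
    have "exp (- R u) \<le> 1" using R0[of u] by simp
    then show "g u \<le> C" unfolding g_def using r0[of u] rC[of u] mult_mono[of "r u" C "exp (- R u)" 1] C0 by simp
  qed
  have [measurable]: "g \<in> borel_measurable borel" unfolding g_def by measurable
  have gi: "set_integrable lborel A g" if "A \<in> sets borel" "emeasure lborel A < \<infinity>" for A
    using g0 that by (intro set_integrable_bounded[where C=C]) auto
  \<comment> \<open>From \<open>x\<close> to \<open>y\<close>, the integral of \<open>g\<close> and
    the drop of \<open>exp (- R)\<close> both lie between \<open>exp (- R y) * J\<close> and
    \<open>exp (- R x) * J\<close>. They differ by at most the gap, which is at most
    \<open>J\<^sup>2\<close>, and \<open>J \<le> C * (y - x)\<close>.\<close>
  have incr: "\<bar>\<phi> y - \<phi> x\<bar> \<le> C\<^sup>2 * (y - x)\<^sup>2" if xy: "a \<le> x" "x \<le> y" for x y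
  proof -
    define J where "J = (LINT v:{x<..y}|lborel. r v)"
    have split: "{a..y} = {a..x} \<union> {x<..y}" using xy by auto
    have Ry: "R y = R x + J"
      unfolding R_def J_def split using xy by (intro set_integral_Un ri) (auto simp: emeasure_lborel_Icc_eq emeasure_lborel_Ioc)
    have J0: "0 \<le> J" unfolding J_def set_lebesgue_integral_def using r0 by (intro integral_nonneg_AE) auto
    have "J \<le> (LINT v:{x<..y}|lborel. C)"
      unfolding J_def using xy rC by (intro set_integral_mono ri) (auto simp: set_integrable_def emeasure_lborel_Ioc)
    also have "\<dots> = C * (y - x)" using xy by (simp add: set_lebesgue_integral_def)
    finally have J1: "J \<le> C * (y - x)" .
    have mono: "R x \<le> R u" "R u \<le> R y" if "u \<in> {x<..y}" for u
    proof -
      have "R u = R x + (LINT v:{x<..u}|lborel. r v)"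
      proof -
        have "{a..u} = {a..x} \<union> {x<..u}" using xy that by auto
        then show ?thesis unfolding R_def using that by (simp, intro set_integral_Un ri) (auto simp: emeasure_lborel_Icc_eq emeasure_lborel_Ioc)
      qed
      moreover have "0 \<le> (LINT v:{x<..u}|lborel. r v)"
        unfolding set_lebesgue_integral_def using r0 by (intro integral_nonneg_AE) auto
      moreover have "R y = R u + (LINT v:{u<..y}|lborel. r v)"
      proof -
        have "{a..y} = {a..u} \<union> {u<..y}" using xy that by auto
        then show ?thesis unfolding R_def using that by (simp, intro set_integral_Un ri) (auto simp: emeasure_lborel_Icc_eq emeasure_lborel_Ioc)
      qed
      moreover have "0 \<le> (LINT v:{u<..y}|lborel. r v)"
        unfolding set_lebesgue_integral_def using r0 by (intro integral_nonneg_AE) auto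
      ultimately show "R x \<le> R u" "R u \<le> R y" by auto
    qed
    define G where "G = (LINT v:{x<..y}|lborel. g v)"
    have G1: "exp (- R y) * J \<le> G"
      unfolding G_def J_def set_integral_mult_right[symmetric] using xy r0 mono
      by (intro set_integral_mono gi set_integrable_mult_right ri)
         (auto simp: emeasure_lborel_Ioc g_def mult.commute intro!: mult_left_mono)
    have G2: "G \<le> exp (- R x) * J"
      unfolding G_def J_def set_integral_mult_right[symmetric] using xy r0 mono
      by (intro set_integral_mono gi set_integrable_mult_right ri)
         (auto simp: emeasure_lborel_Ioc g_def mult.commute intro!: mult_left_mono)
    have E: "exp (- R x) = exp (- R y) * exp J" "exp (- R y) = exp (- R x) * exp (- J)"
      unfolding Ry by (simp_all add: exp_add[symmetric])
    have E1: "exp (- R y) * J \<le> exp (- R x) - exp (- R y)"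
    proof -
      have "exp (- R y) * J \<le> exp (- R y) * (exp J - 1)"
        using exp_ge_add_one_self[of J] by (intro mult_left_mono) (linarith, simp)
      then show ?thesis by (simp add: E(1) algebra_simps)
    qed
    have E2: "exp (- R x) - exp (- R y) \<le> exp (- R x) * J"
    proof -
      have "exp (- R x) * (1 - exp (- J)) \<le> exp (- R x) * J"
        using exp_ge_add_one_self[of "- J"] by (intro mult_left_mono) (linarith, simp)
      then show ?thesis by (simp add: E(2) algebra_simps)
    qed
    have "\<phi> y - \<phi> x = G - (exp (- R x) - exp (- R y))"
    proof -
      have "(LINT x:{a..y}|lborel. g x) = (LINT x:{a..x}|lborel. g x) + G"
        unfolding G_def split using xy by (intro set_integral_Un gi) (auto simp: emeasure_lborel_Icc_eq emeasure_lborel_Ioc)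
      then show ?thesis by (simp add: \<phi>_def)
    qed
    then have "\<bar>\<phi> y - \<phi> x\<bar> \<le> exp (- R x) * J - exp (- R y) * J"
      using G1 G2 E1 E2 by linarith
    also have "\<dots> = (exp (- R x) - exp (- R y)) * J" by (simp add: algebra_simps)
    also have "\<dots> \<le> (exp (- R x) * J) * J" using E2 J0 by (intro mult_right_mono)
    also have "\<dots> \<le> (1 * J) * J" using R0[of x] J0 by (intro mult_right_mono) auto
    also have "\<dots> \<le> (C * (y - x)) * (C * (y - x))" using J0 J1 by (simp add: mult_mono)
    finally show ?thesis by (simp add: power2_eq_square algebra_simps)
  qed
  have "\<phi> b = \<phi> a"
  proof (cases "a = b")
    case False
    have "(\<phi> has_real_derivative 0) (at x within {a..b})" if "x \<in> {a..b}" for x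
      unfolding has_field_derivative_iff
    proof (rule Lim_null_comparison)
      have sq: "\<bar>(\<phi> y - \<phi> x) / (y - x)\<bar> \<le> C\<^sup>2 * \<bar>y - x\<bar>" if "y \<in> {a..b}" "y \<noteq> x" for y
      proof -
        have "\<bar>\<phi> y - \<phi> x\<bar> \<le> C\<^sup>2 * \<bar>y - x\<bar>\<^sup>2"
          using incr[of x y] incr[of y x] that \<open>x \<in> {a..b}\<close>
          by (cases "x \<le> y") (auto simp: abs_minus_commute power2_commute)
        then show ?thesis using that(2) by (simp add: divide_simps power2_eq_square mult.assoc)
      qed
      then show "\<forall>\<^sub>F y in at x within {a..b}. norm ((\<phi> y - \<phi> x) / (y - x)) \<le> C\<^sup>2 * \<bar>y - x\<bar>"
        by (auto simp: eventually_at_filter)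
      show "((\<lambda>y. C\<^sup>2 * \<bar>y - x\<bar>) \<longlongrightarrow> 0) (at x within {a..b})"
        by (auto intro!: tendsto_eq_intros)
    qed
    then have "\<exists>c. \<forall>x\<in>{a..b}. \<phi> x = c"
      by (intro has_field_derivative_zero_constant) auto
    then show ?thesis using ab by auto
  qed auto
  moreover have "\<phi> a = 1"
  proof -
    have "(LINT x:{a..a}|lborel. f x) = 0" for f :: "real \<Rightarrow> real"
    proof -
      have "(LINT x:{a..a}|lborel. f x) = (LINT x|lborel. indicator {a} x *\<^sub>R f a)"
        unfolding set_lebesgue_integral_def by (intro Bochner_Integration.integral_cong) (auto split: split_indicator)
      then show ?thesis by simp
    qed
    then show ?thesis by (simp add: \<phi>_def R_def)
  qed
  ultimately show ?thesis by (simp add: \<phi>_def g_def R_def)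
qed

section \<open>Finite products of probability kernels\<close>

lemma measurable_PiM_kernel:
  assumes fin: "finite I" and K: "\<And>i. i \<in> I \<Longrightarrow> K i \<in> L \<rightarrow>\<^sub>M prob_algebra (N i)"
  shows "(\<lambda>x. PiM I (\<lambda>i. K i x)) \<in> L \<rightarrow>\<^sub>M prob_algebra (PiM I N)"
proof (rule measurable_prob_algebra_generated[OF sets_PiM Int_stable_prod_algebra prod_algebra_sets_into_space])
  fix x assume x: "x \<in> space L"
  have p: "prob_space (K i x)" "sets (K i x) = sets (N i)" if "i \<in> I" for i
    using measurable_space[OF K[OF that] x] by (auto simp: space_prob_algebra)
  show "prob_space (PiM I (\<lambda>i. K i x))" using p by (intro prob_space_PiM)
  show "sets (PiM I (\<lambda>i. K i x)) = sets (PiM I N)" using p by (intro sets_PiM_cong) auto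
next
  fix X assume "X \<in> prod_algebra I N"
  then obtain A where X: "X = Pi\<^sub>E I A" and A: "\<And>i. i \<in> I \<Longrightarrow> A i \<in> sets (N i)"
    using fin by (auto simp: prod_algebra_eq_finite)
  have "emeasure (PiM I (\<lambda>i. K i x)) X = (\<Prod>i\<in>I. emeasure (K i x) (A i))" if x: "x \<in> space L" for x
  proof -
    have p: "prob_space (K i x)" "sets (K i x) = sets (N i)" if "i \<in> I" for i
      using measurable_space[OF K[OF that] x] by (auto simp: space_prob_algebra)
    \<comment> \<open>\<open>product_prob_space\<close> asks for a probability measure at every
      index, so indices outside \<open>I\<close> get a point mass, which the product over
      \<open>I\<close> does not see.\<close>
    define K' where "K' i = (if i \<in> I then K i x else return (count_space UNIV) undefined)" for i
    interpret product_prob_space K' I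
      by (intro product_prob_spaceI) (auto simp: K'_def p intro: prob_space_return)
    have "PiM I (\<lambda>i. K i x) = PiM I K'" by (intro PiM_cong) (auto simp: K'_def)
    then show ?thesis unfolding X using fin A p by (simp add: emeasure_PiM K'_def)
  qed
  moreover have "(\<lambda>x. \<Prod>i\<in>I. emeasure (K i x) (A i)) \<in> borel_measurable L"
    using A measurable_compose[OF measurable_prob_algebraD[OF K] measurable_emeasure_subprob_algebra]
    by (intro borel_measurable_prod_ennreal) blast
  ultimately show "(\<lambda>x. emeasure (PiM I (\<lambda>i. K i x)) X) \<in> borel_measurable L"
    by (simp cong: measurable_cong)
qed

section \<open>Cadlag paths evaluated at varying times\<close>

definition left_lim :: "'a::metric_space path \<Rightarrow> real \<Rightarrow> 'a" where
  "left_lim w u = (if 0 < u then Lim (at_left u) w else w 0)"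

lemma path_cadlag: "w \<in> space (path_space A) \<Longrightarrow> cadlag_on A w"
  by (auto simp: path_space_def space_restrict_space)

lemma path_space_eval:
  assumes "s \<in> A"
  shows "(\<lambda>w. w s) \<in> path_space A \<rightarrow>\<^sub>M borel"
  unfolding path_space_def using measurable_component_singleton[OF assms] by (rule measurable_restrict_space1)

lemma cadlag_left_lim:
  assumes w: "w \<in> space (path_space {0..})" and u: "0 < u"
  shows "(w \<longlongrightarrow> left_lim w u) (at_left u)"
proof -
  obtain l where "(w \<longlongrightarrow> l) (at u within ({0..} \<inter> {..<u}))"
    using path_cadlag[OF w] u unfolding cadlag_on_def by (metis atLeast_iff less_imp_le)
  moreover have "at u within ({0..} \<inter> {..<u}) = at_left u"
    using u by (intro at_within_nhd[where S="{0<..}"]) auto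
  ultimately have "(w \<longlongrightarrow> l) (at_left u)" by simp
  then show ?thesis using u by (simp add: left_lim_def tendsto_Lim)
qed

text \<open>The sigma-algebra on paths only knows evaluations at fixed times. A time with values in
  a grid takes countably many values, so evaluation there is still measurable; path regularity does
  the rest.\<close>

lemma measurable_path_eval_pair:
  "(\<lambda>(w, u). w (max 0 u)) \<in> path_space {0..} \<Otimes>\<^sub>M borel \<rightarrow>\<^sub>M (borel :: 'a::metric_space measure)"
proof -
  \<comment> \<open>a grid point to the right of \<open>u\<close>; it converges to \<open>u\<close>, and paths are right-continuous\<close>
  define q where "q n u = real_of_int (\<lfloor>real (Suc n) * max 0 u\<rfloor> + 1) / real (Suc n)" for n u
  show ?thesis
  proof (rule borel_measurable_LIMSEQ_metric)
    fix n
    have "(\<lambda>z. (\<lambda>k z. fst z (max 0 (real_of_int k / real (Suc n)))) (\<lfloor>real (Suc n) * max 0 (snd z)\<rfloor> + 1) z)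
       \<in> path_space {0..} \<Otimes>\<^sub>M borel \<rightarrow>\<^sub>M (borel :: 'a measure)"
      by (rule measurable_compose_countable) (rule measurable_compose[OF measurable_fst path_space_eval], simp, measurable)
    then show "(\<lambda>(w, u). w (max 0 (q n u))) \<in> path_space {0..} \<Otimes>\<^sub>M borel \<rightarrow>\<^sub>M (borel :: 'a measure)"
      by (simp add: q_def split_beta')
  next
    fix z :: "'a path \<times> real" assume z: "z \<in> space (path_space {0..} \<Otimes>\<^sub>M borel)"
    obtain w u where wu: "z = (w, u)" by (cases z)
    define s where "s = max 0 u"
    have s: "0 \<le> s" by (simp add: s_def)
    have w: "(w \<longlongrightarrow> w s) (at s within ({0..} \<inter> {s<..}))"
      using z path_cadlag[of w "{0..}"] s by (auto simp: wu space_pair_measure cadlag_on_def)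
    have b: "s < q n u" "q n u \<le> s + 1 / real (Suc n)" for n
      unfolding q_def s_def[symmetric] by (simp_all add: field_simps del: of_nat_Suc) linarith+
    have "(\<lambda>n. s + 1 / real (Suc n)) \<longlonglongrightarrow> s"
      using LIMSEQ_inverse_real_of_nat_add[of s] by (simp only: inverse_eq_divide)
    then have *: "(\<lambda>n. q n u) \<longlonglongrightarrow> s"
      by (rule real_tendsto_sandwich[OF always_eventually always_eventually tendsto_const, rotated 2])
         (use b less_imp_le in blast)+
    have "filterlim (\<lambda>n. q n u) (at s within ({0..} \<inter> {s<..})) sequentially"
      unfolding filterlim_at
    proof (intro conjI always_eventually allI)
      show "(\<lambda>n. q n u) \<longlonglongrightarrow> s" by (rule *)
      show "q n u \<in> {0..} \<inter> {s<..}" "q n u \<noteq> s" for n using b(1)[of n] s by simp_all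
    qed
    from filterlim_compose[OF w this] have "(\<lambda>n. w (q n u)) \<longlonglongrightarrow> w s" .
    moreover have "max 0 (q n u) = q n u" for n using b(1)[of n] s by simp
    ultimately show "(\<lambda>n. case z of (w, u) \<Rightarrow> w (max 0 (q n u))) \<longlonglongrightarrow> (case z of (w, u) \<Rightarrow> w (max 0 u))"
      by (simp add: wu s_def)
  qed
qed

lemma measurable_left_lim_pair:
  "(\<lambda>(w, u). left_lim w u) \<in> path_space {0..} \<Otimes>\<^sub>M borel \<rightarrow>\<^sub>M (borel :: 'a::metric_space measure)"
proof -
  \<comment> \<open>For \<open>u > 0\<close> this is the largest grid point strictly below
    \<open>u\<close>: \<open>\<lceil>x\<rceil> - 1\<close> and not the floor, since a left limit
    must not see the value at \<open>u\<close>. For \<open>u \<le> 0\<close> it is negative and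
    \<open>max 0\<close> sends it to \<open>0\<close>, matching the convention in
    \<open>left_lim\<close>.\<close>
  define q where "q n u = real_of_int (\<lceil>real (Suc n) * max 0 u\<rceil> - 1) / real (Suc n)" for n u
  show ?thesis
  proof (rule borel_measurable_LIMSEQ_metric)
    fix n
    have "(\<lambda>z. (\<lambda>k z. fst z (max 0 (real_of_int k / real (Suc n)))) (\<lceil>real (Suc n) * max 0 (snd z)\<rceil> - 1) z)
       \<in> path_space {0..} \<Otimes>\<^sub>M borel \<rightarrow>\<^sub>M (borel :: 'a measure)"
      by (rule measurable_compose_countable) (rule measurable_compose[OF measurable_fst path_space_eval], simp, measurable)
    then show "(\<lambda>(w, u). w (max 0 (q n u))) \<in> path_space {0..} \<Otimes>\<^sub>M borel \<rightarrow>\<^sub>M (borel :: 'a measure)"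
      by (simp add: q_def split_beta')
  next
    fix z :: "'a path \<times> real" assume z: "z \<in> space (path_space {0..} \<Otimes>\<^sub>M borel)"
    obtain w u where wu: "z = (w, u)" by (cases z)
    show "(\<lambda>n. case z of (w, u) \<Rightarrow> w (max 0 (q n u))) \<longlonglongrightarrow> (case z of (w, u) \<Rightarrow> left_lim w u)"
    proof (cases "0 < u")
      case False
      then have "max 0 u = 0" by auto
      then have "max 0 (q n u) = 0" for n
        by (simp only: q_def) (simp add: max_def divide_simps)
      then show ?thesis using False by (simp add: wu left_lim_def)
    next
      case True
      have w: "(w \<longlongrightarrow> left_lim w u) (at_left u)"
        using z True by (intro cadlag_left_lim) (auto simp: wu space_pair_measure)
      have b: "q n u < u" "u - 1 / real (Suc n) \<le> q n u" for n
        using True unfolding q_def by (simp_all add: field_simps del: of_nat_Suc) linarith+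
      have "(\<lambda>n. u - 1 / real (Suc n)) \<longlonglongrightarrow> u"
        using LIMSEQ_inverse_real_of_nat_add_minus[of u] by (simp only: inverse_eq_divide add_uminus_conv_diff)
      then have "(\<lambda>n. q n u) \<longlonglongrightarrow> u"
        by (rule real_tendsto_sandwich[OF always_eventually always_eventually _ tendsto_const, rotated 2])
           (use b less_imp_le in blast)+
      then have *: "(\<lambda>n. max 0 (q n u)) \<longlonglongrightarrow> max 0 u" by (intro tendsto_intros)
      have "filterlim (\<lambda>n. max 0 (q n u)) (at_left u) sequentially"
        unfolding filterlim_at
      proof (intro conjI always_eventually allI)
        show "(\<lambda>n. max 0 (q n u)) \<longlonglongrightarrow> u" using * True by simp
        show "max 0 (q n u) \<in> {..<u}" "max 0 (q n u) \<noteq> u" for n using b(1)[of n] True by (simp_all add: max_def)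
      qed
      from filterlim_compose[OF w this] show ?thesis by (simp add: wu)
    qed
  qed
qed

lemma measurable_path_eval:
  assumes "f \<in> L \<rightarrow>\<^sub>M path_space {0..}" "g \<in> borel_measurable L"
  shows "(\<lambda>x. f x (max 0 (g x))) \<in> borel_measurable L"
  using measurable_compose[OF measurable_Pair[OF assms] measurable_path_eval_pair] by simp

lemma measurable_left_lim:
  assumes "f \<in> L \<rightarrow>\<^sub>M path_space {0..}" "g \<in> borel_measurable L"
  shows "(\<lambda>x. left_lim (f x) (g x)) \<in> borel_measurable L"
  using measurable_compose[OF measurable_Pair[OF assms] measurable_left_lim_pair] by simp

section \<open>One-step operators and their behaviour under relabelling\<close>

text \<open>Jump time, terminal values, complete ancestral tree, genealogical tree. The terminal values are
  stored separately because the evaluation of a path at a random time is not measurable for the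
  product sigma-algebra that the rows carry here.\<close>

type_synonym 'a tree_state = "real \<times> (nat \<Rightarrow> 'a) \<times> 'a rows \<times> 'a rows"

text \<open>A path on \<open>[0,u]\<close>, kept over the fixed index set \<open>{0..}\<close> with
  the value \<open>undefined\<close> after \<open>u\<close>: as \<open>u\<close> is random, the
  states need one space for all jump times.\<close>

definition splice :: "real \<Rightarrow> real \<Rightarrow> 'a path \<Rightarrow> 'a path \<Rightarrow> 'a \<Rightarrow> 'a path" where
  "splice \<tau> u x w l =
     (\<lambda>s\<in>{0..}. if s = u then l else if s < u then (if s \<le> \<tau> then x s else w s) else undefined)"

text \<open>Row \<open>i\<close> after a jump ends in the tip of row \<open>tip_source i\<close>; its past comes from row
  \<open>past_source i\<close> in the complete ancestral tree and from row \<open>tip_source i\<close> in the genealogical tree.\<close>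

fun moved_row :: "move \<Rightarrow> nat" where
  "moved_row (Replace i j) = i"
| "moved_row (Exchange i k) = i"

fun tip_source :: "move \<Rightarrow> nat \<Rightarrow> nat" where
  "tip_source (Replace i j) = id(i := j)"
| "tip_source (Exchange i k) = id(i := k)"

fun past_source :: "move \<Rightarrow> nat \<Rightarrow> nat" where
  "past_source (Replace i j) = id"
| "past_source (Exchange i k) = id(i := k, k := i)"

text \<open>What the two models share: kernel and potential. The one-step operators depend on
  nothing else of a model, so one family of operators serves both.\<close>

locale potential_setting =
  fixes N :: nat
    and P :: "real \<Rightarrow> 'a::metric_space \<Rightarrow> 'a path measure"
    and V :: "real \<Rightarrow> 'a \<Rightarrow> real"
    and C :: real
  assumes kernel:
      "(\<lambda>(s, x). P s x) \<in> restrict_space borel {0..} \<Otimes>\<^sub>M borel \<rightarrow>\<^sub>M prob_algebra (path_space {0..})"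
    and V_measurable: "(\<lambda>(s, x). V s x) \<in> borel_measurable (restrict_space borel {0..} \<Otimes>\<^sub>M borel)"
    and V_nonneg: "\<And>s x. 0 \<le> s \<Longrightarrow> 0 \<le> V s x"
    and V_le: "\<And>s x. 0 \<le> s \<Longrightarrow> V s x \<le> C"
begin

text \<open>\<open>P\<close> and \<open>V\<close> are only constrained at nonnegative times; evaluating them at \<open>max 0 s\<close> gives
  functions that are measurable on the whole line.\<close>

abbreviation tips where "tips \<equiv> (\<Pi>\<^sub>M i\<in>{1..N}. (borel :: 'a measure))"
abbreviation raw_rows where "raw_rows A \<equiv> (\<Pi>\<^sub>M i\<in>{1..N}. \<Pi>\<^sub>M s\<in>A. (borel :: 'a measure))"
abbreviation motions where "motions \<equiv> (\<Pi>\<^sub>M i\<in>{1..N}. (path_space {0..} :: 'a path measure))"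
abbreviation states where
  "states \<equiv> (borel :: real measure) \<Otimes>\<^sub>M tips \<Otimes>\<^sub>M raw_rows {0..} \<Otimes>\<^sub>M raw_rows {0..}"

lemma max_time: "(\<lambda>(s, x). (max 0 s, x)) \<in> borel \<Otimes>\<^sub>M borel \<rightarrow>\<^sub>M restrict_space (borel :: real measure) {0..} \<Otimes>\<^sub>M (borel :: 'a measure)"
  unfolding split_beta' by (intro measurable_Pair measurable_restrict_space2) auto

lemma kernel_max[measurable (raw)]:
  assumes "f \<in> borel_measurable L" "g \<in> borel_measurable L"
  shows "(\<lambda>z. P (max 0 (f z)) (g z)) \<in> L \<rightarrow>\<^sub>M prob_algebra (path_space {0..})"
  using measurable_compose[OF measurable_compose[OF measurable_Pair[OF assms] max_time] kernel] by simp

lemma V_max_measurable[measurable (raw)]: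
  assumes "f \<in> borel_measurable L" "g \<in> borel_measurable L"
  shows "(\<lambda>z. V (max 0 (f z)) (g z)) \<in> borel_measurable L"
  using measurable_compose[OF measurable_compose[OF measurable_Pair[OF assms] max_time] V_measurable] by simp

lemma V_max_bounds: "0 \<le> V (max 0 s) x" "V (max 0 s) x \<le> C"
  using V_nonneg[of "max 0 s" x] V_le[of "max 0 s" x] by auto

lemma motion_row[measurable (raw)]:
  assumes "f \<in> L \<rightarrow>\<^sub>M motions" "i \<in> {1..N}"
  shows "(\<lambda>z. f z i) \<in> L \<rightarrow>\<^sub>M path_space {0..}"
  using measurable_compose[OF assms(1) measurable_component_singleton[OF assms(2)]] .

lemma raw_rows_eval:
  assumes "f \<in> L \<rightarrow>\<^sub>M raw_rows A" "i \<in> {1..N}" "s \<in> A"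
  shows "(\<lambda>z. f z i s) \<in> borel_measurable L"
  using measurable_compose[OF measurable_compose[OF assms(1) measurable_component_singleton[OF assms(2)]]
      measurable_component_singleton[OF assms(3)]] .

lemma motion_eval:
  assumes "f \<in> L \<rightarrow>\<^sub>M motions" "i \<in> {1..N}" "0 \<le> s"
  shows "(\<lambda>z. f z i s) \<in> borel_measurable L"
  using measurable_compose[OF motion_row[OF assms(1,2)] path_space_eval[of s "{0..}"]] assms(3) by simp

text \<open>Three choices of weights occur: \<open>q\<close> for the discount, \<open>1 - q\<close>
  for the total jump rate, and \<open>1\<close> for their sum.\<close>

definition weighted_potential :: "(nat \<Rightarrow> real) \<Rightarrow> 'a rows \<Rightarrow> real \<Rightarrow> real" where
  "weighted_potential q w v = (\<Sum>i\<in>{1..N}. q i * V (max 0 v) (w i (max 0 v)))"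

definition accumulated :: "(nat \<Rightarrow> real) \<Rightarrow> 'a rows \<Rightarrow> real \<Rightarrow> real \<Rightarrow> real" where
  "accumulated q w a b = (LINT v:{a..b}|lborel. weighted_potential q w v)"

lemma weighted_potential_measurable[measurable (raw)]:
  assumes "f \<in> L \<rightarrow>\<^sub>M motions" "g \<in> borel_measurable L"
  shows "(\<lambda>z. weighted_potential q (f z) (g z)) \<in> borel_measurable L"
  unfolding weighted_potential_def
  by (intro borel_measurable_sum borel_measurable_times borel_measurable_const
      V_max_measurable[OF assms(2) measurable_path_eval[OF motion_row[OF assms(1)] assms(2)]])

lemma accumulated_measurable[measurable (raw)]:
  assumes "f \<in> L \<rightarrow>\<^sub>M motions" "a \<in> borel_measurable L" "b \<in> borel_measurable L"
  shows "(\<lambda>z. accumulated q (f z) (a z) (b z)) \<in> borel_measurable L"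
  unfolding accumulated_def using assms
  by (intro measurable_LINT_interval)
     (auto simp: split_beta' intro!: weighted_potential_measurable measurable_compose[OF measurable_fst])

text \<open>Arbitrary index maps take the place of moves: a move followed by a relabelling is in
  general no move, but its index maps can still be composed. The motion \<open>w (\<rho> i)\<close>
  goes with the past \<open>h (\<rho> i)\<close>, so a row read from elsewhere brings along its own
  last stretch.\<close>

definition step :: "(nat \<Rightarrow> nat) \<Rightarrow> (nat \<Rightarrow> nat) \<Rightarrow> 'a tree_state \<Rightarrow> 'a rows \<Rightarrow> real \<Rightarrow> 'a tree_state" where
  "step \<pi> \<rho> = (\<lambda>(\<tau>, y, h, g) w u.
     (u, \<lambda>i\<in>{1..N}. left_lim (w (\<pi> i)) u,
      \<lambda>i\<in>{1..N}. splice \<tau> u (h (\<rho> i)) (w (\<rho> i)) (left_lim (w (\<pi> i)) u),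
      \<lambda>i\<in>{1..N}. splice \<tau> u (g (\<pi> i)) (w (\<pi> i)) (left_lim (w (\<pi> i)) u)))"

lemma splice_rows_measurable:
  assumes [measurable]: "\<tau> \<in> borel_measurable L" "u \<in> borel_measurable L"
    and h: "h \<in> L \<rightarrow>\<^sub>M raw_rows {0..}" and w: "w \<in> L \<rightarrow>\<^sub>M motions"
    and \<rho>: "\<And>i. i \<in> {1..N} \<Longrightarrow> \<rho> i \<in> {1..N}" and \<pi>: "\<And>i. i \<in> {1..N} \<Longrightarrow> \<pi> i \<in> {1..N}"
  shows "(\<lambda>z. \<lambda>i\<in>{1..N}. splice (\<tau> z) (u z) (h z (\<rho> i)) (w z (\<rho> i)) (left_lim (w z (\<pi> i)) (u z))) \<in> L \<rightarrow>\<^sub>M raw_rows {0..}"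
proof (rule measurable_restrict)
  fix i assume i: "i \<in> {1..N}"
  show "(\<lambda>z. splice (\<tau> z) (u z) (h z (\<rho> i)) (w z (\<rho> i)) (left_lim (w z (\<pi> i)) (u z))) \<in> L \<rightarrow>\<^sub>M (\<Pi>\<^sub>M s\<in>{0..}. (borel :: 'a measure))"
    unfolding splice_def
  proof (rule measurable_restrict)
    fix s :: real assume s: "s \<in> {0..}"
    have [measurable]: "(\<lambda>z. h z (\<rho> i) s) \<in> borel_measurable L"
      by (rule raw_rows_eval[OF h \<rho>[OF i] s])
    have [measurable]: "(\<lambda>z. w z (\<rho> i) s) \<in> borel_measurable L"
      using s by (intro motion_eval[OF w \<rho>[OF i]]) simp
    have [measurable]: "(\<lambda>z. left_lim (w z (\<pi> i)) (u z)) \<in> borel_measurable L"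
      by (intro measurable_left_lim motion_row[OF w \<pi>[OF i]]) measurable
    show "(\<lambda>z. if s = u z then left_lim (w z (\<pi> i)) (u z) else if s < u z then if s \<le> \<tau> z then h z (\<rho> i) s else w z (\<rho> i) s
           else undefined) \<in> borel_measurable L"
      by measurable
  qed
qed

lemma step_measurable:
  assumes \<eta>[measurable]: "\<eta> \<in> L \<rightarrow>\<^sub>M states" and w[measurable]: "w \<in> L \<rightarrow>\<^sub>M motions"
    and u[measurable]: "u \<in> borel_measurable L"
    and \<rho>: "\<And>i. i \<in> {1..N} \<Longrightarrow> \<rho> i \<in> {1..N}" and \<pi>: "\<And>i. i \<in> {1..N} \<Longrightarrow> \<pi> i \<in> {1..N}"
  shows "(\<lambda>z. step \<pi> \<rho> (\<eta> z) (w z) (u z)) \<in> L \<rightarrow>\<^sub>M states"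
  unfolding step_def split_beta'
proof (intro measurable_Pair u splice_rows_measurable w \<rho> \<pi>)
  show "(\<lambda>x. \<lambda>i\<in>{1..N}. left_lim (w x (\<pi> i)) (u x)) \<in> L \<rightarrow>\<^sub>M tips"
    by (intro measurable_restrict measurable_left_lim motion_row[OF w \<pi>] u)
qed measurable

abbreviation motion_law :: "'a tree_state \<Rightarrow> 'a rows measure" where
  "motion_law \<eta> \<equiv> (\<Pi>\<^sub>M i\<in>{1..N}. P (max 0 (fst \<eta>)) (fst (snd \<eta>) i))"

lemma motion_law_kernel:
  "motion_law \<in> states \<rightarrow>\<^sub>M prob_algebra motions"
proof (rule measurable_PiM_kernel)
  fix i assume "i \<in> {1..N}"
  then show "(\<lambda>\<eta>. P (max 0 (fst \<eta>)) (fst (snd \<eta>) i)) \<in> states \<rightarrow>\<^sub>M prob_algebra (path_space {0..})"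
    by (intro kernel_max measurable_compose[OF measurable_snd measurable_compose[OF measurable_fst measurable_component_singleton]]) auto
qed simp

text \<open>The density of a jump at \<open>u\<close> after weighting: survival factor and discount
  have merged into one exponential of the full sum of potentials, and neither the set of moves nor
  the weights \<open>q\<close> appear. The row \<open>a\<close> that sets the rate is kept apart
  from the index maps because relabelling the output changes the maps and leaves \<open>a\<close>
  alone.\<close>

definition jump_density :: "nat \<Rightarrow> (nat \<Rightarrow> nat) \<Rightarrow> (nat \<Rightarrow> nat) \<Rightarrow> ('a tree_state \<Rightarrow> ennreal) \<Rightarrow> 'a tree_state \<Rightarrow> 'a rows \<Rightarrow> real \<Rightarrow> ennreal" where
  "jump_density a \<pi> \<rho> \<Phi> \<eta> w u =
     (if fst \<eta> \<le> u then ennreal (V (max 0 u) (w a (max 0 u)) / N * exp (- accumulated (\<lambda>_. 1) w (fst \<eta>) u)) else 0)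
     * \<Phi> (step \<pi> \<rho> \<eta> w u)"

definition jump_op :: "nat \<Rightarrow> (nat \<Rightarrow> nat) \<Rightarrow> (nat \<Rightarrow> nat) \<Rightarrow> ('a tree_state \<Rightarrow> ennreal) \<Rightarrow> 'a tree_state \<Rightarrow> ennreal" where
  "jump_op a \<pi> \<rho> \<Phi> \<eta> = (\<integral>\<^sup>+w. \<integral>\<^sup>+u. jump_density a \<pi> \<rho> \<Phi> \<eta> w u \<partial>lborel \<partial>motion_law \<eta>)"

lemma jump_density_measurable:
  assumes \<Phi>: "\<Phi> \<in> borel_measurable states" and a: "a \<in> {1..N}"
    and \<rho>: "\<And>i. i \<in> {1..N} \<Longrightarrow> \<rho> i \<in> {1..N}" and \<pi>: "\<And>i. i \<in> {1..N} \<Longrightarrow> \<pi> i \<in> {1..N}"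
    and \<eta>: "\<eta> \<in> L \<rightarrow>\<^sub>M states" and w: "w \<in> L \<rightarrow>\<^sub>M motions"
    and u[measurable]: "u \<in> borel_measurable L"
  shows "(\<lambda>z. jump_density a \<pi> \<rho> \<Phi> (\<eta> z) (w z) (u z)) \<in> borel_measurable L"
proof -
  have [measurable]: "(\<lambda>z. fst (\<eta> z)) \<in> borel_measurable L"
    by (rule measurable_compose[OF \<eta> measurable_fst])
  have [measurable]: "(\<lambda>z. \<Phi> (step \<pi> \<rho> (\<eta> z) (w z) (u z))) \<in> borel_measurable L"
    using measurable_compose[OF step_measurable[OF \<eta> w u \<rho> \<pi>] \<Phi>] .
  have [measurable]: "(\<lambda>z. V (max 0 (u z)) (w z a (max 0 (u z)))) \<in> borel_measurable L"
    by (rule V_max_measurable[OF u measurable_path_eval[OF motion_row[OF w a] u]])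
  have [measurable]: "(\<lambda>z. accumulated (\<lambda>_. 1) (w z) (fst (\<eta> z)) (u z)) \<in> borel_measurable L"
    by (rule accumulated_measurable[OF w]) measurable
  show ?thesis unfolding jump_density_def by measurable
qed

lemma jump_density_nn_integral_measurable:
  assumes \<Phi>: "\<Phi> \<in> borel_measurable states" and a: "a \<in> {1..N}"
    and \<rho>: "\<And>i. i \<in> {1..N} \<Longrightarrow> \<rho> i \<in> {1..N}" and \<pi>: "\<And>i. i \<in> {1..N} \<Longrightarrow> \<pi> i \<in> {1..N}"
    and \<eta>: "\<eta> \<in> L \<rightarrow>\<^sub>M states" and w: "w \<in> L \<rightarrow>\<^sub>M motions"
  shows "(\<lambda>z. \<integral>\<^sup>+u. jump_density a \<pi> \<rho> \<Phi> (\<eta> z) (w z) u \<partial>lborel) \<in> borel_measurable L"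
proof (rule lborel.borel_measurable_nn_integral)
  show "(\<lambda>(z, u). jump_density a \<pi> \<rho> \<Phi> (\<eta> z) (w z) u) \<in> borel_measurable (L \<Otimes>\<^sub>M lborel)"
    unfolding split_beta'
    by (rule jump_density_measurable[OF \<Phi> a \<rho> \<pi> measurable_compose[OF measurable_fst \<eta>] measurable_compose[OF measurable_fst w]])
      measurable
qed

lemma jump_op_measurable:
  assumes "\<Phi> \<in> borel_measurable states" "a \<in> {1..N}"
    and "\<And>i. i \<in> {1..N} \<Longrightarrow> \<rho> i \<in> {1..N}" and "\<And>i. i \<in> {1..N} \<Longrightarrow> \<pi> i \<in> {1..N}"
  shows "jump_op a \<pi> \<rho> \<Phi> \<in> borel_measurable states"
  unfolding jump_op_def
  by (intro nn_integral_measurable_subprob_algebra2[OF _ measurable_prob_algebraD[OF motion_law_kernel]])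
     (simp only: split_beta', rule jump_density_nn_integral_measurable[OF assms measurable_fst measurable_snd])

text \<open>The last factor of a term: no further jump up to \<open>t\<close>, and zero if the
  current jump falls after \<open>t\<close>. The set \<open>A\<close> lives in the raw product
  space, since the states carry raw rows with no regularity.\<close>

definition final_op :: "real \<Rightarrow> ('a rows \<times> 'a rows) set \<Rightarrow> 'a tree_state \<Rightarrow> ennreal" where
  "final_op t A \<eta> = (if fst \<eta> \<le> t then \<integral>\<^sup>+w. ennreal (exp (- accumulated (\<lambda>_. 1) w (fst \<eta>) t)) *
     indicator A (map_prod (prolong N (fst \<eta>) t w) (prolong N (fst \<eta>) t w) (snd (snd \<eta>))) \<partial>motion_law \<eta> else 0)"

lemma prolong_measurable:
  assumes [measurable]: "\<tau> \<in> borel_measurable L"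
    and h: "h \<in> L \<rightarrow>\<^sub>M raw_rows {0..}" and w: "w \<in> L \<rightarrow>\<^sub>M motions"
  shows "(\<lambda>z. prolong N (\<tau> z) t (w z) (h z)) \<in> L \<rightarrow>\<^sub>M raw_rows {0..t}"
  unfolding prolong_def
proof (intro measurable_restrict)
  fix i s assume i: "i \<in> {1..N}" and s: "s \<in> {0..t}"
  have [measurable]: "(\<lambda>z. h z i s) \<in> borel_measurable L"
    using s by (intro raw_rows_eval[OF h i]) auto
  have [measurable]: "(\<lambda>z. w z i s) \<in> borel_measurable L"
    using s by (intro motion_eval[OF w i]) simp
  show "(\<lambda>z. if s \<le> \<tau> z then h z i s else w z i s) \<in> borel_measurable L" by measurable
qed

lemma prolong_pair_measurable:
  assumes [measurable]: "\<eta> \<in> L \<rightarrow>\<^sub>M states" and w: "w \<in> L \<rightarrow>\<^sub>M motions"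
  shows "(\<lambda>z. map_prod (prolong N (fst (\<eta> z)) t (w z)) (prolong N (fst (\<eta> z)) t (w z)) (snd (snd (\<eta> z))))
    \<in> L \<rightarrow>\<^sub>M raw_rows {0..t} \<Otimes>\<^sub>M raw_rows {0..t}"
  unfolding map_prod_def split_beta' by (intro measurable_Pair prolong_measurable w) measurable

lemma final_integrand_measurable:
  assumes A: "A \<in> sets (raw_rows {0..t} \<Otimes>\<^sub>M raw_rows {0..t})"
    and \<eta>[measurable]: "\<eta> \<in> L \<rightarrow>\<^sub>M states" and w[measurable]: "w \<in> L \<rightarrow>\<^sub>M motions"
  shows "(\<lambda>z. ennreal (exp (- accumulated (\<lambda>_. 1) (w z) (fst (\<eta> z)) t)) *
     indicator A (map_prod (prolong N (fst (\<eta> z)) t (w z)) (prolong N (fst (\<eta> z)) t (w z)) (snd (snd (\<eta> z))))) \<in> borel_measurable L"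
proof -
  have [measurable]: "(\<lambda>z. fst (\<eta> z)) \<in> borel_measurable L"
    by (rule measurable_compose[OF \<eta> measurable_fst])
  have [measurable]: "(\<lambda>z. accumulated (\<lambda>_. 1) (w z) (fst (\<eta> z)) t) \<in> borel_measurable L"
    by (rule accumulated_measurable[OF w]) measurable
  have [measurable]: "(\<lambda>z. indicator A (map_prod (prolong N (fst (\<eta> z)) t (w z)) (prolong N (fst (\<eta> z)) t (w z)) (snd (snd (\<eta> z)))) :: ennreal)
      \<in> borel_measurable L"
    by (rule measurable_compose[OF prolong_pair_measurable[OF \<eta> w] borel_measurable_indicator[OF A]])
  show ?thesis by measurable
qed

lemma final_op_measurable:
  assumes A: "A \<in> sets (raw_rows {0..t} \<Otimes>\<^sub>M raw_rows {0..t})"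
  shows "final_op t A \<in> borel_measurable states"
proof -
  have [measurable]: "(\<lambda>\<eta>. \<integral>\<^sup>+w. ennreal (exp (- accumulated (\<lambda>_. 1) w (fst \<eta>) t)) *
     indicator A (map_prod (prolong N (fst \<eta>) t w) (prolong N (fst \<eta>) t w) (snd (snd \<eta>))) \<partial>motion_law \<eta>) \<in> borel_measurable states"
    by (intro nn_integral_measurable_subprob_algebra2[OF _ measurable_prob_algebraD[OF motion_law_kernel]])
      (simp only: split_beta', rule final_integrand_measurable[OF A measurable_fst measurable_snd])
  show ?thesis unfolding final_op_def by measurable
qed

section \<open>Relabelling of the rows\<close>

definition relabel :: "(nat \<Rightarrow> nat) \<Rightarrow> 'a tree_state \<Rightarrow> 'a tree_state" where
  "relabel \<sigma> = (\<lambda>(\<tau>, y, h, g). (\<tau>, \<lambda>i\<in>{1..N}. y (\<sigma> i), \<lambda>i\<in>{1..N}. h (\<sigma> i), \<lambda>i\<in>{1..N}. g (\<sigma> i)))"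

lemma restrict_reindex_measurable:
  assumes "f \<in> L \<rightarrow>\<^sub>M PiM I (\<lambda>_. K)" "\<And>i. i \<in> I \<Longrightarrow> \<sigma> i \<in> I"
  shows "(\<lambda>z. \<lambda>i\<in>I. f z (\<sigma> i)) \<in> L \<rightarrow>\<^sub>M PiM I (\<lambda>_. K)"
  by (intro measurable_restrict measurable_compose[OF assms(1) measurable_component_singleton] assms(2))

lemma relabel_measurable:
  assumes "\<And>i. i \<in> {1..N} \<Longrightarrow> \<sigma> i \<in> {1..N}"
  shows "relabel \<sigma> \<in> states \<rightarrow>\<^sub>M states"
  unfolding relabel_def split_beta' using assms
  by (intro measurable_Pair restrict_reindex_measurable) measurable

lemma relabel_step:
  "(\<And>i. i \<in> {1..N} \<Longrightarrow> \<sigma> i \<in> {1..N}) \<Longrightarrow> relabel \<sigma> (step \<pi> \<rho> \<eta> w u) = step (\<pi> \<circ> \<sigma>) (\<rho> \<circ> \<sigma>) \<eta> w u"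
  by (auto simp: relabel_def step_def split_beta' fun_eq_iff restrict_def)

lemma jump_op_relabel_output:
  "(\<And>i. i \<in> {1..N} \<Longrightarrow> \<sigma> i \<in> {1..N}) \<Longrightarrow>
   jump_op a \<pi> \<rho> (\<lambda>\<eta>. \<Phi> (relabel \<sigma> \<eta>)) = jump_op a (\<pi> \<circ> \<sigma>) (\<rho> \<circ> \<sigma>) \<Phi>"
proof -
  assume "\<And>i. i \<in> {1..N} \<Longrightarrow> \<sigma> i \<in> {1..N}"
  then have "jump_density a \<pi> \<rho> (\<lambda>\<eta>. \<Phi> (relabel \<sigma> \<eta>)) = jump_density a (\<pi> \<circ> \<sigma>) (\<rho> \<circ> \<sigma>) \<Phi>"
    by (intro ext) (simp only: jump_density_def relabel_step)
  then show ?thesis unfolding jump_op_def[abs_def] by simp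
qed

text \<open>Permuting the starting values of independent motions amounts to permuting the motions,
  by reindexing of product measures. The total potential in the exponential is a symmetric sum, and
  the rate follows its row from \<open>a\<close> to \<open>\<sigma> a\<close>. Restricting to
  involutions spares an inverse and still covers the transpositions that exchanges call for.\<close>

lemma jump_op_relabel_input:
  assumes \<sigma>: "\<And>i. i \<in> {1..N} \<Longrightarrow> \<sigma> i \<in> {1..N}" and inv: "\<And>i. \<sigma> (\<sigma> i) = i"
    and \<rho>: "\<And>i. i \<in> {1..N} \<Longrightarrow> \<rho> i \<in> {1..N}" and \<pi>: "\<And>i. i \<in> {1..N} \<Longrightarrow> \<pi> i \<in> {1..N}"
    and a: "a \<in> {1..N}" and \<Phi>: "\<Phi> \<in> borel_measurable states" and \<eta>: "\<eta> \<in> space states"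
  shows "jump_op a \<pi> \<rho> \<Phi> \<eta> = jump_op (\<sigma> a) (\<sigma> \<circ> \<pi>) (\<sigma> \<circ> \<rho>) \<Phi> (relabel \<sigma> \<eta>)"
proof -
  let ?\<eta> = "relabel \<sigma> \<eta>"
  let ?w = "\<lambda>w. \<lambda>i\<in>{1..N}. w (\<sigma> i)"
  have fst_eq: "fst ?\<eta> = fst \<eta>" by (simp add: relabel_def split_beta')
  have \<eta>': "?\<eta> \<in> space states"
    using measurable_space[OF relabel_measurable[OF \<sigma>] \<eta>] by simp
  have prob: "prob_space (P (max 0 s) x)" and setsP: "sets (P (max 0 s) x) = sets (path_space {0..})" for s x
    using measurable_space[OF kernel_max[of "\<lambda>_. s" "count_space UNIV" "\<lambda>_. x"], of undefined]
    by (auto simp: space_prob_algebra)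
  have sets_ml: "sets (motion_law \<eta>) = sets motions" for \<eta>
    by (intro sets_PiM_cong setsP) auto
  have "motion_law ?\<eta> = (\<Pi>\<^sub>M i\<in>{1..N}. P (max 0 (fst \<eta>)) (fst (snd \<eta>) (\<sigma> i)))"
    by (intro PiM_cong) (auto simp: relabel_def split_beta')
  also have "\<dots> = distr (motion_law \<eta>) (\<Pi>\<^sub>M i\<in>{1..N}. P (max 0 (fst \<eta>)) (fst (snd \<eta>) (\<sigma> i))) ?w"
    using \<sigma> inv by (intro distr_PiM_reindex[symmetric] prob) (auto intro: inj_on_inverseI[of _ \<sigma>])
  also have "\<dots> = distr (motion_law \<eta>) motions ?w"
    by (intro distr_cong refl sets_PiM_cong setsP)
  finally have law: "motion_law ?\<eta> = distr (motion_law \<eta>) motions ?w" .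
  have wm: "?w \<in> motion_law \<eta> \<rightarrow>\<^sub>M motions"
    by (subst measurable_cong_sets[OF sets_ml refl])
       (rule restrict_reindex_measurable[OF measurable_ident_sets[OF refl] \<sigma>])
  have im: "(\<lambda>w. \<integral>\<^sup>+u. jump_density (\<sigma> a) (\<sigma> \<circ> \<pi>) (\<sigma> \<circ> \<rho>) \<Phi> ?\<eta> w u \<partial>lborel) \<in> borel_measurable motions"
    using \<sigma> \<rho> \<pi> a \<eta>' by (intro jump_density_nn_integral_measurable[OF \<Phi>]) auto
  have eq: "jump_density (\<sigma> a) (\<sigma> \<circ> \<pi>) (\<sigma> \<circ> \<rho>) \<Phi> ?\<eta> (?w w) = jump_density a \<pi> \<rho> \<Phi> \<eta> w" for w
  proof (rule ext)
    fix u
    have "weighted_potential (\<lambda>_. 1) (?w w) v = weighted_potential (\<lambda>_. 1) w v" for v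
      unfolding weighted_potential_def
      using \<sigma> inv by (intro sum.reindex_bij_witness[of _ \<sigma> \<sigma>]) auto
    moreover have "step (\<sigma> \<circ> \<pi>) (\<sigma> \<circ> \<rho>) ?\<eta> (?w w) u = step \<pi> \<rho> \<eta> w u"
      using \<sigma> \<rho> \<pi> inv by (auto simp: step_def relabel_def split_beta' fun_eq_iff restrict_def)
    ultimately show "jump_density (\<sigma> a) (\<sigma> \<circ> \<pi>) (\<sigma> \<circ> \<rho>) \<Phi> ?\<eta> (?w w) u = jump_density a \<pi> \<rho> \<Phi> \<eta> w u"
      using \<sigma>[OF a] inv by (simp add: jump_density_def accumulated_def fst_eq)
  qed
  show ?thesis
    unfolding jump_op_def law using im by (subst nn_integral_distr[OF wm]) (simp_all only: eq measurable_distr_eq1)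
qed

section \<open>The operators of the moves and their symmetries\<close>

definition valid_move :: "move \<Rightarrow> bool" where
  "valid_move e \<longleftrightarrow> moved_row e \<in> {1..N} \<and> (\<forall>i\<in>{1..N}. tip_source e i \<in> {1..N} \<and> past_source e i \<in> {1..N})"

lemma valid_particle_moves: "e \<in> particle_moves N \<Longrightarrow> valid_move e"
  by (auto simp: particle_moves_def valid_move_def)

lemma valid_dual_moves: "k \<in> {1..N} \<Longrightarrow> e \<in> dual_moves N k \<Longrightarrow> valid_move e"
  by (auto simp: dual_moves_def valid_move_def)

definition move_op :: "move \<Rightarrow> ('a tree_state \<Rightarrow> ennreal) \<Rightarrow> 'a tree_state \<Rightarrow> ennreal" where
  "move_op e = jump_op (moved_row e) (tip_source e) (past_source e)"

lemma move_op_measurable: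
  "valid_move e \<Longrightarrow> \<Phi> \<in> borel_measurable states \<Longrightarrow> move_op e \<Phi> \<in> borel_measurable states"
  unfolding move_op_def valid_move_def by (intro jump_op_measurable) auto

text \<open>Relabelling before and after the jump conjugates the index maps:
  \<open>id(i := j)\<close> becomes \<open>id(\<sigma> i := \<sigma> j)\<close>, and the identity
  stays.\<close>

lemma move_op_Replace_relabel:
  assumes \<sigma>: "\<And>i. i \<in> {1..N} \<Longrightarrow> \<sigma> i \<in> {1..N}" and inv: "\<And>i. \<sigma> (\<sigma> i) = i"
    and ij: "i \<in> {1..N}" "j \<in> {1..N}" and \<Phi>: "\<Phi> \<in> borel_measurable states" and \<eta>: "\<eta> \<in> space states"
  shows "move_op (Replace i j) (\<lambda>\<eta>. \<Phi> (relabel \<sigma> \<eta>)) \<eta> = move_op (Replace (\<sigma> i) (\<sigma> j)) \<Phi> (relabel \<sigma> \<eta>)"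
proof -
  have "move_op (Replace i j) (\<lambda>\<eta>. \<Phi> (relabel \<sigma> \<eta>)) \<eta> = jump_op i (id(i := j) \<circ> \<sigma>) (id \<circ> \<sigma>) \<Phi> \<eta>"
    by (simp only: move_op_def moved_row.simps tip_source.simps past_source.simps jump_op_relabel_output[where \<Phi>=\<Phi>, OF \<sigma>])
  also have "\<dots> = jump_op (\<sigma> i) (\<sigma> \<circ> (id(i := j) \<circ> \<sigma>)) (\<sigma> \<circ> (id \<circ> \<sigma>)) \<Phi> (relabel \<sigma> \<eta>)"
    using \<sigma> ij by (intro jump_op_relabel_input[OF \<sigma> inv _ _ _ \<Phi> \<eta>]) auto
  also have "\<dots> = jump_op (\<sigma> i) (id(\<sigma> i := \<sigma> j)) id \<Phi> (relabel \<sigma> \<eta>)"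
  proof -
    have "\<sigma> \<circ> (id(i := j) \<circ> \<sigma>) = id(\<sigma> i := \<sigma> j)" "\<sigma> \<circ> (id \<circ> \<sigma>) = id"
      using inv by (auto simp: fun_eq_iff)
    then show ?thesis by simp
  qed
  finally show ?thesis by (simp add: move_op_def)
qed

text \<open>Let \<sigma> swap \<open>i\<close> and \<open>k\<close>. Composed with \<sigma>, the
  past map becomes the identity and the tip map \<open>id(i := k)\<close> becomes
  \<open>id(k := i)\<close>: copying \<open>k\<close> over \<open>i\<close> while swapping the pasts
  is, in the new labels, copying \<open>i\<close> over \<open>k\<close>. The rate set by row
  \<open>i\<close> is then set by the row labelled \<open>k\<close>, as a replacement of
  \<open>k\<close> requires.\<close>

lemma move_op_Exchange:
  assumes ik: "i \<in> {1..N}" "k \<in> {1..N}" "i \<noteq> k" and \<Phi>: "\<Phi> \<in> borel_measurable states" and \<eta>: "\<eta> \<in> space states"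
  shows "move_op (Exchange i k) \<Phi> \<eta> = move_op (Replace k i) \<Phi> (relabel (id(i := k, k := i)) \<eta>)"
proof -
  let ?\<sigma> = "id(i := k, k := i)"
  have "move_op (Exchange i k) \<Phi> \<eta> = jump_op (?\<sigma> i) (?\<sigma> \<circ> id(i := k)) (?\<sigma> \<circ> ?\<sigma>) \<Phi> (relabel ?\<sigma> \<eta>)"
    unfolding move_op_def moved_row.simps tip_source.simps past_source.simps
    using ik by (intro jump_op_relabel_input[OF _ _ _ _ _ \<Phi> \<eta>]) auto
  also have "\<dots> = jump_op k (id(k := i)) id \<Phi> (relabel ?\<sigma> \<eta>)"
  proof -
    have "?\<sigma> \<circ> id(i := k) = id(k := i)" "?\<sigma> \<circ> ?\<sigma> = id" "?\<sigma> i = k"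
      using ik by (auto simp: fun_eq_iff)
    then show ?thesis by simp
  qed
  finally show ?thesis by (simp add: move_op_def)
qed

fun relabel_move :: "(nat \<Rightarrow> nat) \<Rightarrow> move \<Rightarrow> move" where
  "relabel_move \<sigma> (Replace i j) = Replace (\<sigma> i) (\<sigma> j)"
| "relabel_move \<sigma> (Exchange i j) = Exchange (\<sigma> i) (\<sigma> j)"

text \<open>On the dual moves this is a bijection onto the particle moves: the exchanges supply the
  replacements of row \<open>k\<close>, which the dual process lacks.\<close>

fun undo_exchange :: "nat \<Rightarrow> move \<Rightarrow> move" where
  "undo_exchange k (Replace i j) = Replace i j"
| "undo_exchange k (Exchange i j) = Replace k i"

text \<open>Stated for abstract functionals, so that the induction over the jumps uses no
  probability: the recursions, invariance at the start and proportional initial values are what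
  enters. The constant \<open>c\<close> will be the probability of the label
  \<open>k\<close>.\<close>

lemma dual_functional:
  fixes \<mu> \<nu> :: "nat \<Rightarrow> ('a tree_state \<Rightarrow> ennreal) \<Rightarrow> ennreal"
  assumes k: "k \<in> {1..N}"
    and \<mu>_Suc: "\<And>n \<Phi>. \<Phi> \<in> borel_measurable states \<Longrightarrow> \<mu> (Suc n) \<Phi> = (\<Sum>e\<in>particle_moves N. \<mu> n (move_op e \<Phi>))"
    and \<nu>_Suc: "\<And>n \<Phi>. \<Phi> \<in> borel_measurable states \<Longrightarrow> \<nu> (Suc n) \<Phi> = (\<Sum>e\<in>dual_moves N k. \<nu> n (move_op e \<Phi>))"
    and \<mu>_cong: "\<And>n \<Phi> \<Psi>. (\<And>\<eta>. \<eta> \<in> space states \<Longrightarrow> \<Phi> \<eta> = \<Psi> \<eta>) \<Longrightarrow> \<mu> n \<Phi> = \<mu> n \<Psi>"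
    and \<mu>_sym: "\<And>\<sigma> \<Phi>. (\<And>i. i \<in> {1..N} \<Longrightarrow> \<sigma> i \<in> {1..N}) \<Longrightarrow> (\<And>i. \<sigma> (\<sigma> i) = i) \<Longrightarrow>
        \<Phi> \<in> borel_measurable states \<Longrightarrow> \<mu> 0 (\<lambda>\<eta>. \<Phi> (relabel \<sigma> \<eta>)) = \<mu> 0 \<Phi>"
    and \<nu>_0: "\<And>\<Phi>. \<Phi> \<in> borel_measurable states \<Longrightarrow> \<nu> 0 \<Phi> = c * \<mu> 0 \<Phi>"
    and \<Phi>: "\<Phi> \<in> borel_measurable states"
  shows "\<nu> n \<Phi> = c * \<mu> n \<Phi>"
proof -
  \<comment> \<open>Invariance is needed for every \<open>n\<close>, not just at the start: the
    recursion peels off the latest jump, and the relabelling produced by an exchange acts on the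
    state just before it.\<close>
  have sym: "\<mu> n (\<lambda>\<eta>. \<Phi> (relabel \<sigma> \<eta>)) = \<mu> n \<Phi>"
    if \<sigma>: "\<And>i. i \<in> {1..N} \<Longrightarrow> \<sigma> i \<in> {1..N}" and inv: "\<And>i. \<sigma> (\<sigma> i) = i"
      and "\<Phi> \<in> borel_measurable states" for \<sigma> \<Phi> n
    using that(3)
  proof (induction n arbitrary: \<Phi>)
    case 0
    then show ?case by (intro \<mu>_sym \<sigma> inv)
  next
    case (Suc n)
    have "\<mu> (Suc n) (\<lambda>\<eta>. \<Phi> (relabel \<sigma> \<eta>)) = (\<Sum>e\<in>particle_moves N. \<mu> n (move_op e (\<lambda>\<eta>. \<Phi> (relabel \<sigma> \<eta>))))"
      by (intro \<mu>_Suc measurable_compose[OF relabel_measurable[OF \<sigma>] Suc.prems])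
    also have "\<dots> = (\<Sum>e\<in>particle_moves N. \<mu> n (move_op (relabel_move \<sigma> e) \<Phi>))"
    proof (rule sum.cong[OF refl])
      fix e assume "e \<in> particle_moves N"
      then obtain i j where e: "e = Replace i j" and ij: "i \<in> {1..N}" "j \<in> {1..N}" "j \<noteq> i"
        by (auto simp: particle_moves_def)
      have valid: "valid_move (relabel_move \<sigma> e)"
        using \<sigma>[OF ij(1)] \<sigma>[OF ij(2)] by (auto simp: e valid_move_def)
      have "\<mu> n (move_op e (\<lambda>\<eta>. \<Phi> (relabel \<sigma> \<eta>))) = \<mu> n (\<lambda>\<eta>. move_op (relabel_move \<sigma> e) \<Phi> (relabel \<sigma> \<eta>))"
        unfolding e relabel_move.simps by (intro \<mu>_cong move_op_Replace_relabel \<sigma> inv ij Suc.prems)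
      also have "\<dots> = \<mu> n (move_op (relabel_move \<sigma> e) \<Phi>)"
        by (intro Suc.IH move_op_measurable valid Suc.prems)
      finally show "\<mu> n (move_op e (\<lambda>\<eta>. \<Phi> (relabel \<sigma> \<eta>))) = \<mu> n (move_op (relabel_move \<sigma> e) \<Phi>)" .
    qed
    \<comment> \<open>Conjugation by \<sigma> permutes the replacements among themselves.\<close>
    also have "\<dots> = (\<Sum>e\<in>particle_moves N. \<mu> n (move_op e \<Phi>))"
    proof -
      have m: "relabel_move \<sigma> e \<in> particle_moves N" "relabel_move \<sigma> (relabel_move \<sigma> e) = e"
        if e_in: "e \<in> particle_moves N" for e
      proof -
        obtain i j where e: "e = Replace i j" and ij: "i \<in> {1..N}" "j \<in> {1..N}" "j \<noteq> i"
          using e_in by (auto simp: particle_moves_def)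
        have "\<sigma> j \<noteq> \<sigma> i" using ij(3) inv by metis
        then show "relabel_move \<sigma> e \<in> particle_moves N" "relabel_move \<sigma> (relabel_move \<sigma> e) = e"
          using \<sigma>[OF ij(1)] \<sigma>[OF ij(2)] inv by (auto simp: e particle_moves_def)
      qed
      show ?thesis
        by (rule sum.reindex_bij_witness[where i="relabel_move \<sigma>" and j="relabel_move \<sigma>"]) (auto simp: m)
    qed
    also have "\<dots> = \<mu> (Suc n) \<Phi>" by (rule \<mu>_Suc[symmetric]) fact
    finally show ?case .
  qed
  show ?thesis
    using \<Phi>
  proof (induction n arbitrary: \<Phi>)
    case 0
    then show ?case by (rule \<nu>_0)
  next
    case (Suc n)
    have "\<nu> (Suc n) \<Phi> = (\<Sum>e\<in>dual_moves N k. c * \<mu> n (move_op e \<Phi>))"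
      unfolding \<nu>_Suc[OF Suc.prems]
      by (intro sum.cong refl Suc.IH move_op_measurable Suc.prems valid_dual_moves[OF k])
    also have "\<dots> = (\<Sum>e\<in>dual_moves N k. c * \<mu> n (move_op (undo_exchange k e) \<Phi>))"
    proof (intro sum.cong refl arg_cong2[where f="(*)"])
      fix e assume "e \<in> dual_moves N k"
      then consider i j where "e = Replace i j" | i where "e = Exchange i k" "i \<in> {1..N}" "i \<noteq> k"
        by (auto simp: dual_moves_def)
      then show "\<mu> n (move_op e \<Phi>) = \<mu> n (move_op (undo_exchange k e) \<Phi>)"
      proof cases
        case 2
        \<comment> \<open>The exchange is a replacement evaluated at a relabelled state, and
          invariance of \<open>\<mu> n\<close> drops the relabelling.\<close>
        have "\<mu> n (move_op e \<Phi>) = \<mu> n (\<lambda>\<eta>. move_op (Replace k i) \<Phi> (relabel (id(i := k, k := i)) \<eta>))"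
          unfolding 2 by (intro \<mu>_cong move_op_Exchange 2 k Suc.prems)
        also have "\<dots> = \<mu> n (move_op (Replace k i) \<Phi>)"
          using k 2 by (intro sym move_op_measurable Suc.prems) (auto simp: valid_move_def)
        finally show ?thesis by (simp add: 2)
      qed simp
    qed
    also have "\<dots> = (\<Sum>e\<in>particle_moves N. c * \<mu> n (move_op e \<Phi>))"
    proof (rule sum.reindex_bij_witness[where j="undo_exchange k"
            and i="\<lambda>e. case e of Replace i j \<Rightarrow> if i = k then Exchange j k else e | _ \<Rightarrow> e"])
      fix e assume "e \<in> dual_moves N k"
      then consider i j where "e = Replace i j" "i \<in> {1..N}" "i \<noteq> k" "j \<in> {1..N}" "j \<noteq> i"
        | i where "e = Exchange i k" "i \<in> {1..N}" "i \<noteq> k"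
        by (auto simp: dual_moves_def)
      then show "(case undo_exchange k e of Replace i j \<Rightarrow> if i = k then Exchange j k else undo_exchange k e | _ \<Rightarrow> undo_exchange k e) = e"
        and "undo_exchange k e \<in> particle_moves N"
        using k by (cases; auto simp: particle_moves_def)+
    next
      fix e assume "e \<in> particle_moves N"
      then obtain i j where "e = Replace i j" "i \<in> {1..N}" "j \<in> {1..N}" "j \<noteq> i"
        by (auto simp: particle_moves_def)
      then show "undo_exchange k (case e of Replace i j \<Rightarrow> if i = k then Exchange j k else e | _ \<Rightarrow> e) = e"
        and "(case e of Replace i j \<Rightarrow> if i = k then Exchange j k else e | _ \<Rightarrow> e) \<in> dual_moves N k"
        using k by (auto simp: dual_moves_def)
    qed simp
    also have "\<dots> = c * \<mu> (Suc n) \<Phi>"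
      unfolding \<mu>_Suc[OF Suc.prems] by (rule sum_distrib_left[symmetric])
    finally show ?case .
  qed
qed

end

section \<open>The driving data of a jump process\<close>

instance move :: countable
  by countable_datatype

text \<open>The integrand of the weight is known only strictly between consecutive jumps and is not
  assumed measurable. Changing a measurable function at two points keeps it measurable and leaves
  the integral alone.\<close>

lemma set_integral_eq_on_open_interval:
  fixes f g :: "real \<Rightarrow> real"
  assumes eq: "\<And>s. a < s \<Longrightarrow> s < b \<Longrightarrow> f s = g s"
    and g: "set_integrable lborel {a..b} g"
  shows "set_integrable lborel {a..b} f" "(LINT s:{a..b}|lborel. f s) = (LINT s:{a..b}|lborel. g s)"
proof -
  have gm[measurable]: "(\<lambda>s. indicator {a..b} s *\<^sub>R g s) \<in> borel_measurable borel"
    using g unfolding set_integrable_def by auto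
  have "(\<lambda>s. indicator {a..b} s *\<^sub>R f s) =
      (\<lambda>s. if s = a then indicator {a..b} a *\<^sub>R f a else if s = b then indicator {a..b} b *\<^sub>R f b else indicator {a..b} s *\<^sub>R g s)"
    using eq by (auto simp: fun_eq_iff indicator_def)
  then have f: "(\<lambda>s. indicator {a..b} s *\<^sub>R f s) \<in> borel_measurable borel" by simp
  have ae: "AE s in lborel. indicator {a..b} s *\<^sub>R f s = indicator {a..b} s *\<^sub>R g s"
    using AE_lborel_singleton[of a] AE_lborel_singleton[of b]
    by eventually_elim (use eq in \<open>auto simp: indicator_def\<close>)
  show "set_integrable lborel {a..b} f"
    using gm g f ae unfolding set_integrable_def
    by (subst integrable_cong_AE[of _ _ "\<lambda>s. indicator {a..b} s *\<^sub>R g s"]) auto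
  show "(LINT s:{a..b}|lborel. f s) = (LINT s:{a..b}|lborel. g s)"
    using gm f ae unfolding set_lebesgue_integral_def by (intro integral_cong_AE) auto
qed

lemma move_rate_eq: "move_rate N V e u x = V u (x (moved_row e)) / N"
  by (cases e) auto

context potential_setting
begin

lemma abs_weighted_potential_le: "\<bar>weighted_potential q w v\<bar> \<le> (\<Sum>i\<in>{1..N}. \<bar>q i\<bar> * C)"
  unfolding weighted_potential_def
  by (rule order_trans[OF sum_abs]) (intro sum_mono, simp add: abs_mult V_max_bounds mult_left_mono)

lemma weighted_potential_path_measurable:
  assumes "w \<in> space motions"
  shows "weighted_potential q w \<in> borel_measurable borel"
  using weighted_potential_measurable[of "\<lambda>_. w" borel "\<lambda>v. v" q] assms by simp

lemma set_integrable_weighted_potential: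
  assumes "w \<in> space motions"
  shows "set_integrable lborel {a..b} (weighted_potential q w)"
  by (rule set_integrable_bounded[OF weighted_potential_path_measurable[OF assms] abs_weighted_potential_le])
    (auto simp: emeasure_lborel_Icc_eq)

lemma accumulated_add:
  assumes "w \<in> space motions"
  shows "accumulated q w a b + accumulated r w a b = accumulated (\<lambda>i. q i + r i) w a b"
proof -
  have "weighted_potential (\<lambda>i. q i + r i) w = (\<lambda>v. weighted_potential q w v + weighted_potential r w v)"
    by (simp add: weighted_potential_def fun_eq_iff sum.distrib algebra_simps)
  then show ?thesis
    unfolding accumulated_def using set_integrable_weighted_potential[OF assms] by simp
qed

lemma weighted_potential_nonneg: "(\<And>i. 0 \<le> q i) \<Longrightarrow> 0 \<le> weighted_potential q w v"
  unfolding weighted_potential_def by (intro sum_nonneg mult_nonneg_nonneg V_max_bounds)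

lemma accumulated_nonneg: "(\<And>i. 0 \<le> q i) \<Longrightarrow> 0 \<le> accumulated q w a b"
  unfolding accumulated_def set_lebesgue_integral_def using weighted_potential_nonneg[of q w]
  by (intro integral_nonneg_AE) auto

text \<open>Ties the index maps to the jumps of the model. A row prolonged up to the left of
  \<open>t\<close> is a splice, and overwriting its value at \<open>t\<close> gives a splice with
  the same past, so the two kinds of jump differ only in the rows they read.\<close>

lemma step_eq_jump:
  fixes w h g :: "'a rows"
  assumes e: "valid_move e" and t: "0 < t" "\<tau> < t"
  defines "z \<equiv> jump t e (prolong_left N \<tau> t w h, prolong_left N \<tau> t w g)"
  shows "step (tip_source e) (past_source e) (\<tau>, y, h, g) w t = (t, \<lambda>i\<in>{1..N}. fst z i t, fst z, snd z)"
proof -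
  have L: "Lim (at_left t) x = left_lim x t" for x :: "'a path"
    using t by (simp add: left_lim_def)
  have pl: "prolong_left N \<tau> t w x i = (if i \<in> {1..N} then splice \<tau> t (x i) (w i) (left_lim (w i) t) else undefined)" for x i
    using t by (auto simp: prolong_left_def prolong_def splice_def L fun_eq_iff restrict_def)
  have upd: "(splice \<tau> t x x' l)(t := l') = splice \<tau> t x x' l'" "splice \<tau> t x x' l t = l" for x x' l l'
    using t by (auto simp: splice_def fun_eq_iff restrict_def)
  show ?thesis
  proof (cases e)
    case (Replace i j)
    have i: "i \<in> {1..N}" using e unfolding Replace valid_move_def by simp
    moreover have "tip_source e i \<in> {1..N}" using e i unfolding valid_move_def by blast
    ultimately have "i \<in> {1..N}" "j \<in> {1..N}" by (simp_all add: Replace)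
    then show ?thesis
      by (auto simp: Replace z_def step_def fun_eq_iff pl upd restrict_def)
  next
    case (Exchange i k)
    have i: "i \<in> {1..N}" using e unfolding Exchange valid_move_def by simp
    moreover have "tip_source e i \<in> {1..N}" using e i unfolding valid_move_def by blast
    ultimately have "i \<in> {1..N}" "k \<in> {1..N}" by (simp_all add: Exchange)
    then show ?thesis
      by (auto simp: Exchange z_def step_def fun_eq_iff pl upd restrict_def)
  qed
qed

end

text \<open>\<open>E0\<close> is one fixed value of the random set of moves, and everything is
  localised to the event that it occurs. \<open>rate_sum\<close> is the balance on which the proof
  rests: jump rates with weights \<open>1 - q\<close> against a discount with weights
  \<open>q\<close>. The particle model takes \<open>q = 1 / N\<close>, the dual process the
  indicator of row \<open>k\<close>.\<close>

locale weighted_jump_process = potential_setting N P V C + jump_driven M N P V E \<xi>0 Z T J W F G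
  for N :: nat and P :: "real \<Rightarrow> 'a::metric_space \<Rightarrow> 'a path measure" and V C and M :: "'w measure"
    and E \<xi>0 Z T J W F G +
  fixes E0 :: "move set" and q :: "nat \<Rightarrow> real"
  assumes finite_E0: "finite E0" and valid_E0: "\<And>e. e \<in> E0 \<Longrightarrow> valid_move e"
    and q_bounds: "\<And>i. 0 \<le> q i" "\<And>i. q i \<le> 1"
    and rate_sum: "\<And>s x. (\<Sum>e\<in>E0. move_rate N V e s x) = (\<Sum>i\<in>{1..N}. (1 - q i) * V s (x i))"
begin

text \<open>Equal to \<open>0\<close> when the jump does not occur.\<close>

definition time :: "nat \<Rightarrow> 'w \<Rightarrow> real" where
  "time n \<omega> = real_of_ereal (T n \<omega>)"

text \<open>The process \<open>Z\<close> is measurable at fixed times only, so its value at a jump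
  time is recomputed from the driving data. Keeping the state when \<open>J n\<close> lies outside
  \<open>E0\<close> is a default that keeps the index maps within \<open>{1..N}\<close>.\<close>

primrec state :: "nat \<Rightarrow> 'w \<Rightarrow> 'a tree_state" where
  "state 0 \<omega> = (0, \<lambda>i\<in>{1..N}. \<xi>0 i \<omega>, initial_rows N (\<lambda>i. \<xi>0 i \<omega>), initial_rows N (\<lambda>i. \<xi>0 i \<omega>))"
| "state (Suc n) \<omega> =
    (if J n \<omega> \<in> E0 then step (tip_source (J n \<omega>)) (past_source (J n \<omega>)) (state n \<omega>) (W n \<omega>) (time (Suc n) \<omega>)
     else state n \<omega>)"

primrec discount :: "nat \<Rightarrow> 'w \<Rightarrow> real" where
  "discount 0 \<omega> = 1"
| "discount (Suc n) \<omega> = discount n \<omega> * exp (- accumulated q (W n \<omega>) (time n \<omega>) (time (Suc n) \<omega>))"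

definition alive :: "nat \<Rightarrow> 'w set" where
  "alive n = {\<omega> \<in> space M. E \<omega> = E0 \<and> T n \<omega> < \<infinity>}"

text \<open>The weighted law of the state at the \<open>n\<close>-th jump, written as a functional
  of the test function so that the jump operators act on it by duality.\<close>

definition functional :: "nat \<Rightarrow> ('a tree_state \<Rightarrow> ennreal) \<Rightarrow> ennreal" where
  "functional n \<Phi> = (\<integral>\<^sup>+\<omega>. indicator (alive n) \<omega> * (ennreal (discount n \<omega>) * \<Phi> (state n \<omega>)) \<partial>M)"

lemma F_measurable_G: "f \<in> F n \<rightarrow>\<^sub>M L \<Longrightarrow> f \<in> G n \<rightarrow>\<^sub>M L"
  by (rule measurable_from_subalg[OF F_G])

lemma G_measurable_F_Suc: "f \<in> G n \<rightarrow>\<^sub>M L \<Longrightarrow> f \<in> F (Suc n) \<rightarrow>\<^sub>M L"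
  by (rule measurable_from_subalg[OF G_F])

lemma F_measurable_M: "f \<in> F n \<rightarrow>\<^sub>M L \<Longrightarrow> f \<in> M \<rightarrow>\<^sub>M L"
  by (rule measurable_from_subalg[OF F_sub])

lemma G_measurable_M: "f \<in> G n \<rightarrow>\<^sub>M L \<Longrightarrow> f \<in> M \<rightarrow>\<^sub>M L"
  by (rule measurable_from_subalg[OF G_sub])

lemma F_measurable_F_Suc: "f \<in> F n \<rightarrow>\<^sub>M L \<Longrightarrow> f \<in> F (Suc n) \<rightarrow>\<^sub>M L"
  by (intro G_measurable_F_Suc F_measurable_G)

lemma space_F: "space (F n) = space M" and space_G: "space (G n) = space M"
  using F_sub G_sub by (auto simp: subalgebra_def)

lemma E_measurable_F: "E \<in> F n \<rightarrow>\<^sub>M count_space UNIV"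
  by (induction n) (auto intro: E_meas F_measurable_F_Suc)

lemma time_measurable: "time n \<in> borel_measurable (F n)"
  using T_meas[of n] unfolding time_def by measurable

lemma alive_sets: "alive n \<in> sets (F n)"
proof -
  have "alive n = (E -` {E0} \<inter> space (F n)) \<inter> (T n -` {..<\<infinity>} \<inter> space (F n))"
    by (auto simp: alive_def space_F)
  then show ?thesis using measurable_sets[OF E_measurable_F] measurable_sets[OF T_meas] by auto
qed

lemma F_sets_M: "A \<in> sets (F n) \<Longrightarrow> A \<in> sets M"
  using F_sub by (auto simp: subalgebra_def)

lemma F_sets_G: "A \<in> sets (F n) \<Longrightarrow> A \<in> sets (G n)"
  using F_G by (auto simp: subalgebra_def)

lemma state_measurable: "state n \<in> F n \<rightarrow>\<^sub>M states"
proof (induction n)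
  case 0
  have rows: "(\<lambda>\<omega>. initial_rows N (\<lambda>i. \<xi>0 i \<omega>)) \<in> F 0 \<rightarrow>\<^sub>M raw_rows {0..}"
  proof -
    have "(\<lambda>\<omega>. \<lambda>i\<in>{1..N}. \<lambda>s\<in>{0..}. if s = 0 then \<xi>0 i \<omega> else undefined) \<in> F 0 \<rightarrow>\<^sub>M raw_rows {0..}"
    proof (intro measurable_restrict)
      fix i s assume "i \<in> {1..N}"
      note [measurable] = \<xi>0_meas[OF this]
      show "(\<lambda>\<omega>. if s = 0 then \<xi>0 i \<omega> else undefined) \<in> borel_measurable (F 0)" by measurable
    qed
    moreover have "initial_rows N x = (\<lambda>i\<in>{1..N}. \<lambda>s\<in>{0..}. if s = 0 then x i else undefined)" for x :: "nat \<Rightarrow> 'a"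
      by (auto simp: initial_rows_def fun_eq_iff restrict_def)
    ultimately show ?thesis by simp
  qed
  have "state 0 = (\<lambda>\<omega>. (0, \<lambda>i\<in>{1..N}. \<xi>0 i \<omega>, initial_rows N (\<lambda>i. \<xi>0 i \<omega>), initial_rows N (\<lambda>i. \<xi>0 i \<omega>)))"
    by (simp add: fun_eq_iff)
  then show ?case
    by (simp only:) (intro measurable_Pair rows measurable_restrict \<xi>0_meas measurable_const, auto)
next
  case (Suc n)
  \<comment> \<open>There are countably many moves, so measurability for each fixed \<open>e\<close>
    is enough.\<close>
  have "(\<lambda>\<omega>. if e \<in> E0 then step (tip_source e) (past_source e) (state n \<omega>) (W n \<omega>) (time (Suc n) \<omega>) else state n \<omega>) \<in> F (Suc n) \<rightarrow>\<^sub>M states" for e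
  proof (cases "e \<in> E0")
    case True
    then have "valid_move e" by (rule valid_E0)
    then show ?thesis using True
      by (simp only: if_True)
         (intro step_measurable F_measurable_F_Suc[OF Suc] G_measurable_F_Suc[OF W_meas] time_measurable, auto simp: valid_move_def)
  qed (simp only: if_False, rule F_measurable_F_Suc[OF Suc])
  from measurable_compose_countable[OF this J_meas]
  show ?case by (simp add: state.simps(2)[abs_def])
qed

lemma discount_measurable: "discount n \<in> borel_measurable (F n)"
proof (induction n)
  case (Suc n)
  have "(\<lambda>\<omega>. accumulated q (W n \<omega>) (time n \<omega>) (time (Suc n) \<omega>)) \<in> borel_measurable (F (Suc n))"
    by (intro accumulated_measurable G_measurable_F_Suc[OF W_meas] F_measurable_F_Suc[OF time_measurable] time_measurable)
  with F_measurable_F_Suc[OF Suc] show ?case by simp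
qed simp

lemma T_nonneg: "\<omega> \<in> space M \<Longrightarrow> 0 \<le> T n \<omega>"
proof (induction n)
  case (Suc n)
  then show ?case using T_increasing[of \<omega> n] T_infinite[of \<omega> n] by (cases "T n \<omega> < \<infinity>") (auto intro: order_trans less_imp_le)
qed (simp add: T_0)

lemma T_mono:
  assumes "\<omega> \<in> space M" "m \<le> n"
  shows "T m \<omega> \<le> T n \<omega>"
  using assms(2)
proof (induction rule: dec_induct)
  case (step n)
  then show ?case using T_increasing[OF assms(1), of n] T_infinite[OF assms(1), of n]
    by (cases "T n \<omega> < \<infinity>") (auto intro: order_trans less_imp_le)
qed simp

lemma T_eq_time: "\<omega> \<in> space M \<Longrightarrow> T n \<omega> < \<infinity> \<Longrightarrow> T n \<omega> = ereal (time n \<omega>)"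
  using T_nonneg[of \<omega> n] by (cases "T n \<omega>") (auto simp: time_def)

lemma time_nonneg: "\<omega> \<in> space M \<Longrightarrow> 0 \<le> time n \<omega>"
  using T_nonneg[of \<omega> n] by (cases "T n \<omega>") (auto simp: time_def)

lemma T_Suc_finiteD: "\<omega> \<in> space M \<Longrightarrow> T (Suc n) \<omega> < \<infinity> \<Longrightarrow> T n \<omega> < \<infinity>"
  using T_infinite[of \<omega> n] by (cases "T n \<omega>") auto

lemma time_less_Suc: "\<omega> \<in> space M \<Longrightarrow> T (Suc n) \<omega> < \<infinity> \<Longrightarrow> time n \<omega> < time (Suc n) \<omega>"
  using T_increasing[of \<omega> n] T_Suc_finiteD[of \<omega> n] T_eq_time[of \<omega> n] T_eq_time[of \<omega> "Suc n"] by auto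

text \<open>The rebuilt state agrees with the process at its jump times: where
  \<open>E \<omega> = E0\<close> every jump made lies in \<open>E0\<close>, so the default in
  \<open>state\<close> never applies.\<close>

lemma state_eq:
  assumes "\<omega> \<in> space M" "E \<omega> = E0" "T n \<omega> = ereal \<tau>"
  shows "state n \<omega> = (\<tau>, \<lambda>i\<in>{1..N}. fst (Z \<tau> \<omega>) i \<tau>, fst (Z \<tau> \<omega>), snd (Z \<tau> \<omega>))"
  using assms(3)
proof (induction n arbitrary: \<tau>)
  case 0
  then have "\<tau> = 0" using T_0[OF assms(1)] by simp
  then show ?case using initial[OF assms(1)] by (auto simp: initial_rows_def fun_eq_iff restrict_def)
next
  case (Suc n)
  have "T n \<omega> < \<infinity>" using Suc.prems T_Suc_finiteD[OF assms(1), of n] by simp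
  then obtain \<sigma> where \<sigma>: "T n \<omega> = ereal \<sigma>" using T_eq_time[OF assms(1)] by blast
  have less: "\<sigma> < \<tau>" using T_increasing[OF assms(1), of n] \<sigma> Suc.prems by simp
  have "0 \<le> \<sigma>" using T_nonneg[OF assms(1), of n] \<sigma> by simp
  have Jn: "J n \<omega> \<in> E0" using J_possible[OF assms(1), of n] Suc.prems assms(2) by simp
  have tm: "time (Suc n) \<omega> = \<tau>" using Suc.prems by (simp add: time_def)
  have Zt: "Z \<tau> \<omega> = jump \<tau> (J n \<omega>) (prolong_left N \<sigma> \<tau> (W n \<omega>) (fst (Z \<sigma> \<omega>)), prolong_left N \<sigma> \<tau> (W n \<omega>) (snd (Z \<sigma> \<omega>)))"
    using at_jump[OF assms(1) \<sigma> Suc.prems] by (simp add: map_prod_def split_beta')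
  show ?case
    unfolding state.simps if_P[OF Jn] Suc.IH[OF \<sigma>] tm Zt
    using less \<open>0 \<le> \<sigma>\<close> by (intro step_eq_jump valid_E0[OF Jn]) auto
qed

lemma state_alive:
  assumes "\<omega> \<in> alive n"
  shows "fst (state n \<omega>) = time n \<omega>"
    and "\<And>i. i \<in> {1..N} \<Longrightarrow> fst (snd (state n \<omega>)) i = fst (Z (time n \<omega>) \<omega>) i (time n \<omega>)"
    and "snd (snd (state n \<omega>)) = Z (time n \<omega>) \<omega>"
  using state_eq[of \<omega> n "time n \<omega>"] T_eq_time[of \<omega> n] assms by (auto simp: alive_def)

text \<open>The disintegration given \<open>F n\<close> with no event imposed. On
  \<open>alive n\<close> the rebuilt state supplies the time and the starting points that
  \<open>free_motion_law\<close> reads off \<open>Z\<close>.\<close>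

lemma free_motion_integral:
  assumes \<Psi>: "\<Psi> \<in> borel_measurable (F n \<Otimes>\<^sub>M motions)"
  shows "(\<integral>\<^sup>+\<omega>. indicator (alive n) \<omega> * \<Psi> (\<omega>, W n \<omega>) \<partial>M)
    = (\<integral>\<^sup>+\<omega>. indicator (alive n) \<omega> * (\<integral>\<^sup>+w. \<Psi> (\<omega>, w) \<partial>motion_law (state n \<omega>)) \<partial>M)"
proof -
  have "(\<integral>\<^sup>+\<omega>. indicator (alive n \<inter> space M) \<omega> * \<Psi> (\<omega>, W n \<omega>) \<partial>M)
    = (\<integral>\<^sup>+\<omega>. indicator (alive n) \<omega> * (\<integral>\<^sup>+w. \<Psi> (\<omega>, w) \<partial>motion_law (state n \<omega>)) \<partial>M)"
  proof (rule nn_integral_disintegration[OF F_sub _ alive_sets sets.top _ sets.sigma_sets_eq[symmetric] sets.Int_stable sets.space_closed _ _ _ _ \<Psi>, where C="{space motions}"])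
    show "W n \<in> M \<rightarrow>\<^sub>M motions" by (rule G_measurable_M[OF W_meas])
    show "(\<lambda>\<omega>. motion_law (state n \<omega>)) \<in> F n \<rightarrow>\<^sub>M subprob_algebra motions"
      by (rule measurable_compose[OF state_measurable measurable_prob_algebraD[OF motion_law_kernel]])
    fix A assume A: "A \<in> sets motions"
    show "AE \<omega> in M. \<omega> \<in> alive n \<longrightarrow>
       real_cond_exp M (F n) (indicator {\<omega> \<in> space M. \<omega> \<in> space M \<and> W n \<omega> \<in> A}) \<omega> = measure (motion_law (state n \<omega>)) A"
      using free_motion_law[OF A, of n]
    proof (eventually_elim, intro impI)
      fix \<omega> assume *: "\<forall>\<tau>. T n \<omega> = ereal \<tau> \<longrightarrow> real_cond_exp M (F n) (indicator {\<omega> \<in> space M. W n \<omega> \<in> A}) \<omega>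
        = measure (\<Pi>\<^sub>M i\<in>{1..N}. P \<tau> (fst (Z \<tau> \<omega>) i \<tau>)) A" and al: "\<omega> \<in> alive n"
      have T: "T n \<omega> = ereal (time n \<omega>)" "0 \<le> time n \<omega>"
        using al T_eq_time[of \<omega> n] time_nonneg[of \<omega> n] by (auto simp: alive_def)
      have "motion_law (state n \<omega>) = (\<Pi>\<^sub>M i\<in>{1..N}. P (time n \<omega>) (fst (Z (time n \<omega>) \<omega>) i (time n \<omega>)))"
        using T(2) by (intro PiM_cong refl) (simp only: state_alive[OF al] max_absorb2)
      then show "real_cond_exp M (F n) (indicator {\<omega> \<in> space M. \<omega> \<in> space M \<and> W n \<omega> \<in> A}) \<omega> = measure (motion_law (state n \<omega>)) A"
        using * T(1) by simp
    qed
  qed auto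
  moreover have "alive n \<inter> space M = alive n" by (auto simp: alive_def)
  ultimately show ?thesis by simp
qed

end

section \<open>The next jump, given the free motion\<close>

context weighted_jump_process
begin

text \<open>The conditional density, given \<open>G n\<close>, of the next jump time on the event
  that the jump is \<open>e\<close>. Its clock has the weights \<open>1 - q\<close>, whereas that of
  \<open>jump_density\<close> has the weights \<open>1\<close>.\<close>

definition rate_density :: "nat \<Rightarrow> move \<Rightarrow> 'w \<Rightarrow> real \<Rightarrow> ennreal" where
  "rate_density n e \<omega> u =
     (if time n \<omega> \<le> u then ennreal (V (max 0 u) (W n \<omega> (moved_row e) (max 0 u)) / N *
        exp (- accumulated (\<lambda>i. 1 - q i) (W n \<omega>) (time n \<omega>) u)) else 0)"

lemma W_space: "\<omega> \<in> space M \<Longrightarrow> W n \<omega> \<in> space motions"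
  using measurable_space[OF W_meas[of n]] by (simp add: space_G)

lemma rate_le_weighted_potential:
  assumes "e \<in> E0"
  shows "V (max 0 u) (w (moved_row e) (max 0 u)) / N \<le> weighted_potential (\<lambda>i. 1 - q i) w u"
proof -
  have "move_rate N V e (max 0 u) (\<lambda>i. w i (max 0 u)) \<le> (\<Sum>e\<in>E0. move_rate N V e (max 0 u) (\<lambda>i. w i (max 0 u)))"
    using V_max_bounds by (intro member_le_sum assms finite_E0) (simp add: move_rate_eq)
  then show ?thesis unfolding rate_sum by (simp only: move_rate_eq weighted_potential_def)
qed

lemma rate_density_measurable:
  assumes e: "e \<in> E0" and f: "f \<in> L \<rightarrow>\<^sub>M G n" and u[measurable]: "u \<in> borel_measurable L"
  shows "(\<lambda>z. rate_density n e (f z) (u z)) \<in> borel_measurable L"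
proof -
  have a: "moved_row e \<in> {1..N}" using valid_E0[OF e] by (simp add: valid_move_def)
  have Wf: "(\<lambda>z. W n (f z)) \<in> L \<rightarrow>\<^sub>M motions" by (rule measurable_compose[OF f W_meas])
  have [measurable]: "(\<lambda>z. time n (f z)) \<in> borel_measurable L"
    by (rule measurable_compose[OF f F_measurable_G[OF time_measurable]])
  have [measurable]: "(\<lambda>z. V (max 0 (u z)) (W n (f z) (moved_row e) (max 0 (u z)))) \<in> borel_measurable L"
    by (rule V_max_measurable[OF u measurable_path_eval[OF motion_row[OF Wf a] u]])
  have [measurable]: "(\<lambda>z. accumulated (\<lambda>i. 1 - q i) (W n (f z)) (time n (f z)) (u z)) \<in> borel_measurable L"
    by (rule accumulated_measurable[OF Wf]) measurable
  show ?thesis unfolding rate_density_def by measurable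
qed

lemma rate_density_path_measurable:
  "e \<in> E0 \<Longrightarrow> \<omega> \<in> space M \<Longrightarrow> rate_density n e \<omega> \<in> borel_measurable borel"
  using rate_density_measurable[of e "\<lambda>_. \<omega>" borel n "\<lambda>u. u"] by (simp add: space_G)

text \<open>The density of one move is dominated by that of all moves together, whose integral is
  one minus a survival probability. This makes the law of the jump time a sub-probability
  kernel.\<close>

lemma rate_density_atMost:
  assumes e: "e \<in> E0" and \<omega>: "\<omega> \<in> space M"
  shows "emeasure (density lborel (rate_density n e \<omega>)) {..t} =
    ennreal (LINT u:{time n \<omega>..t}|lborel. V (max 0 u) (W n \<omega> (moved_row e) (max 0 u)) / N *
        exp (- accumulated (\<lambda>i. 1 - q i) (W n \<omega>) (time n \<omega>) u))" (is "_ = ennreal (LINT u:_|_. ?g u)")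
    and "(LINT u:{time n \<omega>..t}|lborel. V (max 0 u) (W n \<omega> (moved_row e) (max 0 u)) / N *
        exp (- accumulated (\<lambda>i. 1 - q i) (W n \<omega>) (time n \<omega>) u)) \<le> 1"
    and "0 \<le> (LINT u:{time n \<omega>..t}|lborel. V (max 0 u) (W n \<omega> (moved_row e) (max 0 u)) / N *
        exp (- accumulated (\<lambda>i. 1 - q i) (W n \<omega>) (time n \<omega>) u))"
    and rate_density_integrable: "set_integrable lborel {time n \<omega>..t} (\<lambda>u. V (max 0 u) (W n \<omega> (moved_row e) (max 0 u)) / N *
        exp (- accumulated (\<lambda>i. 1 - q i) (W n \<omega>) (time n \<omega>) u))"
proof -
  let ?r = "weighted_potential (\<lambda>i. 1 - q i) (W n \<omega>)"
  let ?A = "\<lambda>u. accumulated (\<lambda>i. 1 - q i) (W n \<omega>) (time n \<omega>) u"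
  have a: "moved_row e \<in> {1..N}" using valid_E0[OF e] by (simp add: valid_move_def)
  have Wc: "(\<lambda>_::real. W n \<omega>) \<in> borel \<rightarrow>\<^sub>M motions" using W_space[OF \<omega>] by simp
  have [measurable]: "(\<lambda>u. V (max 0 u) (W n \<omega> (moved_row e) (max 0 u))) \<in> borel_measurable borel"
    by (rule V_max_measurable[OF _ measurable_path_eval[OF motion_row[OF Wc a]]]) simp_all
  have Am[measurable]: "?A \<in> borel_measurable borel"
    by (rule accumulated_measurable[OF Wc]) simp_all
  have rm[measurable]: "?r \<in> borel_measurable borel"
    by (rule weighted_potential_path_measurable[OF W_space[OF \<omega>]])
  define g where "g = ?g"
  have [measurable]: "g \<in> borel_measurable borel" unfolding g_def by measurable
  have g0: "0 \<le> g u" for u using V_max_bounds by (simp add: g_def)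
  have r0: "0 \<le> ?r u" for u using q_bounds by (intro weighted_potential_nonneg) simp
  have A0: "0 \<le> ?A u" for u using q_bounds by (intro accumulated_nonneg) simp
  obtain B where B: "?r u \<le> B" for u
    using abs_weighted_potential_le[of "\<lambda>i. 1 - q i" "W n \<omega>"] by (meson abs_le_D1)
  have B0: "0 \<le> B" using r0[of 0] B[of 0] by simp
  have gr: "g u \<le> ?r u * exp (- ?A u)" for u
    unfolding g_def using rate_le_weighted_potential[OF e, of u "W n \<omega>"] by (intro mult_right_mono) auto
  have rB: "?r u * exp (- ?A u) \<le> B" for u
    using mult_mono[OF B[of u], of "exp (- ?A u)" 1] A0[of u] B0 by simp
  have ig: "set_integrable lborel {time n \<omega>..t} g"
    using g0 order_trans[OF gr rB] by (intro set_integrable_bounded[where C=B]) (auto simp: emeasure_lborel_Icc_eq)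
  have ir: "set_integrable lborel {time n \<omega>..t} (\<lambda>u. ?r u * exp (- ?A u))"
    using rB r0 by (intro set_integrable_bounded[where C=B]) (auto simp: emeasure_lborel_Icc_eq abs_mult)
  show "emeasure (density lborel (rate_density n e \<omega>)) {..t} = ennreal (LINT u:{time n \<omega>..t}|lborel. ?g u)"
    unfolding g_def[symmetric]
  proof -
    have "emeasure (density lborel (rate_density n e \<omega>)) {..t} = (\<integral>\<^sup>+u. rate_density n e \<omega> u * indicator {..t} u \<partial>lborel)"
      using rate_density_path_measurable[OF e \<omega>] by (intro emeasure_density) auto
    also have "\<dots> = (\<integral>\<^sup>+u. ennreal (indicator {time n \<omega>..t} u *\<^sub>R g u) \<partial>lborel)"
      by (intro nn_integral_cong) (auto simp: rate_density_def indicator_def g_def)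
    also have "\<dots> = ennreal (LINT u:{time n \<omega>..t}|lborel. g u)"
      unfolding set_lebesgue_integral_def using ig g0
      by (intro nn_integral_eq_integral) (auto simp: set_integrable_def)
    finally show "emeasure (density lborel (rate_density n e \<omega>)) {..t} = ennreal (LINT u:{time n \<omega>..t}|lborel. g u)" .
  qed
  show "(LINT u:{time n \<omega>..t}|lborel. ?g u) \<le> 1"
    unfolding g_def[symmetric]
  proof (cases "time n \<omega> \<le> t")
    case True
    have "(LINT u:{time n \<omega>..t}|lborel. g u) \<le> (LINT u:{time n \<omega>..t}|lborel. ?r u * exp (- ?A u))"
      by (intro set_integral_mono ig ir gr)
    also have "\<dots> = 1 - exp (- ?A t)"
      unfolding accumulated_def by (rule integral_rate_times_survival[OF rm r0 B True])
    finally show "(LINT u:{time n \<omega>..t}|lborel. g u) \<le> 1" by (smt (verit) exp_gt_zero)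
  qed (simp add: set_lebesgue_integral_def)
  show "set_integrable lborel {time n \<omega>..t} ?g" using ig unfolding g_def .
  show "0 \<le> (LINT u:{time n \<omega>..t}|lborel. ?g u)"
    unfolding g_def[symmetric] set_lebesgue_integral_def using g0 by (intro integral_nonneg_AE) auto
qed

lemma total_jump_probability:
  assumes \<omega>: "\<omega> \<in> space M" and t: "time n \<omega> \<le> t"
  shows "(\<Sum>e\<in>E0. LINT u:{time n \<omega>..t}|lborel. V (max 0 u) (W n \<omega> (moved_row e) (max 0 u)) / N *
        exp (- accumulated (\<lambda>i. 1 - q i) (W n \<omega>) (time n \<omega>) u))
    = 1 - exp (- accumulated (\<lambda>i. 1 - q i) (W n \<omega>) (time n \<omega>) t)"
proof -
  let ?r = "weighted_potential (\<lambda>i. 1 - q i) (W n \<omega>)"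
  let ?A = "\<lambda>u. accumulated (\<lambda>i. 1 - q i) (W n \<omega>) (time n \<omega>) u"
  have r0: "0 \<le> ?r u" for u using q_bounds by (intro weighted_potential_nonneg) simp
  obtain B where B: "?r u \<le> B" for u
    using abs_weighted_potential_le[of "\<lambda>i. 1 - q i" "W n \<omega>"] by (meson abs_le_D1)
  have "(\<Sum>e\<in>E0. LINT u:{time n \<omega>..t}|lborel. V (max 0 u) (W n \<omega> (moved_row e) (max 0 u)) / N * exp (- ?A u))
    = (LINT u:{time n \<omega>..t}|lborel. (\<Sum>e\<in>E0. V (max 0 u) (W n \<omega> (moved_row e) (max 0 u)) / N * exp (- ?A u)))"
    unfolding set_lebesgue_integral_def scaleR_sum_right
    using rate_density_integrable[OF _ \<omega>] unfolding set_integrable_def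
    by (intro Bochner_Integration.integral_sum[symmetric]) blast
  also have "\<dots> = (LINT u:{time n \<omega>..t}|lborel. ?r u * exp (- ?A u))"
  proof -
    have "(\<Sum>e\<in>E0. V (max 0 u) (W n \<omega> (moved_row e) (max 0 u)) / N * exp (- ?A u)) = ?r u * exp (- ?A u)" for u
      using rate_sum[of "max 0 u" "\<lambda>i. W n \<omega> i (max 0 u)"]
      unfolding sum_distrib_right[symmetric] by (simp only: move_rate_eq weighted_potential_def)
    then show ?thesis by simp
  qed
  also have "\<dots> = 1 - exp (- ?A t)"
    unfolding accumulated_def
    by (rule integral_rate_times_survival[OF weighted_potential_path_measurable[OF W_space[OF \<omega>]] r0 B t])
  finally show ?thesis .
qed

lemma jump_event_sets: "{\<omega> \<in> space M. J n \<omega> = e \<and> T (Suc n) \<omega> < \<infinity>} \<in> sets M"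
proof -
  have "{\<omega> \<in> space M. J n \<omega> = e \<and> T (Suc n) \<omega> < \<infinity>}
      = (J n -` {e} \<inter> space M) \<inter> (T (Suc n) -` {..<\<infinity>} \<inter> space M)"
    by auto
  then show ?thesis
    using measurable_sets[OF F_measurable_M[OF J_meas[of n]], of "{e}"]
      measurable_sets[OF F_measurable_M[OF T_meas[of "Suc n"]], of "{..<\<infinity>}"]
    by auto
qed

text \<open>The disintegration given \<open>G n\<close>, with \<open>H\<close> the event that a next
  jump occurs and is \<open>e\<close>. Half-lines serve as generator because \<open>jump_law\<close>
  speaks only of a jump time at most \<open>t\<close>.\<close>

lemma jump_integral:
  assumes e: "e \<in> E0" and \<Psi>: "\<Psi> \<in> borel_measurable (G n \<Otimes>\<^sub>M borel)"
  shows "(\<integral>\<^sup>+\<omega>. indicator (alive n \<inter> {\<omega> \<in> space M. J n \<omega> = e \<and> T (Suc n) \<omega> < \<infinity>}) \<omega> * \<Psi> (\<omega>, time (Suc n) \<omega>) \<partial>M)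
    = (\<integral>\<^sup>+\<omega>. indicator (alive n) \<omega> * (\<integral>\<^sup>+u. rate_density n e \<omega> u * \<Psi> (\<omega>, u) \<partial>lborel) \<partial>M)"
proof -
  let ?H = "{\<omega> \<in> space M. J n \<omega> = e \<and> T (Suc n) \<omega> < \<infinity>}"
  let ?K = "\<lambda>\<omega>. density lborel (rate_density n e \<omega>)"
  have "(\<integral>\<^sup>+\<omega>. indicator (alive n \<inter> ?H) \<omega> * \<Psi> (\<omega>, time (Suc n) \<omega>) \<partial>M)
    = (\<integral>\<^sup>+\<omega>. indicator (alive n) \<omega> * (\<integral>\<^sup>+u. \<Psi> (\<omega>, u) \<partial>?K \<omega>) \<partial>M)"
  proof (rule nn_integral_disintegration[OF G_sub _ F_sets_G[OF alive_sets] _ _ _ _ _ _ _ _ _ \<Psi>])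
    show "time (Suc n) \<in> borel_measurable M" by (rule F_measurable_M[OF time_measurable])
    show "?H \<in> sets M" by (rule jump_event_sets)
    show "?K \<in> G n \<rightarrow>\<^sub>M subprob_algebra borel"
    proof (rule measurable_subprob_algebra)
      fix \<omega> assume "\<omega> \<in> space (G n)"
      then have \<omega>: "\<omega> \<in> space M" by (simp add: space_G)
      \<comment> \<open>The bound on half-lines passes to the whole line by monotone limits.\<close>
      have "emeasure (?K \<omega>) UNIV \<le> 1"
      proof -
        have inc: "incseq (\<lambda>n::nat. {..real n})" by (auto simp: incseq_def)
        have "(SUP n::nat. emeasure (?K \<omega>) {..real n}) = emeasure (?K \<omega>) (\<Union>n::nat. {..real n})"
          by (rule SUP_emeasure_incseq[OF _ inc]) auto
        moreover have "(\<Union>n::nat. {..real n}) = UNIV" by (auto intro: real_arch_simple)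
        moreover have "(SUP n::nat. emeasure (?K \<omega>) {..real n}) \<le> 1"
          using rate_density_atMost[OF e \<omega>] by (intro SUP_least) simp
        ultimately show ?thesis by simp
      qed
      then show "subprob_space (?K \<omega>)" by (intro subprob_spaceI) auto
      show "sets (?K \<omega>) = sets borel" by simp
    next
      fix A :: "real set" assume A[measurable]: "A \<in> sets borel"
      have m: "(\<lambda>(\<omega>, u). rate_density n e \<omega> u * indicator A u) \<in> borel_measurable (G n \<Otimes>\<^sub>M lborel)"
      proof -
        have [measurable]: "(\<lambda>z. rate_density n e (fst z) (snd z)) \<in> borel_measurable (G n \<Otimes>\<^sub>M lborel)"
          by (rule rate_density_measurable[OF e measurable_fst]) measurable
        show ?thesis unfolding split_beta' by measurable
      qed
      have "(\<lambda>\<omega>. \<integral>\<^sup>+u. rate_density n e \<omega> u * indicator A u \<partial>lborel) \<in> borel_measurable (G n)"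
        by (rule lborel.borel_measurable_nn_integral[OF m])
      moreover have "emeasure (?K \<omega>) A = (\<integral>\<^sup>+u. rate_density n e \<omega> u * indicator A u \<partial>lborel)" if "\<omega> \<in> space (G n)" for \<omega>
        using rate_density_path_measurable[OF e, of \<omega> n] that by (intro emeasure_density) (auto simp: space_G)
      ultimately show "(\<lambda>\<omega>. emeasure (?K \<omega>) A) \<in> borel_measurable (G n)"
        by (simp cong: measurable_cong)
    qed
    show "sets (borel :: real measure) = sigma_sets (space borel) (range atMost)"
      using borel_eq_atMost by (metis sets_measure_of space_borel subset_UNIV Pow_UNIV)
    show "Int_stable (range (atMost :: real \<Rightarrow> real set))"
      by (auto simp: Int_stable_def)
    show "range atMost \<subseteq> Pow (space (borel :: real measure))" by auto
    show "countable (range (\<lambda>n::nat. {..real n}))" by simp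
    show "range (\<lambda>n::nat. {..real n}) \<subseteq> range atMost" by auto
    show "\<Union> (range (\<lambda>n::nat. {..real n})) = space borel" by (auto intro: real_arch_simple)
    fix A :: "real set" assume "A \<in> range atMost"
    then obtain t where A: "A = {..t}" by auto
    \<comment> \<open>\<open>time\<close> is \<open>0\<close> for a jump that never happens, so a
      half-line alone could count it; the finiteness in \<open>?H\<close> excludes it.\<close>
    have "{\<omega> \<in> space M. \<omega> \<in> ?H \<and> time (Suc n) \<omega> \<in> A} = {\<omega> \<in> space M. T (Suc n) \<omega> \<le> ereal t \<and> J n \<omega> = e}"
    proof -
      have "T (Suc n) \<omega> \<le> ereal t \<longleftrightarrow> T (Suc n) \<omega> < \<infinity> \<and> time (Suc n) \<omega> \<le> t" if "\<omega> \<in> space M" for \<omega>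
        using T_nonneg[OF that, of "Suc n"] by (cases "T (Suc n) \<omega>") (auto simp: time_def)
      then show ?thesis by (auto simp: A)
    qed
    then have eq: "indicat_real {\<omega> \<in> space M. \<omega> \<in> ?H \<and> time (Suc n) \<omega> \<in> A} = indicat_real {\<omega> \<in> space M. T (Suc n) \<omega> \<le> ereal t \<and> J n \<omega> = e}"
      by simp
    show "AE \<omega> in M. \<omega> \<in> alive n \<longrightarrow>
       real_cond_exp M (G n) (indicator {\<omega> \<in> space M. \<omega> \<in> ?H \<and> time (Suc n) \<omega> \<in> A}) \<omega> = measure (?K \<omega>) A"
      unfolding eq using jump_law[of n e t]
    proof (eventually_elim, intro impI)
      fix \<omega> assume *: "\<forall>\<tau>. T n \<omega> = ereal \<tau> \<longrightarrow> e \<in> E \<omega> \<longrightarrow>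
        real_cond_exp M (G n) (indicat_real {\<omega> \<in> space M. T (Suc n) \<omega> \<le> ereal t \<and> J n \<omega> = e}) \<omega> =
        (LINT u:{\<tau>..t}|lborel. move_rate N V e u (\<lambda>i. W n \<omega> i u) *
           exp (- (LINT v:{\<tau>..u}|lborel. (\<Sum>e'\<in>E \<omega>. move_rate N V e' v (\<lambda>i. W n \<omega> i v)))))"
        and al: "\<omega> \<in> alive n"
      have \<omega>: "\<omega> \<in> space M" and E: "E \<omega> = E0" and T: "T n \<omega> = ereal (time n \<omega>)" "0 \<le> time n \<omega>"
        using al T_eq_time[of \<omega> n] time_nonneg[of \<omega> n] by (auto simp: alive_def)
      \<comment> \<open>The rate balance turns the total rate of \<open>jump_law\<close> into the
        weights \<open>1 - q\<close>.\<close>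
      have acc: "(LINT v:{time n \<omega>..u}|lborel. (\<Sum>e'\<in>E \<omega>. move_rate N V e' v (\<lambda>i. W n \<omega> i v)))
          = accumulated (\<lambda>i. 1 - q i) (W n \<omega>) (time n \<omega>) u" for u
        unfolding accumulated_def E rate_sum using T(2)
        by (intro set_lebesgue_integral_cong) (auto simp: weighted_potential_def)
      have "measure (?K \<omega>) A = (LINT u:{time n \<omega>..t}|lborel. V (max 0 u) (W n \<omega> (moved_row e) (max 0 u)) / N *
        exp (- accumulated (\<lambda>i. 1 - q i) (W n \<omega>) (time n \<omega>) u))"
        using rate_density_atMost[OF e \<omega>, of n t] by (simp add: A measure_def)
      also have "\<dots> = (LINT u:{time n \<omega>..t}|lborel. move_rate N V e u (\<lambda>i. W n \<omega> i u) *
        exp (- accumulated (\<lambda>i. 1 - q i) (W n \<omega>) (time n \<omega>) u))"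
        using T(2) by (intro set_lebesgue_integral_cong) (auto simp: move_rate_eq)
      finally show "real_cond_exp M (G n) (indicat_real {\<omega> \<in> space M. T (Suc n) \<omega> \<le> ereal t \<and> J n \<omega> = e}) \<omega> = measure (?K \<omega>) A"
        using *[rule_format, OF T(1)] e E unfolding acc by simp
    qed
  qed
  also have "\<dots> = (\<integral>\<^sup>+\<omega>. indicator (alive n) \<omega> * (\<integral>\<^sup>+u. rate_density n e \<omega> u * \<Psi> (\<omega>, u) \<partial>lborel) \<partial>M)"
  proof (rule nn_integral_cong)
    fix \<omega> assume \<omega>: "\<omega> \<in> space M"
    have "(\<lambda>u. \<Psi> (\<omega>, u)) \<in> borel_measurable lborel"
      using measurable_compose[OF measurable_Pair1'[of \<omega> "G n" borel] \<Psi>] \<omega> by (simp add: space_G)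
    then have "(\<integral>\<^sup>+u. \<Psi> (\<omega>, u) \<partial>?K \<omega>) = (\<integral>\<^sup>+u. rate_density n e \<omega> u * \<Psi> (\<omega>, u) \<partial>lborel)"
      using rate_density_path_measurable[OF e \<omega>, of n] by (intro nn_integral_density) auto
    then show "indicator (alive n) \<omega> * (\<integral>\<^sup>+u. \<Psi> (\<omega>, u) \<partial>?K \<omega>) = indicator (alive n) \<omega> * (\<integral>\<^sup>+u. rate_density n e \<omega> u * \<Psi> (\<omega>, u) \<partial>lborel)"
      by simp
  qed
  finally show ?thesis .
qed

end

section \<open>The weighted law after n jumps\<close>

context weighted_jump_process
begin

lemma discount_bounds: "0 < discount n \<omega> \<and> discount n \<omega> \<le> 1"
proof (induction n)
  case (Suc n)
  have "exp (- accumulated q (W n \<omega>) (time n \<omega>) (time (Suc n) \<omega>)) \<le> 1"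
    using accumulated_nonneg[of q] q_bounds by simp
  with Suc show ?case using mult_le_one[of "discount n \<omega>"] by simp
qed simp

lemma exp_accumulated_split:
  assumes "\<omega> \<in> space M"
  shows "exp (- accumulated (\<lambda>i. 1 - q i) (W n \<omega>) a b) * exp (- accumulated q (W n \<omega>) a b)
    = exp (- accumulated (\<lambda>_. 1) (W n \<omega>) a b)"
  using accumulated_add[OF W_space[OF assms], of "\<lambda>i. 1 - q i" n a b q] by (simp add: exp_add[symmetric])

text \<open>Conditioning in two stages: given \<open>G n\<close> the free motion is known, and the
  time and kind of the jump are integrated out; given \<open>F n\<close> the motion itself is. In
  between, the survival factor and the discount since the last jump multiply to the density in
  \<open>jump_op\<close>.\<close>

lemma functional_Suc:
  assumes \<Phi>: "\<Phi> \<in> borel_measurable states"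
  shows "functional (Suc n) \<Phi> = (\<Sum>e\<in>E0. functional n (move_op e \<Phi>))"
proof -
  let ?H = "\<lambda>e. {\<omega> \<in> space M. J n \<omega> = e \<and> T (Suc n) \<omega> < \<infinity>}"
  define \<Psi> where "\<Psi> e = (\<lambda>(\<omega>, u). ennreal (discount n \<omega> * exp (- accumulated q (W n \<omega>) (time n \<omega>) u)) *
      \<Phi> (step (tip_source e) (past_source e) (state n \<omega>) (W n \<omega>) u))" for e
  have step: "(\<integral>\<^sup>+\<omega>. indicator (alive n \<inter> ?H e) \<omega> * \<Psi> e (\<omega>, time (Suc n) \<omega>) \<partial>M) = functional n (move_op e \<Phi>)"
    if e: "e \<in> E0" for e
  proof -
    let ?j = "jump_density (moved_row e) (tip_source e) (past_source e) \<Phi>"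
    have v: "moved_row e \<in> {1..N}" "\<And>i. i \<in> {1..N} \<Longrightarrow> past_source e i \<in> {1..N}" "\<And>i. i \<in> {1..N} \<Longrightarrow> tip_source e i \<in> {1..N}"
      using valid_E0[OF e] by (auto simp: valid_move_def)
    have stG: "(\<lambda>z. state n (fst z)) \<in> G n \<Otimes>\<^sub>M L \<rightarrow>\<^sub>M states" for L :: "'z measure"
      by (rule measurable_compose[OF measurable_fst F_measurable_G[OF state_measurable]])
    have WG: "(\<lambda>z. W n (fst z)) \<in> G n \<Otimes>\<^sub>M L \<rightarrow>\<^sub>M motions" for L :: "'z measure"
      by (rule measurable_compose[OF measurable_fst W_meas])
    have tG[measurable]: "time n \<in> borel_measurable (G n)"
      by (rule F_measurable_G[OF time_measurable])
    have dG[measurable]: "discount n \<in> borel_measurable (G n)"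
      by (rule F_measurable_G[OF discount_measurable])
    have [measurable]: "(\<lambda>z. accumulated q (W n (fst z)) (time n (fst z)) (snd z)) \<in> borel_measurable (G n \<Otimes>\<^sub>M borel)"
      by (rule accumulated_measurable[OF WG]) measurable
    have [measurable]: "(\<lambda>z. \<Phi> (step (tip_source e) (past_source e) (state n (fst z)) (W n (fst z)) (snd z))) \<in> borel_measurable (G n \<Otimes>\<^sub>M borel)"
      by (rule measurable_compose[OF step_measurable[OF stG WG measurable_snd v(2,3)] \<Phi>])
    have "\<Psi> e \<in> borel_measurable (G n \<Otimes>\<^sub>M borel)"
      unfolding \<Psi>_def split_beta' by measurable
    from jump_integral[OF e this]
    have "(\<integral>\<^sup>+\<omega>. indicator (alive n \<inter> ?H e) \<omega> * \<Psi> e (\<omega>, time (Suc n) \<omega>) \<partial>M)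
      = (\<integral>\<^sup>+\<omega>. indicator (alive n) \<omega> * (\<integral>\<^sup>+u. rate_density n e \<omega> u * \<Psi> e (\<omega>, u) \<partial>lborel) \<partial>M)" .
    also have "\<dots> = (\<integral>\<^sup>+\<omega>. indicator (alive n) \<omega> * (ennreal (discount n \<omega>) *
        (\<integral>\<^sup>+u. ?j (state n \<omega>) (W n \<omega>) u \<partial>lborel)) \<partial>M)"
    proof (rule nn_integral_cong)
      fix \<omega> assume \<omega>: "\<omega> \<in> space M"
      show "indicator (alive n) \<omega> * (\<integral>\<^sup>+u. rate_density n e \<omega> u * \<Psi> e (\<omega>, u) \<partial>lborel) = indicator (alive n) \<omega> * (ennreal (discount n \<omega>) *
        (\<integral>\<^sup>+u. ?j (state n \<omega>) (W n \<omega>) u \<partial>lborel))"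
      proof (cases "\<omega> \<in> alive n")
        case True
        \<comment> \<open>The weights \<open>1 - q\<close> and \<open>q\<close> add up to
          \<open>1\<close>, so \<open>q\<close> remains only in the discount up to the last
          jump.\<close>
        have "rate_density n e \<omega> u * \<Psi> e (\<omega>, u) = ennreal (discount n \<omega>) *
          ?j (state n \<omega>) (W n \<omega>) u" for u
          using discount_bounds[of n \<omega>] V_max_bounds
          by (simp add: rate_density_def \<Psi>_def jump_density_def state_alive(1)[OF True]
              exp_accumulated_split[OF \<omega>, symmetric] ennreal_mult[symmetric] mult.assoc[symmetric])
            (simp add: mult_ac)
        moreover have "(\<lambda>u. ?j (state n \<omega>) (W n \<omega>) u) \<in> borel_measurable lborel"
          using measurable_space[OF state_measurable] W_space[OF \<omega>] \<omega>
          by (intro jump_density_measurable[OF \<Phi> v]) (auto simp: space_F)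
        ultimately show ?thesis by (simp add: nn_integral_cmult)
      qed simp
    qed
    also have "\<dots> = (\<integral>\<^sup>+\<omega>. indicator (alive n) \<omega> *
       (\<integral>\<^sup>+w. ennreal (discount n \<omega>) * (\<integral>\<^sup>+u. ?j (state n \<omega>) w u \<partial>lborel) \<partial>motion_law (state n \<omega>)) \<partial>M)"
    proof -
      have "(\<lambda>(\<omega>, w). ennreal (discount n \<omega>) * (\<integral>\<^sup>+u. ?j (state n \<omega>) w u \<partial>lborel))
        \<in> borel_measurable (F n \<Otimes>\<^sub>M motions)"
      proof -
        note [measurable] = discount_measurable[of n]
        have [measurable]: "(\<lambda>z. \<integral>\<^sup>+u. ?j (state n (fst z)) (snd z) u \<partial>lborel)
            \<in> borel_measurable (F n \<Otimes>\<^sub>M motions)"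
          by (rule jump_density_nn_integral_measurable[OF \<Phi> v measurable_compose[OF measurable_fst state_measurable] measurable_snd])
        show ?thesis unfolding split_beta' by measurable
      qed
      from free_motion_integral[OF this] show ?thesis by simp
    qed
    also have "\<dots> = functional n (move_op e \<Phi>)"
      unfolding functional_def move_op_def jump_op_def
    proof (rule nn_integral_cong)
      fix \<omega> assume \<omega>: "\<omega> \<in> space M"
      then have st: "state n \<omega> \<in> space states" using measurable_space[OF state_measurable] by (simp add: space_F)
      have sm: "sets (motion_law (state n \<omega>)) = sets motions"
        using measurable_space[OF motion_law_kernel st] by (auto simp: space_prob_algebra)
      have "(\<lambda>w. \<integral>\<^sup>+u. ?j (state n \<omega>) w u \<partial>lborel) \<in> borel_measurable (motion_law (state n \<omega>))"
        by (rule jump_density_nn_integral_measurable[OF \<Phi> v measurable_const[OF st] measurable_ident_sets[OF sm]])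
      then show "indicator (alive n) \<omega> * (\<integral>\<^sup>+w. ennreal (discount n \<omega>) * (\<integral>\<^sup>+u. ?j (state n \<omega>) w u \<partial>lborel) \<partial>motion_law (state n \<omega>))
        = indicator (alive n) \<omega> * (ennreal (discount n \<omega>) * (\<integral>\<^sup>+w. \<integral>\<^sup>+u. ?j (state n \<omega>) w u \<partial>lborel \<partial>motion_law (state n \<omega>)))"
        by (subst nn_integral_cmult) auto
    qed
    finally show ?thesis .
  qed
  \<comment> \<open>On \<open>alive (Suc n)\<close> exactly one summand survives, the one with
    \<open>e = J n\<close>, which belongs to \<open>E0\<close> by \<open>J_possible\<close>.\<close>
  have "functional (Suc n) \<Phi> = (\<integral>\<^sup>+\<omega>. (\<Sum>e\<in>E0. indicator (alive n \<inter> ?H e) \<omega> * \<Psi> e (\<omega>, time (Suc n) \<omega>)) \<partial>M)"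
    unfolding functional_def
  proof (rule nn_integral_cong)
    fix \<omega> assume \<omega>: "\<omega> \<in> space M"
    show "indicator (alive (Suc n)) \<omega> * (ennreal (discount (Suc n) \<omega>) * \<Phi> (state (Suc n) \<omega>)) =
      (\<Sum>e\<in>E0. indicator (alive n \<inter> ?H e) \<omega> * \<Psi> e (\<omega>, time (Suc n) \<omega>))"
    proof (cases "\<omega> \<in> alive (Suc n)")
      case True
      then have al: "\<omega> \<in> alive n" and Jn: "J n \<omega> \<in> E0" and fin: "T (Suc n) \<omega> < \<infinity>"
        using T_Suc_finiteD[OF \<omega>, of n] J_possible[OF \<omega>, of n] by (auto simp: alive_def)
      have "(\<Sum>e\<in>E0. indicator (alive n \<inter> ?H e) \<omega> * \<Psi> e (\<omega>, time (Suc n) \<omega>)) =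
        (\<Sum>e\<in>E0. if e = J n \<omega> then \<Psi> (J n \<omega>) (\<omega>, time (Suc n) \<omega>) else 0)"
        using al fin \<omega> by (intro sum.cong) (auto simp: indicator_def)
      also have "\<dots> = \<Psi> (J n \<omega>) (\<omega>, time (Suc n) \<omega>)"
        using Jn finite_E0 by simp
      finally show ?thesis using True Jn by (simp add: \<Psi>_def)
    next
      case False
      then have "\<omega> \<notin> alive n \<inter> ?H e" for e by (auto simp: alive_def)
      with False show ?thesis by simp
    qed
  qed
  also have "\<dots> = (\<Sum>e\<in>E0. \<integral>\<^sup>+\<omega>. indicator (alive n \<inter> ?H e) \<omega> * \<Psi> e (\<omega>, time (Suc n) \<omega>) \<partial>M)"
  proof (rule nn_integral_sum)
    fix e assume e: "e \<in> E0"
    have v: "\<And>i. i \<in> {1..N} \<Longrightarrow> past_source e i \<in> {1..N}" "\<And>i. i \<in> {1..N} \<Longrightarrow> tip_source e i \<in> {1..N}"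
      using valid_E0[OF e] by (auto simp: valid_move_def)
    note [measurable] = F_measurable_M[OF discount_measurable[of n]] F_measurable_M[OF time_measurable[of n]]
      F_measurable_M[OF time_measurable[of "Suc n"]]
    have [measurable]: "(\<lambda>\<omega>. accumulated q (W n \<omega>) (time n \<omega>) (time (Suc n) \<omega>)) \<in> borel_measurable M"
      by (rule accumulated_measurable[OF G_measurable_M[OF W_meas]]) measurable
    have [measurable]: "(\<lambda>\<omega>. \<Phi> (step (tip_source e) (past_source e) (state n \<omega>) (W n \<omega>) (time (Suc n) \<omega>))) \<in> borel_measurable M"
      by (rule measurable_compose[OF step_measurable[OF F_measurable_M[OF state_measurable] G_measurable_M[OF W_meas] _ v] \<Phi>]) measurable
    have [measurable]: "alive n \<inter> ?H e \<in> sets M"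
      by (intro sets.Int jump_event_sets F_sets_M[OF alive_sets])
    show "(\<lambda>\<omega>. indicator (alive n \<inter> ?H e) \<omega> * \<Psi> e (\<omega>, time (Suc n) \<omega>)) \<in> borel_measurable M"
      unfolding \<Psi>_def prod.case by measurable
  qed
  also have "\<dots> = (\<Sum>e\<in>E0. functional n (move_op e \<Phi>))"
    by (intro sum.cong refl step)
  finally show ?thesis .
qed

text \<open>\<open>jump_law\<close> gives the probabilities of jumping by time \<open>t\<close>;
  survival is obtained as the complement. The jump probabilities add up to one minus the
  exponential, both parts together give the integral of \<open>B\<close>, and the jump part is
  cancelled. Cancellation needs it to be finite, whence the bound on \<open>B\<close>.\<close>

lemma survival_integral:
  assumes B[measurable]: "B \<in> borel_measurable (G n)" and B1: "\<And>\<omega>. \<omega> \<in> space M \<Longrightarrow> B \<omega> \<le> 1"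
    and Bt: "\<And>\<omega>. \<omega> \<in> space M \<Longrightarrow> B \<omega> \<noteq> 0 \<Longrightarrow> \<omega> \<in> alive n \<and> time n \<omega> \<le> t"
  shows "(\<integral>\<^sup>+\<omega>. indicator {\<omega>. ereal t < T (Suc n) \<omega>} \<omega> * B \<omega> \<partial>M)
    = (\<integral>\<^sup>+\<omega>. ennreal (exp (- accumulated (\<lambda>i. 1 - q i) (W n \<omega>) (time n \<omega>) t)) * B \<omega> \<partial>M)"
proof -
  let ?H = "\<lambda>e. {\<omega> \<in> space M. J n \<omega> = e \<and> T (Suc n) \<omega> < \<infinity>}"
  let ?A = "\<lambda>\<omega>. accumulated (\<lambda>i. 1 - q i) (W n \<omega>) (time n \<omega>) t"
  let ?g = "\<lambda>e \<omega> u. V (max 0 u) (W n \<omega> (moved_row e) (max 0 u)) / N *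
        exp (- accumulated (\<lambda>i. 1 - q i) (W n \<omega>) (time n \<omega>) u)"
  note [measurable] = G_measurable_M[OF B] F_measurable_M[OF time_measurable[of n]] F_measurable_M[OF T_meas[of "Suc n"]]
  have [measurable]: "?A \<in> borel_measurable M"
    by (rule accumulated_measurable[OF G_measurable_M[OF W_meas]]) measurable
  have A0: "0 \<le> ?A \<omega>" for \<omega> using q_bounds by (intro accumulated_nonneg) simp
  have "(\<integral>\<^sup>+\<omega>. indicator {\<omega>. T (Suc n) \<omega> \<le> ereal t} \<omega> * B \<omega> \<partial>M)
    = (\<integral>\<^sup>+\<omega>. (\<Sum>e\<in>E0. indicator (alive n \<inter> ?H e) \<omega> * (indicator {..t} (time (Suc n) \<omega>) * B \<omega>)) \<partial>M)"
  proof (rule nn_integral_cong)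
    fix \<omega> assume \<omega>: "\<omega> \<in> space M"
    show "indicator {\<omega>. T (Suc n) \<omega> \<le> ereal t} \<omega> * B \<omega> =
      (\<Sum>e\<in>E0. indicator (alive n \<inter> ?H e) \<omega> * (indicator {..t} (time (Suc n) \<omega>) * B \<omega>))"
    proof (cases "B \<omega> = 0")
      case False
      with Bt[OF \<omega>] have al: "\<omega> \<in> alive n" by simp
      show ?thesis
      proof (cases "T (Suc n) \<omega> < \<infinity>")
        case True
        then have Jn: "J n \<omega> \<in> E0" using J_possible[OF \<omega>, of n] al by (auto simp: alive_def)
        have "(\<Sum>e\<in>E0. indicator (alive n \<inter> ?H e) \<omega> * (indicator {..t} (time (Suc n) \<omega>) * B \<omega>)) =
          (\<Sum>e\<in>E0. if e = J n \<omega> then indicator {..t} (time (Suc n) \<omega>) * B \<omega> else 0)"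
          using al True \<omega> by (intro sum.cong) (auto simp: indicator_def)
        also have "\<dots> = indicator {..t} (time (Suc n) \<omega>) * B \<omega>" using Jn finite_E0 by simp
        finally show ?thesis using T_eq_time[OF \<omega> True] by (simp add: indicator_def)
      qed (auto simp: indicator_def)
    qed simp
  qed
  also have "\<dots> = (\<Sum>e\<in>E0. \<integral>\<^sup>+\<omega>. indicator (alive n \<inter> ?H e) \<omega> * (indicator {..t} (time (Suc n) \<omega>) * B \<omega>) \<partial>M)"
  proof (rule nn_integral_sum)
    fix e
    note [measurable] = jump_event_sets[of n e] F_sets_M[OF alive_sets[of n]] F_measurable_M[OF time_measurable[of "Suc n"]]
    show "(\<lambda>\<omega>. indicator (alive n \<inter> ?H e) \<omega> * (indicator {..t} (time (Suc n) \<omega>) * B \<omega>)) \<in> borel_measurable M"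
      by measurable
  qed
  also have "\<dots> = (\<Sum>e\<in>E0. \<integral>\<^sup>+\<omega>. indicator (alive n) \<omega> * (\<integral>\<^sup>+u. rate_density n e \<omega> u * (indicator {..t} u * B \<omega>) \<partial>lborel) \<partial>M)"
  proof (rule sum.cong[OF refl])
    fix e assume e: "e \<in> E0"
    have "(\<lambda>(\<omega>, u). indicator {..t} u * B \<omega>) \<in> borel_measurable (G n \<Otimes>\<^sub>M borel)"
      unfolding split_beta' by measurable
    from jump_integral[OF e this]
    show "(\<integral>\<^sup>+\<omega>. indicator (alive n \<inter> ?H e) \<omega> * (indicator {..t} (time (Suc n) \<omega>) * B \<omega>) \<partial>M)
      = (\<integral>\<^sup>+\<omega>. indicator (alive n) \<omega> * (\<integral>\<^sup>+u. rate_density n e \<omega> u * (indicator {..t} u * B \<omega>) \<partial>lborel) \<partial>M)"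
      by simp
  qed
  also have "\<dots> = (\<Sum>e\<in>E0. \<integral>\<^sup>+\<omega>. B \<omega> * emeasure (density lborel (rate_density n e \<omega>)) {..t} \<partial>M)"
  proof (intro sum.cong refl nn_integral_cong)
    fix e \<omega> assume e: "e \<in> E0" and \<omega>: "\<omega> \<in> space M"
    have rd: "rate_density n e \<omega> \<in> borel_measurable borel" by (rule rate_density_path_measurable[OF e \<omega>])
    have "(\<integral>\<^sup>+u. rate_density n e \<omega> u * (indicator {..t} u * B \<omega>) \<partial>lborel) = (\<integral>\<^sup>+u. B \<omega> * (rate_density n e \<omega> u * indicator {..t} u) \<partial>lborel)"
      by (intro nn_integral_cong) (simp add: mult_ac)
    also have "\<dots> = B \<omega> * (\<integral>\<^sup>+u. rate_density n e \<omega> u * indicator {..t} u \<partial>lborel)"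
      using rd by (intro nn_integral_cmult) auto
    also have "(\<integral>\<^sup>+u. rate_density n e \<omega> u * indicator {..t} u \<partial>lborel) = emeasure (density lborel (rate_density n e \<omega>)) {..t}"
      using rd by (intro emeasure_density[symmetric]) auto
    finally show "indicator (alive n) \<omega> * (\<integral>\<^sup>+u. rate_density n e \<omega> u * (indicator {..t} u * B \<omega>) \<partial>lborel)
       = B \<omega> * emeasure (density lborel (rate_density n e \<omega>)) {..t}"
      using Bt[OF \<omega>] by (cases "B \<omega> = 0") auto
  qed
  also have "\<dots> = (\<integral>\<^sup>+\<omega>. (\<Sum>e\<in>E0. B \<omega> * emeasure (density lborel (rate_density n e \<omega>)) {..t}) \<partial>M)"
  proof (rule nn_integral_sum[symmetric])
    fix e assume e: "e \<in> E0"
    have m: "(\<lambda>(\<omega>, u). rate_density n e \<omega> u * indicator {..t} u) \<in> borel_measurable (G n \<Otimes>\<^sub>M lborel)"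
    proof -
      have [measurable]: "(\<lambda>z. rate_density n e (fst z) (snd z)) \<in> borel_measurable (G n \<Otimes>\<^sub>M lborel)"
        by (rule rate_density_measurable[OF e measurable_fst]) measurable
      show ?thesis unfolding split_beta' by measurable
    qed
    have "(\<lambda>\<omega>. \<integral>\<^sup>+u. rate_density n e \<omega> u * indicator {..t} u \<partial>lborel) \<in> borel_measurable M"
      by (rule G_measurable_M[OF lborel.borel_measurable_nn_integral[OF m]])
    moreover have "emeasure (density lborel (rate_density n e \<omega>)) {..t} = (\<integral>\<^sup>+u. rate_density n e \<omega> u * indicator {..t} u \<partial>lborel)" if "\<omega> \<in> space M" for \<omega>
      using rate_density_path_measurable[OF e that, of n] by (intro emeasure_density) auto
    ultimately have "(\<lambda>\<omega>. emeasure (density lborel (rate_density n e \<omega>)) {..t}) \<in> borel_measurable M"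
      by (simp cong: measurable_cong)
    then show "(\<lambda>\<omega>. B \<omega> * emeasure (density lborel (rate_density n e \<omega>)) {..t}) \<in> borel_measurable M"
      by measurable
  qed
  also have "\<dots> = (\<integral>\<^sup>+\<omega>. ennreal (1 - exp (- ?A \<omega>)) * B \<omega> \<partial>M)"
  proof (rule nn_integral_cong)
    fix \<omega> assume \<omega>: "\<omega> \<in> space M"
    show "(\<Sum>e\<in>E0. B \<omega> * emeasure (density lborel (rate_density n e \<omega>)) {..t}) = ennreal (1 - exp (- ?A \<omega>)) * B \<omega>"
    proof (cases "B \<omega> = 0")
      case False
      then have tt: "time n \<omega> \<le> t" using Bt[OF \<omega>] by simp
      have tot: "(\<Sum>e\<in>E0. LINT u:{time n \<omega>..t}|lborel. ?g e \<omega> u) = 1 - exp (- ?A \<omega>)"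
        by (rule total_jump_probability[OF \<omega> tt])
      have "(\<Sum>e\<in>E0. B \<omega> * emeasure (density lborel (rate_density n e \<omega>)) {..t})
        = B \<omega> * (\<Sum>e\<in>E0. ennreal (LINT u:{time n \<omega>..t}|lborel. ?g e \<omega> u))"
        unfolding sum_distrib_left by (intro sum.cong refl) (simp only: rate_density_atMost(1)[OF _ \<omega>])
      also have "(\<Sum>e\<in>E0. ennreal (LINT u:{time n \<omega>..t}|lborel. ?g e \<omega> u)) = ennreal (\<Sum>e\<in>E0. LINT u:{time n \<omega>..t}|lborel. ?g e \<omega> u)"
        by (intro sum_ennreal rate_density_atMost(3)[OF _ \<omega>])
      finally show ?thesis unfolding tot by (simp add: mult.commute)
    qed simp
  qed
  finally have hit: "(\<integral>\<^sup>+\<omega>. indicator {\<omega>. T (Suc n) \<omega> \<le> ereal t} \<omega> * B \<omega> \<partial>M) = (\<integral>\<^sup>+\<omega>. ennreal (1 - exp (- ?A \<omega>)) * B \<omega> \<partial>M)" .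
  have [measurable]: "(\<lambda>\<omega>. indicator {\<omega>. T (Suc n) \<omega> \<le> ereal t} \<omega> :: ennreal) \<in> borel_measurable M"
      "(\<lambda>\<omega>. indicator {\<omega>. ereal t < T (Suc n) \<omega>} \<omega> :: ennreal) \<in> borel_measurable M"
    unfolding indicator_def by measurable
  have "(\<integral>\<^sup>+\<omega>. indicator {\<omega>. ereal t < T (Suc n) \<omega>} \<omega> * B \<omega> \<partial>M) + (\<integral>\<^sup>+\<omega>. indicator {\<omega>. T (Suc n) \<omega> \<le> ereal t} \<omega> * B \<omega> \<partial>M)
      = (\<integral>\<^sup>+\<omega>. B \<omega> \<partial>M)"
    by (subst nn_integral_add[symmetric]) (auto intro!: nn_integral_cong simp: indicator_def)
  also have "\<dots> = (\<integral>\<^sup>+\<omega>. ennreal (exp (- ?A \<omega>)) * B \<omega> \<partial>M) + (\<integral>\<^sup>+\<omega>. ennreal (1 - exp (- ?A \<omega>)) * B \<omega> \<partial>M)"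
  proof (subst nn_integral_add[symmetric])
    have "B \<omega> = ennreal (exp (- ?A \<omega>)) * B \<omega> + ennreal (1 - exp (- ?A \<omega>)) * B \<omega>" for \<omega>
      using A0[of \<omega>] by (simp add: distrib_right[symmetric] ennreal_plus[symmetric] del: ennreal_plus)
    then show "(\<integral>\<^sup>+\<omega>. B \<omega> \<partial>M) = (\<integral>\<^sup>+\<omega>. ennreal (exp (- ?A \<omega>)) * B \<omega> + ennreal (1 - exp (- ?A \<omega>)) * B \<omega> \<partial>M)"
      by simp
  qed measurable
  finally have eq: "(\<integral>\<^sup>+\<omega>. indicator {\<omega>. ereal t < T (Suc n) \<omega>} \<omega> * B \<omega> \<partial>M) + (\<integral>\<^sup>+\<omega>. indicator {\<omega>. T (Suc n) \<omega> \<le> ereal t} \<omega> * B \<omega> \<partial>M)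
    = (\<integral>\<^sup>+\<omega>. ennreal (exp (- ?A \<omega>)) * B \<omega> \<partial>M) + (\<integral>\<^sup>+\<omega>. indicator {\<omega>. T (Suc n) \<omega> \<le> ereal t} \<omega> * B \<omega> \<partial>M)"
    unfolding hit .
  have "(\<integral>\<^sup>+\<omega>. indicator {\<omega>. T (Suc n) \<omega> \<le> ereal t} \<omega> * B \<omega> \<partial>M) \<le> (\<integral>\<^sup>+\<omega>. 1 \<partial>M)"
    using B1 by (intro nn_integral_mono) (auto simp: indicator_def)
  then have "(\<integral>\<^sup>+\<omega>. indicator {\<omega>. T (Suc n) \<omega> \<le> ereal t} \<omega> * B \<omega> \<partial>M) \<noteq> top"
    by (auto simp: emeasure_space_1 top_unique)
  then show ?thesis using eq by (simp only: add.commute[of _ "\<integral>\<^sup>+\<omega>. indicator {\<omega>. T (Suc n) \<omega> \<le> ereal t} \<omega> * B \<omega> \<partial>M"] ennreal_add_left_cancel) simp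
qed


section \<open>The weight as a product over the jumps\<close>

lemma integral_extend:
  assumes \<omega>: "\<omega> \<in> space M" and f: "\<And>s. a < s \<Longrightarrow> s < b \<Longrightarrow> f s = weighted_potential q (W n \<omega>) s"
    and a: "0 \<le> a" "a \<le> b" and i: "set_integrable lborel {0..a} f"
  shows "set_integrable lborel {0..b} f"
    and "(LINT s:{0..b}|lborel. f s) = (LINT s:{0..a}|lborel. f s) + accumulated q (W n \<omega>) a b"
proof -
  have s: "{0..b} = {0..a} \<union> {a..b}" using a by auto
  have g: "set_integrable lborel {a..b} (weighted_potential q (W n \<omega>))"
    by (rule set_integrable_weighted_potential[OF W_space[OF \<omega>]])
  note fi = set_integral_eq_on_open_interval[OF f g]
  show "set_integrable lborel {0..b} f"
    unfolding s using i fi(1) by (intro set_integrable_Un) auto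
  have "AE x in lborel. \<not> (x \<in> {0..a} \<and> x \<in> {a..b})"
    using AE_lborel_singleton[of a] by eventually_elim auto
  then show "(LINT s:{0..b}|lborel. f s) = (LINT s:{0..a}|lborel. f s) + accumulated q (W n \<omega>) a b"
    unfolding s accumulated_def using i fi by (subst set_integral_Un_AE) auto
qed

text \<open>Integrability is carried through the induction, because splitting the integral at a jump
  time requires it and \<open>f\<close> is known between jumps only.\<close>

lemma discount_eq_at_jump:
  assumes \<omega>: "\<omega> \<in> space M"
    and f: "\<And>n s. T n \<omega> < ereal s \<Longrightarrow> ereal s < T (Suc n) \<omega> \<Longrightarrow> f s = weighted_potential q (W n \<omega>) s"
  shows "T n \<omega> < \<infinity> \<Longrightarrow> set_integrable lborel {0..time n \<omega>} f \<and> exp (- (LINT s:{0..time n \<omega>}|lborel. f s)) = discount n \<omega>"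
proof (induction n)
  case 0
  have t0: "time 0 \<omega> = 0" using T_0[OF \<omega>] by (simp add: time_def)
  \<comment> \<open>The open interval is empty, so \<open>f\<close> agrees with \<open>0\<close> on
    it vacuously and is integrable over a point without being known to be measurable.\<close>
  have "set_integrable lborel {0..0} (\<lambda>_. 0::real)" by (simp add: set_integrable_def)
  from set_integral_eq_on_open_interval[OF _ this, of f] show ?case by (simp add: t0 set_lebesgue_integral_def)
next
  case (Suc n)
  have fin: "T n \<omega> < \<infinity>" using T_Suc_finiteD[OF \<omega> Suc.prems] .
  note ih = Suc.IH[OF fin]
  have fs: "f s = weighted_potential q (W n \<omega>) s" if "time n \<omega> < s" "s < time (Suc n) \<omega>" for s
    using that T_eq_time[OF \<omega> fin] T_eq_time[OF \<omega> Suc.prems] by (intro f) auto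
  note ext = integral_extend[OF \<omega> fs time_nonneg[OF \<omega>] less_imp_le[OF time_less_Suc[OF \<omega> Suc.prems]]]
  show ?case using ih ext by (auto simp: exp_diff exp_minus divide_inverse)
qed

lemma discount_eq:
  assumes \<omega>: "\<omega> \<in> space M"
    and f: "\<And>n s. T n \<omega> < ereal s \<Longrightarrow> ereal s < T (Suc n) \<omega> \<Longrightarrow> f s = weighted_potential q (W n \<omega>) s"
    and t: "T n \<omega> \<le> ereal t" "ereal t < T (Suc n) \<omega>"
  shows "exp (- (LINT s:{0..t}|lborel. f s)) = discount n \<omega> * exp (- accumulated q (W n \<omega>) (time n \<omega>) t)"
proof -
  have fin: "T n \<omega> < \<infinity>" using t(1) by (cases "T n \<omega>") auto
  note ih = discount_eq_at_jump[OF \<omega> f fin]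
  have fs: "f s = weighted_potential q (W n \<omega>) s" if "time n \<omega> < s" "s < t" for s
    using that T_eq_time[OF \<omega> fin] t(2) by (intro f) (auto intro: less_trans[of _ "ereal t"])
  have "time n \<omega> \<le> t" using T_eq_time[OF \<omega> fin] t(1) by simp
  note ext = integral_extend(2)[OF \<omega> fs time_nonneg[OF \<omega>] this]
  show ?thesis using ih ext by (auto simp: exp_diff exp_minus divide_inverse)
qed

lemma ex_current_jump:
  assumes \<omega>: "\<omega> \<in> space M" and t: "0 \<le> t"
  shows "\<exists>n. T n \<omega> \<le> ereal t \<and> ereal t < T (Suc n) \<omega>"
proof -
  have "eventually (\<lambda>n. ereal t < T n \<omega>) sequentially"
    using T_unbounded[OF \<omega>] by (simp add: order_tendsto_iff)
  then obtain m where m: "ereal t < T m \<omega>" by (auto simp: eventually_sequentially)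
  define k where "k = (LEAST k. ereal t < T k \<omega>)"
  have k: "ereal t < T k \<omega>" unfolding k_def using m by (rule LeastI)
  have "k \<noteq> 0" using k T_0[OF \<omega>] t by (cases k) auto
  then obtain n where n: "k = Suc n" using not0_implies_Suc by blast
  have "\<not> ereal t < T n \<omega>" using not_less_Least[of n "\<lambda>k. ereal t < T k \<omega>"] n by (simp add: k_def)
  then show ?thesis using k n by (auto simp: not_less)
qed

lemma current_jump_unique:
  assumes \<omega>: "\<omega> \<in> space M" and "T n \<omega> \<le> ereal t" "ereal t < T (Suc n) \<omega>" "T m \<omega> \<le> ereal t" "ereal t < T (Suc m) \<omega>"
  shows "m = n"
  using T_mono[OF \<omega>, of "Suc n" m] T_mono[OF \<omega>, of "Suc m" n] assms(2-)
  by (meson not_less_eq_eq le_antisym leD order_trans not_le)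

text \<open>The inequality on the left is strict because \<open>W n\<close> is tied to the terminal
  value at \<open>T n\<close> through its law only: at \<open>s = T n\<close> equality would hold
  merely almost surely.\<close>

lemma current_row:
  assumes \<omega>: "\<omega> \<in> space M" and n: "T n \<omega> < ereal s" "ereal s < T (Suc n) \<omega>" and i: "i \<in> {1..N}"
  shows "snd (Z s \<omega>) i s = W n \<omega> i s"
proof -
  have fin: "T n \<omega> < \<infinity>" using n(1) by (cases "T n \<omega>") auto
  have "time n \<omega> < s" using n(1) T_eq_time[OF \<omega> fin] by simp
  then show ?thesis
    using between_jumps[OF \<omega> T_eq_time[OF \<omega> fin] _ n(2)] time_nonneg[OF \<omega>, of n] i by (simp add: prolong_def)
qed

text \<open>The index of the last jump up to \<open>t\<close> is random. A series over all indices
  with at most one nonzero term replaces it, and such a series can be integrated term by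
  term.\<close>

lemma suminf_current_jump:
  assumes \<omega>: "\<omega> \<in> space M" and n: "T n \<omega> \<le> ereal t" "ereal t < T (Suc n) \<omega>"
  shows "(\<Sum>m. indicator {\<omega>. ereal t < T (Suc m) \<omega>} \<omega> * (indicator (alive m) \<omega> * (indicator {..t} (time m \<omega>) * g m)))
    = indicator (alive n) \<omega> * (indicator {..t} (time n \<omega>) * (g n :: ennreal))"
proof -
  define b where "b m = indicator (alive m) \<omega> * (indicator {..t} (time m \<omega>) * g m)" for m
  have "(\<Sum>m. indicator {\<omega>. ereal t < T (Suc m) \<omega>} \<omega> * b m) = (\<Sum>m\<in>{n}. indicator {\<omega>. ereal t < T (Suc m) \<omega>} \<omega> * b m)"
  proof (rule suminf_finite)
    fix m assume m: "m \<notin> {n}"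
    show "indicator {\<omega>. ereal t < T (Suc m) \<omega>} \<omega> * b m = 0"
    proof (rule ccontr)
      assume "indicator {\<omega>. ereal t < T (Suc m) \<omega>} \<omega> * b m \<noteq> 0"
      then have "ereal t < T (Suc m) \<omega>" "\<omega> \<in> alive m" "time m \<omega> \<le> t"
        by (auto simp: b_def indicator_def split: if_splits)
      then have "T m \<omega> \<le> ereal t" "ereal t < T (Suc m) \<omega>"
        using T_eq_time[OF \<omega>, of m] by (auto simp: alive_def)
      then show False using current_jump_unique[OF \<omega> n] m by simp
    qed
  qed simp
  then show ?thesis using n by (simp add: b_def[symmetric])
qed

text \<open>No joint measurability of \<open>f\<close> is assumed. The weight is measurable because
  it equals a series of measurable terms built from the driving data.\<close>

lemma weight_measurable:
  assumes t: "0 \<le> t"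
    and f: "\<And>\<omega> n s. \<omega> \<in> space M \<Longrightarrow> E \<omega> = E0 \<Longrightarrow> T n \<omega> < ereal s \<Longrightarrow> ereal s < T (Suc n) \<omega> \<Longrightarrow>
      f \<omega> s = weighted_potential q (W n \<omega>) s"
  shows "(\<lambda>\<omega>. indicator {\<omega>. E \<omega> = E0} \<omega> * exp (- (LINT s:{0..t}|lborel. f \<omega> s))) \<in> borel_measurable M"
proof -
  define g where "g n \<omega> = ennreal (discount n \<omega> * exp (- accumulated q (W n \<omega>) (time n \<omega>) t))" for n \<omega>
  define S where "S \<omega> = (\<Sum>m. indicator {\<omega>. ereal t < T (Suc m) \<omega>} \<omega> * (indicator (alive m) \<omega> * (indicator {..t} (time m \<omega>) * g m \<omega>)))" for \<omega>
  have "(\<lambda>\<omega>. indicator {\<omega>. ereal t < T (Suc n) \<omega>} \<omega> * (indicator (alive n) \<omega> * (indicator {..t} (time n \<omega>) * g n \<omega>))) \<in> borel_measurable M" for n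
  proof -
    note [measurable] = F_measurable_M[OF time_measurable[of n]] F_measurable_M[OF discount_measurable[of n]] F_sets_M[OF alive_sets[of n]]
      F_measurable_M[OF T_meas[of "Suc n"]]
    have [measurable]: "(\<lambda>\<omega>. accumulated q (W n \<omega>) (time n \<omega>) t) \<in> borel_measurable M"
      by (rule accumulated_measurable[OF G_measurable_M[OF W_meas]]) measurable
    have [measurable]: "(\<lambda>\<omega>. indicator {\<omega>. ereal t < T (Suc n) \<omega>} \<omega> :: ennreal) \<in> borel_measurable M"
      unfolding indicator_def by measurable
    show ?thesis unfolding g_def by measurable
  qed
  then have "S \<in> borel_measurable M" unfolding S_def by (rule borel_measurable_suminf_order)
  then have "(\<lambda>\<omega>. enn2real (S \<omega>)) \<in> borel_measurable M" by measurable
  moreover have "enn2real (S \<omega>) = indicator {\<omega>. E \<omega> = E0} \<omega> * exp (- (LINT s:{0..t}|lborel. f \<omega> s))" if \<omega>: "\<omega> \<in> space M" for \<omega>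
  proof -
    obtain n where n: "T n \<omega> \<le> ereal t" "ereal t < T (Suc n) \<omega>" using ex_current_jump[OF \<omega> t] by blast
    have S: "S \<omega> = indicator (alive n) \<omega> * (indicator {..t} (time n \<omega>) * g n \<omega>)"
      unfolding S_def by (rule suminf_current_jump[OF \<omega> n])
    show ?thesis
    proof (cases "E \<omega> = E0")
      case True
      have fin: "T n \<omega> < \<infinity>" using n(1) by (cases "T n \<omega>") auto
      have "exp (- (LINT s:{0..t}|lborel. f \<omega> s)) = discount n \<omega> * exp (- accumulated q (W n \<omega>) (time n \<omega>) t)"
        using f[OF \<omega> True] by (intro discount_eq[OF \<omega> _ n]) blast
      then show ?thesis
        using True fin n(1) T_eq_time[OF \<omega> fin] \<omega> discount_bounds[of n \<omega>] unfolding S g_def by (simp add: alive_def)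
    qed (simp add: S alive_def)
  qed
  ultimately show ?thesis by (simp cong: measurable_cong)
qed

lemma functional_cong:
  assumes "\<And>\<eta>. \<eta> \<in> space states \<Longrightarrow> \<Phi> \<eta> = \<Psi> \<eta>"
  shows "functional n \<Phi> = functional n \<Psi>"
  unfolding functional_def using measurable_space[OF state_measurable[of n]]
  by (intro nn_integral_cong) (simp add: assms space_F)

lemma functional_0: "functional 0 \<Phi> = (\<integral>\<^sup>+\<omega>. indicator {\<omega>. E \<omega> = E0} \<omega> * \<Phi> (state 0 \<omega>) \<partial>M)"
  unfolding functional_def by (intro nn_integral_cong) (auto simp: alive_def T_0 indicator_def)

text \<open>Split by the index \<open>n\<close> of the last jump up to \<open>t\<close>. That no
  further jump occurs is integrated out given \<open>G n\<close>, the free motion given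
  \<open>F n\<close>; survival and the discount since the last jump again merge into the exponential
  with weights \<open>1\<close>.\<close>

lemma expansion:
  assumes t: "0 \<le> t" and A: "A \<in> sets (raw_rows {0..t} \<Otimes>\<^sub>M raw_rows {0..t})"
    and f: "\<And>\<omega> n s. \<omega> \<in> space M \<Longrightarrow> E \<omega> = E0 \<Longrightarrow> T n \<omega> < ereal s \<Longrightarrow> ereal s < T (Suc n) \<omega> \<Longrightarrow>
      f \<omega> s = weighted_potential q (W n \<omega>) s"
  shows "(\<integral>\<^sup>+\<omega>. indicator {\<omega>. E \<omega> = E0} \<omega> * (ennreal (exp (- (LINT s:{0..t}|lborel. f \<omega> s))) * indicator A (Z t \<omega>)) \<partial>M)
    = (\<Sum>n. functional n (final_op t A))"
proof -
  define I where "I n \<omega> = (indicator A (map_prod (prolong N (fst (state n \<omega>)) t (W n \<omega>)) (prolong N (fst (state n \<omega>)) t (W n \<omega>)) (snd (snd (state n \<omega>)))) :: ennreal)" for n \<omega>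
  define B where "B n \<omega> = (indicator (alive n) \<omega> * (indicator {..t} (time n \<omega>) * (ennreal (discount n \<omega> * exp (- accumulated q (W n \<omega>) (time n \<omega>) t)) * I n \<omega>)) :: ennreal)" for n \<omega>
  have B[measurable]: "B n \<in> borel_measurable (G n)" for n
  proof -
    note [measurable] = F_measurable_G[OF time_measurable[of n]] F_measurable_G[OF discount_measurable[of n]] F_sets_G[OF alive_sets[of n]]
    have [measurable]: "(\<lambda>\<omega>. accumulated q (W n \<omega>) (time n \<omega>) t) \<in> borel_measurable (G n)"
      by (rule accumulated_measurable[OF W_meas]) measurable
    have [measurable]: "I n \<in> borel_measurable (G n)"
      unfolding I_def by (rule measurable_compose[OF prolong_pair_measurable[OF F_measurable_G[OF state_measurable] W_meas] borel_measurable_indicator[OF A]])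
    show ?thesis unfolding B_def by measurable
  qed
  have "(\<integral>\<^sup>+\<omega>. indicator {\<omega>. E \<omega> = E0} \<omega> * (ennreal (exp (- (LINT s:{0..t}|lborel. f \<omega> s))) * indicator A (Z t \<omega>)) \<partial>M)
    = (\<integral>\<^sup>+\<omega>. (\<Sum>n. indicator {\<omega>. ereal t < T (Suc n) \<omega>} \<omega> * B n \<omega>) \<partial>M)"
  proof (rule nn_integral_cong)
    fix \<omega> assume \<omega>: "\<omega> \<in> space M"
    obtain n where n: "T n \<omega> \<le> ereal t" "ereal t < T (Suc n) \<omega>" using ex_current_jump[OF \<omega> t] by blast
    have "(\<Sum>m. indicator {\<omega>. ereal t < T (Suc m) \<omega>} \<omega> * B m \<omega>) = B n \<omega>"
      unfolding B_def by (rule suminf_current_jump[OF \<omega> n])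
    also have "B n \<omega> = indicator {\<omega>. E \<omega> = E0} \<omega> * (ennreal (exp (- (LINT s:{0..t}|lborel. f \<omega> s))) * indicator A (Z t \<omega>))"
    proof (cases "E \<omega> = E0")
      case True
      have fin: "T n \<omega> < \<infinity>" using n(1) by (cases "T n \<omega>") auto
      then have al: "\<omega> \<in> alive n" using \<omega> True by (simp add: alive_def)
      have tm: "time n \<omega> \<le> t" using n(1) T_eq_time[OF \<omega> fin] by simp
      have "Z t \<omega> = map_prod (prolong N (fst (state n \<omega>)) t (W n \<omega>)) (prolong N (fst (state n \<omega>)) t (W n \<omega>)) (snd (snd (state n \<omega>)))"
        unfolding state_alive[OF al] by (rule between_jumps[OF \<omega> T_eq_time[OF \<omega> fin] tm n(2)])
      moreover have "exp (- (LINT s:{0..t}|lborel. f \<omega> s)) = discount n \<omega> * exp (- accumulated q (W n \<omega>) (time n \<omega>) t)"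
        using f[OF \<omega> True] by (intro discount_eq[OF \<omega> _ n]) blast
      ultimately show ?thesis using True al tm by (simp add: B_def I_def)
    qed (simp add: B_def alive_def)
    finally show "indicator {\<omega>. E \<omega> = E0} \<omega> * (ennreal (exp (- (LINT s:{0..t}|lborel. f \<omega> s))) * indicator A (Z t \<omega>))
      = (\<Sum>n. indicator {\<omega>. ereal t < T (Suc n) \<omega>} \<omega> * B n \<omega>)" by simp
  qed
  also have "\<dots> = (\<Sum>n. \<integral>\<^sup>+\<omega>. indicator {\<omega>. ereal t < T (Suc n) \<omega>} \<omega> * B n \<omega> \<partial>M)"
  proof (rule nn_integral_suminf)
    fix n
    note [measurable] = G_measurable_M[OF B[of n]] F_measurable_M[OF T_meas[of "Suc n"]]
    show "(\<lambda>\<omega>. indicator {\<omega>. ereal t < T (Suc n) \<omega>} \<omega> * B n \<omega>) \<in> borel_measurable M"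
      unfolding indicator_def by measurable
  qed
  also have "\<dots> = (\<Sum>n. functional n (final_op t A))"
  proof (rule suminf_cong)
    fix n
    have "(\<integral>\<^sup>+\<omega>. indicator {\<omega>. ereal t < T (Suc n) \<omega>} \<omega> * B n \<omega> \<partial>M)
       = (\<integral>\<^sup>+\<omega>. ennreal (exp (- accumulated (\<lambda>i. 1 - q i) (W n \<omega>) (time n \<omega>) t)) * B n \<omega> \<partial>M)"
    proof (rule survival_integral[OF B])
      fix \<omega> assume \<omega>: "\<omega> \<in> space M"
      have "discount n \<omega> * exp (- accumulated q (W n \<omega>) (time n \<omega>) t) \<le> 1"
        using discount_bounds[of n \<omega>] accumulated_nonneg[of q] q_bounds by (intro mult_le_one) auto
      then show "B n \<omega> \<le> 1" by (auto simp: B_def I_def indicator_def ennreal_le_1)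
      show "B n \<omega> \<noteq> 0 \<Longrightarrow> \<omega> \<in> alive n \<and> time n \<omega> \<le> t" by (auto simp: B_def indicator_def split: if_splits)
    qed
    also have "\<dots> = (\<integral>\<^sup>+\<omega>. indicator (alive n) \<omega> * (indicator {..t} (time n \<omega>) * ennreal (discount n \<omega>) *
        (ennreal (exp (- accumulated (\<lambda>_. 1) (W n \<omega>) (fst (state n \<omega>)) t)) * I n \<omega>)) \<partial>M)"
    proof (rule nn_integral_cong)
      fix \<omega> assume \<omega>: "\<omega> \<in> space M"
      show "ennreal (exp (- accumulated (\<lambda>i. 1 - q i) (W n \<omega>) (time n \<omega>) t)) * B n \<omega> =
        indicator (alive n) \<omega> * (indicator {..t} (time n \<omega>) * ennreal (discount n \<omega>) *
        (ennreal (exp (- accumulated (\<lambda>_. 1) (W n \<omega>) (fst (state n \<omega>)) t)) * I n \<omega>))"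
      proof (cases "\<omega> \<in> alive n")
        case True
        have "ennreal (exp (- accumulated (\<lambda>i. 1 - q i) (W n \<omega>) (time n \<omega>) t)) * ennreal (discount n \<omega> * exp (- accumulated q (W n \<omega>) (time n \<omega>) t))
          = ennreal (discount n \<omega>) * ennreal (exp (- accumulated (\<lambda>_. 1) (W n \<omega>) (time n \<omega>) t))"
          using discount_bounds[of n \<omega>] exp_accumulated_split[OF \<omega>, of n "time n \<omega>" t]
          by (simp add: ennreal_mult[symmetric] mult_ac)
        then show ?thesis using True by (simp add: B_def state_alive(1)[OF True] mult_ac)
      qed (simp add: B_def)
    qed
    also have "\<dots> = (\<integral>\<^sup>+\<omega>. indicator (alive n) \<omega> * (\<integral>\<^sup>+w. indicator {..t} (time n \<omega>) * ennreal (discount n \<omega>) *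
        (ennreal (exp (- accumulated (\<lambda>_. 1) w (fst (state n \<omega>)) t)) *
         indicator A (map_prod (prolong N (fst (state n \<omega>)) t w) (prolong N (fst (state n \<omega>)) t w) (snd (snd (state n \<omega>))))) \<partial>motion_law (state n \<omega>)) \<partial>M)"
    proof -
      note [measurable] = discount_measurable[of n] time_measurable[of n]
      have [measurable]: "(\<lambda>z. ennreal (exp (- accumulated (\<lambda>_. 1) (snd z) (fst (state n (fst z))) t)) *
         indicator A (map_prod (prolong N (fst (state n (fst z))) t (snd z)) (prolong N (fst (state n (fst z))) t (snd z)) (snd (snd (state n (fst z))))))
          \<in> borel_measurable (F n \<Otimes>\<^sub>M motions)"
        by (rule final_integrand_measurable[OF A measurable_compose[OF measurable_fst state_measurable] measurable_snd])
      have "(\<lambda>(\<omega>, w). indicator {..t} (time n \<omega>) * ennreal (discount n \<omega>) *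
        (ennreal (exp (- accumulated (\<lambda>_. 1) w (fst (state n \<omega>)) t)) *
         indicator A (map_prod (prolong N (fst (state n \<omega>)) t w) (prolong N (fst (state n \<omega>)) t w) (snd (snd (state n \<omega>))))))
         \<in> borel_measurable (F n \<Otimes>\<^sub>M motions)"
        unfolding split_beta' by measurable
      from free_motion_integral[OF this] show ?thesis by (simp add: I_def)
    qed
    also have "\<dots> = functional n (final_op t A)"
      unfolding functional_def
    proof (rule nn_integral_cong)
      fix \<omega> assume \<omega>: "\<omega> \<in> space M"
      then have st: "state n \<omega> \<in> space states" using measurable_space[OF state_measurable] by (simp add: space_F)
      have sm: "sets (motion_law (state n \<omega>)) = sets motions"
        using measurable_space[OF motion_law_kernel st] by (auto simp: space_prob_algebra)
      let ?h = "\<lambda>w. ennreal (exp (- accumulated (\<lambda>_. 1) w (fst (state n \<omega>)) t)) *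
         indicator A (map_prod (prolong N (fst (state n \<omega>)) t w) (prolong N (fst (state n \<omega>)) t w) (snd (snd (state n \<omega>))))"
      have h: "?h \<in> borel_measurable (motion_law (state n \<omega>))"
        by (rule final_integrand_measurable[OF A measurable_const[OF st] measurable_ident_sets[OF sm]])
      have "(\<integral>\<^sup>+w. indicator {..t} (time n \<omega>) * ennreal (discount n \<omega>) * ?h w \<partial>motion_law (state n \<omega>))
        = indicator {..t} (time n \<omega>) * ennreal (discount n \<omega>) * (\<integral>\<^sup>+w. ?h w \<partial>motion_law (state n \<omega>))"
        by (rule nn_integral_cmult[OF h])
      then show "indicator (alive n) \<omega> * (\<integral>\<^sup>+w. indicator {..t} (time n \<omega>) * ennreal (discount n \<omega>) * ?h w \<partial>motion_law (state n \<omega>))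
        = indicator (alive n) \<omega> * (ennreal (discount n \<omega>) * final_op t A (state n \<omega>))"
        by (cases "\<omega> \<in> alive n") (auto simp: final_op_def state_alive(1) indicator_def)
    qed
    finally show "(\<integral>\<^sup>+\<omega>. indicator {\<omega>. ereal t < T (Suc n) \<omega>} \<omega> * B n \<omega> \<partial>M) = functional n (final_op t A)" .
  qed
  finally show ?thesis .
qed

end

section \<open>Exchangeability, independence, and the sets of the state space\<close>

lemma nn_integral_PiM_reindex:
  assumes Q: "prob_space Q" and \<sigma>: "\<And>i. i \<in> I \<Longrightarrow> \<sigma> i \<in> I" "inj_on \<sigma> I"
    and \<Psi>: "\<Psi> \<in> borel_measurable (PiM I (\<lambda>_. Q))"
  shows "(\<integral>\<^sup>+x. \<Psi> (\<lambda>i\<in>I. x (\<sigma> i)) \<partial>PiM I (\<lambda>_. Q)) = (\<integral>\<^sup>+x. \<Psi> x \<partial>PiM I (\<lambda>_. Q))"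
proof -
  have D: "distr (PiM I (\<lambda>_. Q)) (PiM I (\<lambda>_. Q)) (\<lambda>x. \<lambda>i\<in>I. x (\<sigma> i)) = PiM I (\<lambda>_. Q)"
    using \<sigma> by (intro distr_PiM_reindex Q) auto
  have "(\<lambda>x. \<lambda>i\<in>I. x (\<sigma> i)) \<in> PiM I (\<lambda>_. Q) \<rightarrow>\<^sub>M PiM I (\<lambda>_. Q)"
    using \<sigma>(1) by (intro measurable_restrict measurable_component_singleton)
  then have "(\<integral>\<^sup>+x. \<Psi> x \<partial>distr (PiM I (\<lambda>_. Q)) (PiM I (\<lambda>_. Q)) (\<lambda>x. \<lambda>i\<in>I. x (\<sigma> i)))
      = (\<integral>\<^sup>+x. \<Psi> (\<lambda>i\<in>I. x (\<sigma> i)) \<partial>PiM I (\<lambda>_. Q))"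
    by (rule nn_integral_distr) (simp add: \<Psi>)
  then show ?thesis unfolding D by simp
qed

text \<open>Independence of a single event from \<open>X\<close> says that two image measures agree
  on all sets; hence they integrate alike.\<close>

lemma (in prob_space) nn_integral_indicator_indep:
  assumes S[measurable]: "S \<in> sets M" and X[measurable]: "X \<in> M \<rightarrow>\<^sub>M L"
    and indep: "\<And>A. A \<in> sets L \<Longrightarrow> prob (S \<inter> (X -` A \<inter> space M)) = prob S * prob (X -` A \<inter> space M)"
    and \<Psi>[measurable]: "\<Psi> \<in> borel_measurable L"
  shows "(\<integral>\<^sup>+\<omega>. indicator S \<omega> * \<Psi> (X \<omega>) \<partial>M) = ennreal (prob S) * (\<integral>\<^sup>+\<omega>. \<Psi> (X \<omega>) \<partial>M)"
proof -
  have eq: "distr (density M (indicator S)) L X = distr (density M (\<lambda>_. ennreal (prob S))) L X"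
  proof (rule measure_eqI)
    fix A assume "A \<in> sets (distr (density M (indicator S)) L X)"
    then have A: "A \<in> sets L" by simp
    have XA: "X -` A \<inter> space M \<in> sets M" by (rule measurable_sets[OF X A])
    have "emeasure (distr (density M (indicator S)) L X) A = emeasure (density M (indicator S)) (X -` A \<inter> space M)"
      using A by (subst emeasure_distr) simp_all
    also have "\<dots> = (\<integral>\<^sup>+\<omega>. indicator (S \<inter> (X -` A \<inter> space M)) \<omega> \<partial>M)"
      unfolding emeasure_density[OF borel_measurable_indicator[OF S] XA]
      by (intro nn_integral_cong) (simp split: split_indicator)
    also have "\<dots> = emeasure M (S \<inter> (X -` A \<inter> space M))"
      using S XA by (intro nn_integral_indicator) simp
    also have "\<dots> = ennreal (prob S) * emeasure M (X -` A \<inter> space M)"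
      unfolding emeasure_eq_measure indep[OF A] by (simp add: ennreal_mult)
    also have "\<dots> = emeasure (density M (\<lambda>_. ennreal (prob S))) (X -` A \<inter> space M)"
      using XA by (subst emeasure_density) (simp_all add: nn_integral_cmult_indicator)
    also have "\<dots> = emeasure (distr (density M (\<lambda>_. ennreal (prob S))) L X) A"
      using A by (subst emeasure_distr) simp_all
    finally show "emeasure (distr (density M (indicator S)) L X) A = emeasure (distr (density M (\<lambda>_. ennreal (prob S))) L X) A" .
  qed simp
  have "(\<integral>\<^sup>+\<omega>. indicator S \<omega> * \<Psi> (X \<omega>) \<partial>M) = (\<integral>\<^sup>+x. \<Psi> x \<partial>distr (density M (indicator S)) L X)"
    by (subst nn_integral_distr) (simp_all add: nn_integral_density)
  also have "\<dots> = (\<integral>\<^sup>+\<omega>. ennreal (prob S) * \<Psi> (X \<omega>) \<partial>M)"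
    unfolding eq by (subst nn_integral_distr) (simp_all add: nn_integral_density)
  also have "\<dots> = ennreal (prob S) * (\<integral>\<^sup>+\<omega>. \<Psi> (X \<omega>) \<partial>M)"
    by (rule nn_integral_cmult) measurable
  finally show ?thesis .
qed

context potential_setting
begin

text \<open>The state space is the trace of the raw product space on cadlag rows:
  \<open>path_space\<close> is itself a restricted product, so the identity from the trace to the
  state space is measurable coordinate by coordinate. Thus operators that work with raw rows still
  determine laws on the state space.\<close>

lemma state_space_sets:
  assumes "B \<in> sets (state_space N t :: ('a rows \<times> 'a rows) measure)"
  shows "\<exists>A\<in>sets (raw_rows {0..t} \<Otimes>\<^sub>M raw_rows {0..t}). B = A \<inter> space (state_space N t)"
proof -
  let ?S = "state_space N t :: ('a rows \<times> 'a rows) measure"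
  let ?R = "raw_rows {0..t} \<Otimes>\<^sub>M raw_rows {0..t}"
  let ?Vm = "vimage_algebra (space ?S) (\<lambda>z. z) ?R"
  have sub: "x \<in> space (raw_rows {0..t})" if "x \<in> space (\<Pi>\<^sub>M i\<in>{1..N}. path_space {0..t})" for x :: "'a rows"
    using that by (auto simp: space_PiM PiE_iff path_space_def space_restrict_space)
  have in_R: "(\<lambda>z. z) \<in> space ?S \<rightarrow> space ?R"
    using sub by (auto simp: state_space_def space_pair_measure)
  have idV: "(\<lambda>z. z) \<in> ?Vm \<rightarrow>\<^sub>M ?R"
    using in_R by (rule measurable_vimage_algebra1)
  have rows: "f \<in> ?Vm \<rightarrow>\<^sub>M (\<Pi>\<^sub>M i\<in>{1..N}. path_space {0..t})"
    if f: "f \<in> ?Vm \<rightarrow>\<^sub>M raw_rows {0..t}" and sp: "\<And>z. z \<in> space ?S \<Longrightarrow> f z \<in> space (\<Pi>\<^sub>M i\<in>{1..N}. path_space {0..t})" for f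
  proof (rule measurable_PiM_single')
    show "f \<in> space ?Vm \<rightarrow> (\<Pi>\<^sub>E i\<in>{1..N}. space (path_space {0..t}))"
      using sp by (auto simp: space_PiM)
    fix i assume i: "i \<in> {1..N}"
    show "(\<lambda>z. f z i) \<in> ?Vm \<rightarrow>\<^sub>M path_space {0..t}"
      unfolding path_space_def
    proof (rule measurable_restrict_space2)
      show "(\<lambda>z. f z i) \<in> space ?Vm \<rightarrow> {x. cadlag_on {0..t} x}"
        using sp i by (auto simp: space_PiM PiE_iff path_cadlag)
      show "(\<lambda>z. f z i) \<in> ?Vm \<rightarrow>\<^sub>M (\<Pi>\<^sub>M s\<in>{0..t}. borel)"
        by (rule measurable_compose[OF f measurable_component_singleton[OF i]])
    qed
  qed
  have "(\<lambda>z. (fst z, snd z)) \<in> ?Vm \<rightarrow>\<^sub>M ?S"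
    unfolding state_space_def
  proof (intro measurable_Pair, unfold state_space_def[symmetric])
    show "fst \<in> ?Vm \<rightarrow>\<^sub>M (\<Pi>\<^sub>M i\<in>{1..N}. path_space {0..t})"
      using measurable_compose[OF idV measurable_fst] by (intro rows) (auto simp: state_space_def space_pair_measure)
    show "snd \<in> ?Vm \<rightarrow>\<^sub>M (\<Pi>\<^sub>M i\<in>{1..N}. path_space {0..t})"
      using measurable_compose[OF idV measurable_snd] by (intro rows) (auto simp: state_space_def space_pair_measure)
  qed
  then have idS: "(\<lambda>z. z) \<in> ?Vm \<rightarrow>\<^sub>M ?S" by simp
  from measurable_sets[OF this assms] have "B \<in> sets ?Vm"
    using sets.sets_into_space[OF assms] by (simp add: Int_absorb2)
  then obtain A where "A \<in> sets ?R" "B = (\<lambda>z. z) -` A \<inter> space ?S"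
    unfolding sets_vimage_algebra2[OF in_R] by blast
  then show ?thesis by (intro bexI[of _ A]) simp_all
qed

definition initial_state :: "(nat \<Rightarrow> 'a) \<Rightarrow> 'a tree_state" where
  "initial_state x = (0, \<lambda>i\<in>{1..N}. x i, initial_rows N x, initial_rows N x)"

lemma initial_state_measurable: "initial_state \<in> tips \<rightarrow>\<^sub>M states"
proof -
  have row: "initial_rows N \<in> tips \<rightarrow>\<^sub>M raw_rows {0..}"
  proof -
    have "(\<lambda>x. \<lambda>i\<in>{1..N}. \<lambda>s\<in>{0..}. if s = 0 then x i else undefined) \<in> tips \<rightarrow>\<^sub>M raw_rows {0..}"
    proof (intro measurable_restrict)
      fix i s assume "i \<in> {1..N}"
      then have [measurable]: "(\<lambda>x. x i) \<in> borel_measurable tips" by (rule measurable_component_singleton)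
      show "(\<lambda>x. if s = 0 then x i else undefined) \<in> borel_measurable tips" by measurable
    qed
    moreover have "initial_rows N = (\<lambda>x::nat \<Rightarrow> 'a. \<lambda>i\<in>{1..N}. \<lambda>s\<in>{0..}. if s = 0 then x i else undefined)"
      by (auto simp: initial_rows_def fun_eq_iff restrict_def)
    ultimately show ?thesis by simp
  qed
  show ?thesis
    unfolding initial_state_def
    by (intro measurable_Pair row measurable_restrict measurable_component_singleton measurable_const) auto
qed

lemma initial_state_restrict: "initial_state (\<lambda>i\<in>{1..N}. x i) = initial_state x"
  by (auto simp: initial_state_def initial_rows_def fun_eq_iff restrict_def)

lemma relabel_initial_state:
  assumes "\<And>i. i \<in> {1..N} \<Longrightarrow> \<sigma> i \<in> {1..N}"
  shows "relabel \<sigma> (initial_state x) = initial_state (\<lambda>i\<in>{1..N}. x (\<sigma> i))"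
  using assms by (auto simp: relabel_def initial_state_def initial_rows_def fun_eq_iff restrict_def)

end

context weighted_jump_process
begin

lemma state_0: "state 0 \<omega> = initial_state (\<lambda>i. \<xi>0 i \<omega>)"
  by (simp add: initial_state_def)

text \<open>Having the constant \<open>c\<close> inside the density allows the laws of the two
  models, whose masses differ by the factor \<open>1 / N\<close>, to be compared as
  measures.\<close>

lemma weighted_law:
  assumes t: "0 \<le> t"
    and f: "\<And>\<omega> n s. \<omega> \<in> space M \<Longrightarrow> E \<omega> = E0 \<Longrightarrow> T n \<omega> < ereal s \<Longrightarrow> ereal s < T (Suc n) \<omega> \<Longrightarrow>
      f \<omega> s = weighted_potential q (W n \<omega>) s"
    and A: "A \<in> sets (raw_rows {0..t} \<Otimes>\<^sub>M raw_rows {0..t})" and c: "0 \<le> c"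
    and B: "A \<inter> space (state_space N t) \<in> sets (state_space N t)"
  shows "emeasure (distr (density M (\<lambda>\<omega>. ennreal (c * (indicator {\<omega>. E \<omega> = E0} \<omega> * exp (- (LINT s:{0..t}|lborel. f \<omega> s))))))
      (state_space N t) (Z t)) (A \<inter> space (state_space N t)) = ennreal c * (\<Sum>n. functional n (final_op t A))"
proof -
  let ?w = "\<lambda>\<omega>. indicator {\<omega>. E \<omega> = E0} \<omega> * exp (- (LINT s:{0..t}|lborel. f \<omega> s))"
  have [measurable]: "?w \<in> borel_measurable M" by (rule weight_measurable[OF t f])
  note Z[measurable] = Z_meas[OF t]
  note B[measurable]
  have "emeasure (distr (density M (\<lambda>\<omega>. ennreal (c * ?w \<omega>))) (state_space N t) (Z t)) (A \<inter> space (state_space N t))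
    = emeasure (density M (\<lambda>\<omega>. ennreal (c * ?w \<omega>))) (Z t -` (A \<inter> space (state_space N t)) \<inter> space M)"
    by (subst emeasure_distr) simp_all
  also have "\<dots> = (\<integral>\<^sup>+\<omega>. ennreal (c * ?w \<omega>) * indicator (Z t -` (A \<inter> space (state_space N t)) \<inter> space M) \<omega> \<partial>M)"
    by (rule emeasure_density) (use measurable_sets[OF Z B] in simp_all)
  also have "\<dots> = (\<integral>\<^sup>+\<omega>. ennreal c * (ennreal (?w \<omega>) * indicator (Z t -` (A \<inter> space (state_space N t)) \<inter> space M) \<omega>) \<partial>M)"
    using c by (intro nn_integral_cong) (simp add: ennreal_mult mult.assoc)
  also have "\<dots> = ennreal c * (\<integral>\<^sup>+\<omega>. ennreal (?w \<omega>) * indicator (Z t -` (A \<inter> space (state_space N t)) \<inter> space M) \<omega> \<partial>M)"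
    using measurable_sets[OF Z B] by (intro nn_integral_cmult) simp
  also have "(\<integral>\<^sup>+\<omega>. ennreal (?w \<omega>) * indicator (Z t -` (A \<inter> space (state_space N t)) \<inter> space M) \<omega> \<partial>M)
    = (\<integral>\<^sup>+\<omega>. indicator {\<omega>. E \<omega> = E0} \<omega> * (ennreal (exp (- (LINT s:{0..t}|lborel. f \<omega> s))) * indicator A (Z t \<omega>)) \<partial>M)"
    using measurable_space[OF Z] by (intro nn_integral_cong) (auto simp: indicator_def)
  also have "\<dots> = (\<Sum>n. functional n (final_op t A))"
    by (rule expansion[OF t A f])
  finally show ?thesis .
qed

end

section \<open>Total jump rates of the two models\<close>

lemma finite_particle_moves: "finite (particle_moves N)"
proof (rule finite_subset)
  show "particle_moves N \<subseteq> (\<lambda>(i, j). Replace i j) ` ({1..N} \<times> {1..N})"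
    by (auto simp: particle_moves_def)
qed simp

lemma finite_dual_moves: "finite (dual_moves N k)"
proof (rule finite_subset)
  show "dual_moves N k \<subseteq> (\<lambda>(i, j). Replace i j) ` ({1..N} \<times> {1..N}) \<union> (\<lambda>i. Exchange i k) ` {1..N}"
    by (auto simp: dual_moves_def)
qed simp

lemma sum_Replace:
  fixes c :: "nat \<Rightarrow> real"
  assumes "A \<subseteq> {1..N}"
  shows "(\<Sum>e\<in>{Replace i j |i j. i \<in> A \<and> j \<in> {1..N} \<and> j \<noteq> i}. c (moved_row e)) = (\<Sum>i\<in>A. (real N - 1) * c i)"
proof -
  have "(\<Sum>e\<in>{Replace i j |i j. i \<in> A \<and> j \<in> {1..N} \<and> j \<noteq> i}. c (moved_row e))
    = (\<Sum>(i, j)\<in>(SIGMA i:A. {1..N} - {i}). c i)"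
    by (rule sum.reindex_bij_witness[where i="\<lambda>(i, j). Replace i j" and j="\<lambda>e. case e of Replace i j \<Rightarrow> (i, j) | Exchange i j \<Rightarrow> (i, j)"])
      auto
  also have "\<dots> = (\<Sum>i\<in>A. \<Sum>j\<in>{1..N} - {i}. c i)"
    using finite_subset[OF assms] by (intro sum.Sigma[symmetric]) auto
  also have "\<dots> = (\<Sum>i\<in>A. (real N - 1) * c i)"
  proof (rule sum.cong[OF refl])
    fix i assume "i \<in> A"
    then have "i \<in> {1..N}" using assms by auto
    then have "card ({1..N} - {i}) = N - 1" "1 \<le> N" by auto
    then show "(\<Sum>j\<in>{1..N} - {i}. c i) = (real N - 1) * c i" by (simp add: of_nat_diff)
  qed
  finally show ?thesis .
qed

lemma particle_rate_sum:
  assumes "N \<ge> 1"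
  shows "(\<Sum>e\<in>particle_moves N. move_rate N V e s x) = (\<Sum>i\<in>{1..N}. (1 - 1 / real N) * V s (x i))"
proof -
  have "(\<Sum>e\<in>particle_moves N. move_rate N V e s x) = (\<Sum>i\<in>{1..N}. (real N - 1) * (V s (x i) / N))"
    unfolding particle_moves_def move_rate_eq by (rule sum_Replace) simp
  also have "\<dots> = (\<Sum>i\<in>{1..N}. (1 - 1 / real N) * V s (x i))"
    using assms by (intro sum.cong) (auto simp: field_simps)
  finally show ?thesis .
qed

text \<open>A row other than \<open>k\<close> drives \<open>N - 1\<close> replacements and one
  exchange, each at rate \<open>V / N\<close>, hence a total of \<open>V\<close>; row
  \<open>k\<close> drives none.\<close>

lemma dual_rate_sum:
  assumes k: "k \<in> {1..N}"
  shows "(\<Sum>e\<in>dual_moves N k. move_rate N V e s x) = (\<Sum>i\<in>{1..N}. (1 - of_bool (i = k)) * V s (x i))"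
proof -
  let ?R = "{Replace i j |i j. i \<in> {1..N} - {k} \<and> j \<in> {1..N} \<and> j \<noteq> i}"
  let ?X = "{Exchange i k |i. i \<in> {1..N} \<and> i \<noteq> k}"
  have un: "dual_moves N k = ?R \<union> ?X" by (auto simp: dual_moves_def)
  have fin: "finite ?R" "finite ?X" using finite_dual_moves[of N k] unfolding un by auto
  have "(\<Sum>e\<in>dual_moves N k. move_rate N V e s x) = (\<Sum>e\<in>?R. V s (x (moved_row e)) / N) + (\<Sum>e\<in>?X. V s (x (moved_row e)) / N)"
    unfolding un move_rate_eq by (intro sum.union_disjoint fin) auto
  also have "(\<Sum>e\<in>?R. V s (x (moved_row e)) / N) = (\<Sum>i\<in>{1..N} - {k}. (real N - 1) * (V s (x i) / N))"
    by (rule sum_Replace) auto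
  also have "(\<Sum>e\<in>?X. V s (x (moved_row e)) / N) = (\<Sum>i\<in>{1..N} - {k}. V s (x i) / N)"
    by (rule sum.reindex_bij_witness[where i="\<lambda>i. Exchange i k" and j=moved_row]) auto
  also have "(\<Sum>i\<in>{1..N} - {k}. (real N - 1) * (V s (x i) / N)) + (\<Sum>i\<in>{1..N} - {k}. V s (x i) / N) = (\<Sum>i\<in>{1..N} - {k}. V s (x i))"
    unfolding sum.distrib[symmetric] using k by (intro sum.cong) (auto simp: field_simps)
  also have "\<dots> = (\<Sum>i\<in>{1..N} - {k}. (1 - of_bool (i = k)) * V s (x i))" by (intro sum.cong) auto
  also have "\<dots> = (\<Sum>i\<in>{1..N}. (1 - of_bool (i = k)) * V s (x i))"
    by (intro sum.mono_neutral_left) auto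
  finally show ?thesis .
qed

text \<open>With a second row available there is an exchange naming \<open>k\<close>, so the set of
  moves reveals the label. Hence the event that the set of moves is \<open>dual_moves N k\<close> is
  the slice \<open>I = k\<close>.\<close>

lemma dual_moves_inj:
  assumes "N \<ge> 2" "k \<in> {1..N}" "dual_moves N k = dual_moves N l"
  shows "k = l"
proof -
  have "\<exists>i. i \<in> {1..N} \<and> i \<noteq> k"
    using assms(1) by (intro exI[of _ "if k = 1 then 2 else 1"]) auto
  then obtain i where i: "i \<in> {1..N}" "i \<noteq> k" by blast
  then have "Exchange i k \<in> dual_moves N k" by (auto simp: dual_moves_def)
  then show ?thesis unfolding assms(3) by (auto simp: dual_moves_def)
qed

section \<open>The duality formula\<close>

text \<open>The left side does not depend on \<omega>, so the claim is that the conditional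
  expectation given the label is almost surely this constant. It is tested on each slice
  \<open>I = k\<close>, of probability \<open>1 / N\<close>, by comparing two weighted laws on the
  state space.\<close>

theorem theorem1p1:
  fixes N :: nat and t :: real
    and \<Omega> :: "'v measure" and X :: "real \<Rightarrow> 'v \<Rightarrow> 'a::metric_space"
    and P :: "real \<Rightarrow> 'a \<Rightarrow> 'a path measure"
    and Dom :: "('a \<Rightarrow> real) set" and L :: "real \<Rightarrow> ('a \<Rightarrow> real) \<Rightarrow> 'a \<Rightarrow> real"
    and V :: "real \<Rightarrow> 'a \<Rightarrow> real"
    and M :: "'w measure" and \<xi>0 :: "nat \<Rightarrow> 'w \<Rightarrow> 'a" and I :: "'w \<Rightarrow> nat"
    and \<xi>h XX \<chi>h YY :: "real \<Rightarrow> 'w \<Rightarrow> 'a rows"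
    and F :: "'a rows \<times> 'a rows \<Rightarrow> real"
  assumes "cadlag_markov_process \<Omega> X P" and "has_generators P Dom L"
    and "(\<lambda>(s, x). V s x) \<in> borel_measurable (restrict_space borel {0..} \<Otimes>\<^sub>M borel)"
    and "\<And>s x. 0 \<le> s \<Longrightarrow> 0 \<le> V s x" and "\<exists>C. \<forall>s\<ge>0. \<forall>x. V s x \<le> C"
    and "N \<ge> 2"
    and "prob_space M"
    and "prob_space.indep_vars M (\<lambda>_. borel) \<xi>0 {1..N}"
    and "\<And>i. i \<in> {1..N} \<Longrightarrow> distr M borel (\<xi>0 i) = distr \<Omega> borel (X 0)"
    and "particle_model M N P V \<xi>0 \<xi>h XX"
    and "I \<in> M \<rightarrow>\<^sub>M count_space {1..N}"
    and "distr M (count_space {1..N}) I = uniform_count_measure {1..N}"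
    and "prob_space.indep_set M
           (sets (vimage_algebra (space M) I (count_space {1..N})))
           (sets (vimage_algebra (space M) (\<lambda>\<omega>. \<lambda>s\<in>{0..}. (\<xi>h s \<omega>, XX s \<omega>))
                    (\<Pi>\<^sub>M s\<in>{0..}. state_space N s)))"
    and "dual_model M N P V \<xi>0 I \<chi>h YY"
    and "t \<ge> 0"
    and "F \<in> borel_measurable (state_space N t)" and "bounded (F ` space (state_space N t))"
  shows "AE \<omega> in M.
    (\<integral>\<omega>. F (\<xi>h t \<omega>, XX t \<omega>) *
        exp (- (LINT s:{0..t}|lborel.
                  measure_pmf.expectation (empirical N (XX s \<omega>)) (hist_potential V s))) \<partial>M)
    = real_cond_exp M (vimage_algebra (space M) I (count_space {1..N}))
        (\<lambda>\<omega>. F (\<chi>h t \<omega>, YY t \<omega>) *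
          exp (- (LINT s:{0..t}|lborel. hist_potential V s (YY s \<omega> (I \<omega>))))) \<omega>"
proof -
  obtain C where C: "\<And>s x. 0 \<le> s \<Longrightarrow> V s x \<le> C" using assms(5) by blast
  interpret M: prob_space M by fact
  have laws: "markov_laws P" using assms(1) by (simp add: cadlag_markov_process_def)
  interpret potential_setting N P V C
    by (rule potential_setting.intro[OF markov_laws.kernel[OF laws] assms(3,4) C])
  obtain Tp Jp Wp Fp Gp where pj: "jump_driven M N P V (\<lambda>_. particle_moves N) \<xi>0 (\<lambda>t \<omega>. (\<xi>h t \<omega>, XX t \<omega>)) Tp Jp Wp Fp Gp"
    using assms(10) unfolding particle_model_def interacting_jump_process_def by blast
  obtain Td Jd Wd Fd Gd where dj: "jump_driven M N P V (\<lambda>\<omega>. dual_moves N (I \<omega>)) \<xi>0 (\<lambda>t \<omega>. (\<chi>h t \<omega>, YY t \<omega>)) Td Jd Wd Fd Gd"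
    using assms(14) unfolding dual_model_def interacting_jump_process_def by blast
  interpret PM: weighted_jump_process N P V C M "\<lambda>_. particle_moves N" \<xi>0 "\<lambda>t \<omega>. (\<xi>h t \<omega>, XX t \<omega>)" Tp Jp Wp Fp Gp
      "particle_moves N" "\<lambda>_. 1 / real N"
    by (intro weighted_jump_process.intro weighted_jump_process_axioms.intro potential_setting_axioms pj
          finite_particle_moves valid_particle_moves particle_rate_sum) (use \<open>N \<ge> 2\<close> in auto)
  \<comment> \<open>One instance for each possible label, since the set of dual moves is fixed only
    on a slice \<open>I = k\<close>.\<close>
  have DM: "weighted_jump_process N P V C M (\<lambda>\<omega>. dual_moves N (I \<omega>)) \<xi>0 (\<lambda>t \<omega>. (\<chi>h t \<omega>, YY t \<omega>)) Td Jd Wd Fd Gd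
      (dual_moves N k) (\<lambda>i. of_bool (i = k))" if "k \<in> {1..N}" for k
    by (intro weighted_jump_process.intro weighted_jump_process_axioms.intro potential_setting_axioms dj
          finite_dual_moves valid_dual_moves[OF that] dual_rate_sum[OF that]) auto
  have I_range: "I \<omega> \<in> {1..N}" if "\<omega> \<in> space M" for \<omega>
    using measurable_space[OF assms(11) that] by simp
  have I_eq: "indicator {\<omega>. dual_moves N (I \<omega>) = dual_moves N k} \<omega> = (indicator (I -` {k} \<inter> space M) \<omega> :: ennreal)"
    and I_eq_real: "indicator {\<omega>. dual_moves N (I \<omega>) = dual_moves N k} \<omega> = (indicator (I -` {k} \<inter> space M) \<omega> :: real)"
    if "\<omega> \<in> space M" for k \<omega>
    using dual_moves_inj[OF \<open>N \<ge> 2\<close> I_range[OF that], of k] that by (auto simp: indicator_def)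
  have I_set: "I -` {k} \<inter> space M \<in> sets (vimage_algebra (space M) I (count_space {1..N}))" if "k \<in> {1..N}" for k
    using that by (intro in_vimage_algebra) auto
  have I_set_M: "I -` {k} \<inter> space M \<in> sets M" if "k \<in> {1..N}" for k
    using that by (intro measurable_sets[OF assms(11)]) auto
  have I_prob: "measure M (I -` {k} \<inter> space M) = 1 / real N" if k: "k \<in> {1..N}" for k
  proof -
    have "measure M (I -` {k} \<inter> space M) = measure (distr M (count_space {1..N}) I) {k}"
      using k by (intro measure_distr[symmetric] assms(11)) auto
    also have "\<dots> = 1 / real N"
      unfolding assms(12) using k by (subst measure_uniform_count_measure) auto
    finally show ?thesis .
  qed
  define x0 where "x0 \<omega> = (\<lambda>i\<in>{1..N}. \<xi>0 i \<omega>)" for \<omega>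
  have \<xi>0_M: "\<xi>0 i \<in> borel_measurable M" if "i \<in> {1..N}" for i
    using PM.F_measurable_M[OF PM.\<xi>0_meas[OF that]] .
  have x0_M[measurable]: "x0 \<in> M \<rightarrow>\<^sub>M tips"
    unfolding x0_def by (intro measurable_restrict \<xi>0_M)
  have x0_law: "distr M tips x0 = (\<Pi>\<^sub>M i\<in>{1..N}. distr M borel (\<xi>0 1))"
  proof -
    have "distr M tips x0 = (\<Pi>\<^sub>M i\<in>{1..N}. distr M borel (\<xi>0 i))"
      unfolding x0_def using assms(6,8) \<xi>0_M by (subst M.indep_vars_iff_distr_eq_PiM'[symmetric]) auto
    also have "\<dots> = (\<Pi>\<^sub>M i\<in>{1..N}. distr M borel (\<xi>0 1))"
      using assms(6,9) by (intro PiM_cong) auto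
    finally show ?thesis .
  qed
  have x0_indep: "measure M ((I -` {k} \<inter> space M) \<inter> (x0 -` A \<inter> space M)) = 1 / real N * measure M (x0 -` A \<inter> space M)"
    if k: "k \<in> {1..N}" and A: "A \<in> sets tips" for k A
  proof -
    let ?P = "\<Pi>\<^sub>M s\<in>{0..}. (state_space N s :: ('a rows \<times> 'a rows) measure)"
    \<comment> \<open>Independence of the label is assumed for the particle model as a whole;
      \<open>g\<close> recovers the initial values from it, as the values of the ancestral rows at
      time \<open>0\<close>.\<close>
    define g where "g p = (\<lambda>i\<in>{1..N}. fst (p (0::real)) i (0::real))" for p :: "real \<Rightarrow> 'a rows \<times> 'a rows"
    have g: "g \<in> ?P \<rightarrow>\<^sub>M tips"
      unfolding g_def
    proof (rule measurable_restrict)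
      fix i assume i: "i \<in> {1..N}"
      have "(\<lambda>p. fst (p 0)) \<in> ?P \<rightarrow>\<^sub>M (\<Pi>\<^sub>M i\<in>{1..N}. path_space {0..0})"
        by (rule measurable_compose[OF measurable_component_singleton[of 0]]) (auto simp: state_space_def)
      from measurable_compose[OF measurable_compose[OF this measurable_component_singleton[OF i]] path_space_eval[of 0]]
      show "(\<lambda>p. fst (p 0) i 0) \<in> borel_measurable ?P" by simp
    qed
    let ?h = "\<lambda>\<omega>. \<lambda>s\<in>{0..}. (\<xi>h s \<omega>, XX s \<omega>)"
    have "x0 -` A \<inter> space M = ?h -` (g -` A \<inter> space ?P) \<inter> space M"
    proof -
      have "?h \<omega> \<in> space ?P" "g (?h \<omega>) = x0 \<omega>" if "\<omega> \<in> space M" for \<omega>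
        using measurable_space[OF PM.Z_meas that] PM.initial[OF that]
        by (auto simp: space_PiM g_def x0_def initial_rows_def fun_eq_iff)
      then show ?thesis by auto
    qed
    then have "x0 -` A \<inter> space M \<in> sets (vimage_algebra (space M) ?h ?P)"
      using in_vimage_algebra[OF measurable_sets[OF g A], of ?h "space M"] by simp
    from M.indep_setD[OF assms(13) I_set[OF k] this] show ?thesis
      unfolding I_prob[OF k] .
  qed
  have functional_0: "PM.functional 0 \<Phi> = (\<integral>\<^sup>+x. \<Phi> (initial_state x) \<partial>distr M tips x0)"
    if \<Phi>: "\<Phi> \<in> borel_measurable states" for \<Phi>
  proof -
    have "(\<integral>\<^sup>+x. \<Phi> (initial_state x) \<partial>distr M tips x0) = (\<integral>\<^sup>+\<omega>. \<Phi> (initial_state (x0 \<omega>)) \<partial>M)"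
      using measurable_compose[OF initial_state_measurable \<Phi>] by (intro nn_integral_distr x0_M) simp
    then show ?thesis
      unfolding PM.functional_0 PM.state_0 x0_def initial_state_restrict by simp
  qed
  \<comment> \<open>The factor \<open>1 / N\<close> is the probability of the label
    \<open>k\<close>. It enters before the first jump, where label and initial values are
    independent.\<close>
  have functionals: "weighted_jump_process.functional N V M (\<lambda>\<omega>. dual_moves N (I \<omega>)) \<xi>0 Td Jd Wd (dual_moves N k) (\<lambda>i. of_bool (i = k)) n \<Phi>
      = ennreal (1 / real N) * PM.functional n \<Phi>" if k: "k \<in> {1..N}" and \<Phi>: "\<Phi> \<in> borel_measurable states" for k n \<Phi>
  proof -
    interpret DM: weighted_jump_process N P V C M "\<lambda>\<omega>. dual_moves N (I \<omega>)" \<xi>0 "\<lambda>t \<omega>. (\<chi>h t \<omega>, YY t \<omega>)" Td Jd Wd Fd Gd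
      "dual_moves N k" "\<lambda>i. of_bool (i = k)" by (rule DM[OF k])
    show ?thesis
    proof (rule dual_functional[where \<mu>=PM.functional and \<nu>=DM.functional, OF k])
      show "PM.functional (Suc n) \<Phi> = (\<Sum>e\<in>particle_moves N. PM.functional n (move_op e \<Phi>))"
        if "\<Phi> \<in> borel_measurable states" for n \<Phi> by (rule PM.functional_Suc[OF that])
      show "DM.functional (Suc n) \<Phi> = (\<Sum>e\<in>dual_moves N k. DM.functional n (move_op e \<Phi>))"
        if "\<Phi> \<in> borel_measurable states" for n \<Phi> by (rule DM.functional_Suc[OF that])
      show "PM.functional n \<Phi> = PM.functional n \<Psi>" if "\<And>\<eta>. \<eta> \<in> space states \<Longrightarrow> \<Phi> \<eta> = \<Psi> \<eta>" for n \<Phi> \<Psi>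
        by (rule PM.functional_cong[OF that])
      show "PM.functional 0 (\<lambda>\<eta>. \<Phi> (relabel \<sigma> \<eta>)) = PM.functional 0 \<Phi>"
        if \<sigma>: "\<And>i. i \<in> {1..N} \<Longrightarrow> \<sigma> i \<in> {1..N}" and inv: "\<And>i. \<sigma> (\<sigma> i) = i"
          and \<Phi>: "\<Phi> \<in> borel_measurable states" for \<sigma> \<Phi>
      proof -
        have "PM.functional 0 (\<lambda>\<eta>. \<Phi> (relabel \<sigma> \<eta>)) = (\<integral>\<^sup>+x. \<Phi> (relabel \<sigma> (initial_state x)) \<partial>distr M tips x0)"
          by (rule functional_0[OF measurable_compose[OF relabel_measurable[OF \<sigma>] \<Phi>]])
        also have "\<dots> = (\<integral>\<^sup>+x. \<Phi> (initial_state (\<lambda>i\<in>{1..N}. x (\<sigma> i))) \<partial>distr M tips x0)"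
          by (simp only: relabel_initial_state[OF \<sigma>])
        \<comment> \<open>The initial values are i.i.d., so their joint law is a power measure and
          does not see a permutation.\<close>
        also have "\<dots> = (\<integral>\<^sup>+x. \<Phi> (initial_state x) \<partial>distr M tips x0)"
          unfolding x0_law
        proof (rule nn_integral_PiM_reindex[where \<Psi>="\<lambda>x. \<Phi> (initial_state x)", OF _ \<sigma>])
          show "prob_space (distr M borel (\<xi>0 1))" using \<open>N \<ge> 2\<close> by (intro M.prob_space_distr \<xi>0_M) simp
          show "inj_on \<sigma> {1..N}" by (metis inj_on_def inv)
          have sm: "sets (\<Pi>\<^sub>M i\<in>{1..N}. distr M borel (\<xi>0 1)) = sets tips" by (intro sets_PiM_cong) simp_all
          show "(\<lambda>x. \<Phi> (initial_state x)) \<in> borel_measurable (\<Pi>\<^sub>M i\<in>{1..N}. distr M borel (\<xi>0 1))"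
            by (subst measurable_cong_sets[OF sm refl]) (rule measurable_compose[OF initial_state_measurable \<Phi>])
        qed
        also have "\<dots> = PM.functional 0 \<Phi>" by (rule functional_0[OF \<Phi>, symmetric])
        finally show ?thesis .
      qed
      show "DM.functional 0 \<Phi> = ennreal (1 / real N) * PM.functional 0 \<Phi>" if \<Phi>: "\<Phi> \<in> borel_measurable states" for \<Phi>
      proof -
        have "DM.functional 0 \<Phi> = (\<integral>\<^sup>+\<omega>. indicator (I -` {k} \<inter> space M) \<omega> * \<Phi> (initial_state (x0 \<omega>)) \<partial>M)"
          unfolding DM.functional_0 DM.state_0 x0_def initial_state_restrict
          by (intro nn_integral_cong) (simp only: I_eq)
        also have "\<dots> = ennreal (measure M (I -` {k} \<inter> space M)) * (\<integral>\<^sup>+\<omega>. \<Phi> (initial_state (x0 \<omega>)) \<partial>M)"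
          using x0_indep[OF k] unfolding I_prob[OF k, symmetric]
          by (rule M.nn_integral_indicator_indep[OF I_set_M[OF k] x0_M _ measurable_compose[OF initial_state_measurable \<Phi>]])
        also have "(\<integral>\<^sup>+\<omega>. \<Phi> (initial_state (x0 \<omega>)) \<partial>M) = PM.functional 0 \<Phi>"
          unfolding PM.functional_0 PM.state_0 x0_def initial_state_restrict by simp
        finally show ?thesis unfolding I_prob[OF k] .
      qed
    qed (rule \<Phi>)
  qed
  define fP where "fP \<omega> s = measure_pmf.expectation (empirical N (XX s \<omega>)) (hist_potential V s)" for \<omega> s
  define fD where "fD \<omega> s = hist_potential V s (YY s \<omega> (I \<omega>))" for \<omega> s
  have fP_eq: "fP \<omega> s = (\<Sum>i\<in>{1..N}. V s (XX s \<omega> i s)) / N" for \<omega> s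
    using \<open>N \<ge> 2\<close> unfolding fP_def empirical_def
    by (simp only: integral_map_pmf) (subst integral_pmf_of_set, auto simp: hist_potential_def)
  have fP: "fP \<omega> s = weighted_potential (\<lambda>_. 1 / real N) (Wp n \<omega>) s"
    if "\<omega> \<in> space M" "Tp n \<omega> < ereal s" "ereal s < Tp (Suc n) \<omega>" for \<omega> n s
  proof -
    have "0 \<le> s" using order_le_less_trans[OF PM.T_nonneg[OF that(1), of n] that(2)] by simp
    then show ?thesis
      using PM.current_row[OF that] by (simp add: fP_eq weighted_potential_def sum_divide_distrib max_absorb2)
  qed
  let ?S = "state_space N t :: ('a rows \<times> 'a rows) measure"
  let ?Zp = "\<lambda>\<omega>. (\<xi>h t \<omega>, XX t \<omega>)" and ?Zd = "\<lambda>\<omega>. (\<chi>h t \<omega>, YY t \<omega>)"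
  let ?wp = "\<lambda>\<omega>. exp (- (LINT s:{0..t}|lborel. fP \<omega> s))" and ?wd = "\<lambda>\<omega>. exp (- (LINT s:{0..t}|lborel. fD \<omega> s))"
  have Zd[measurable]: "?Zd \<in> M \<rightarrow>\<^sub>M ?S"
    using jump_driven.Z_meas[OF dj \<open>t \<ge> 0\<close>] .
  have Zp[measurable]: "?Zp \<in> M \<rightarrow>\<^sub>M ?S"
    using PM.Z_meas[OF \<open>t \<ge> 0\<close>] .
  note F[measurable] = assms(16)
  define c where "c = (\<integral>\<omega>. F (?Zp \<omega>) * ?wp \<omega> \<partial>M)"
  have wd_M: "(\<lambda>\<omega>. indicator (I -` {k} \<inter> space M) \<omega> * ?wd \<omega>) \<in> borel_measurable M"
    and slice: "(\<integral>\<omega>. indicator (I -` {k} \<inter> space M) \<omega> * (F (?Zd \<omega>) * ?wd \<omega>) \<partial>M) = c / real N"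
    if k: "k \<in> {1..N}" for k
  proof -
    interpret DM: weighted_jump_process N P V C M "\<lambda>\<omega>. dual_moves N (I \<omega>)" \<xi>0 "\<lambda>t \<omega>. (\<chi>h t \<omega>, YY t \<omega>)" Td Jd Wd Fd Gd
      "dual_moves N k" "\<lambda>i. of_bool (i = k)" by (rule DM[OF k])
    have fD: "fD \<omega> s = weighted_potential (\<lambda>i. of_bool (i = k)) (Wd n \<omega>) s"
      if "\<omega> \<in> space M" "dual_moves N (I \<omega>) = dual_moves N k" "Td n \<omega> < ereal s" "ereal s < Td (Suc n) \<omega>" for \<omega> n s
    proof -
      have "0 \<le> s" using order_le_less_trans[OF DM.T_nonneg[OF that(1), of n] that(3)] by simp
      moreover have "I \<omega> = k" by (rule dual_moves_inj[OF \<open>N \<ge> 2\<close> I_range[OF that(1)] that(2)])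
      moreover have "weighted_potential (\<lambda>i. of_bool (i = k)) w s = V (max 0 s) (w k (max 0 s))" for w
        unfolding weighted_potential_def using k by (subst sum.remove[of _ k]) auto
      ultimately show ?thesis
        using DM.current_row[OF that(1,3,4) k] by (simp add: fD_def hist_potential_def max_absorb2)
    qed
    \<comment> \<open>Both densities are brought into the shape of \<open>weighted_law\<close>: the
      event is trivial for the particles, and the constant is \<open>1\<close> for the dual.\<close>
    let ?wp' = "\<lambda>\<omega>. 1 / real N * (indicator {\<omega>. particle_moves N = particle_moves N} \<omega> * ?wp \<omega>)"
    let ?wd' = "\<lambda>\<omega>. 1 * (indicator {\<omega>. dual_moves N (I \<omega>) = dual_moves N k} \<omega> * ?wd \<omega>)"
    have wp'[measurable]: "?wp' \<in> borel_measurable M"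
      by (rule borel_measurable_times[OF borel_measurable_const PM.weight_measurable[OF \<open>t \<ge> 0\<close> fP]])
    have wd'[measurable]: "?wd' \<in> borel_measurable M"
      by (rule borel_measurable_times[OF borel_measurable_const DM.weight_measurable[OF \<open>t \<ge> 0\<close> fD]])
    have wd_eq: "?wd' \<omega> = indicator (I -` {k} \<inter> space M) \<omega> * ?wd \<omega>" if "\<omega> \<in> space M" for \<omega>
      by (simp only: I_eq_real[OF that] mult_1)
    show "(\<lambda>\<omega>. indicator (I -` {k} \<inter> space M) \<omega> * ?wd \<omega>) \<in> borel_measurable M"
      using wd' by (rule measurable_cong[THEN iffD1, rotated]) (rule wd_eq)
    \<comment> \<open>Equality as measures on the state space, so that signed functions can be
      integrated against it.\<close>
    have "distr (density M (\<lambda>\<omega>. ennreal (?wp' \<omega>))) ?S ?Zp = distr (density M (\<lambda>\<omega>. ennreal (?wd' \<omega>))) ?S ?Zd"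
    proof (rule measure_eqI)
      fix B assume "B \<in> sets (distr (density M (\<lambda>\<omega>. ennreal (?wp' \<omega>))) ?S ?Zp)"
      then have B: "B \<in> sets ?S" by simp
      obtain A where A: "A \<in> sets (raw_rows {0..t} \<Otimes>\<^sub>M raw_rows {0..t})" and BA: "B = A \<inter> space ?S"
        using state_space_sets[OF B] by blast
      have "emeasure (distr (density M (\<lambda>\<omega>. ennreal (?wd' \<omega>))) ?S ?Zd) B = (\<Sum>n. DM.functional n (final_op t A))"
        unfolding BA using DM.weighted_law[OF \<open>t \<ge> 0\<close> fD A, of 1] B BA by simp
      also have "\<dots> = (\<Sum>n. ennreal (1 / real N) * PM.functional n (final_op t A))"
        using functionals[OF k final_op_measurable[OF A]] by simp
      also have "\<dots> = ennreal (1 / real N) * (\<Sum>n. PM.functional n (final_op t A))" by (rule ennreal_suminf_cmult)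
      also have "\<dots> = emeasure (distr (density M (\<lambda>\<omega>. ennreal (?wp' \<omega>))) ?S ?Zp) B"
        unfolding BA using PM.weighted_law[OF \<open>t \<ge> 0\<close> fP A, of "1 / real N"] B BA by simp
      finally show "emeasure (distr (density M (\<lambda>\<omega>. ennreal (?wp' \<omega>))) ?S ?Zp) B
          = emeasure (distr (density M (\<lambda>\<omega>. ennreal (?wd' \<omega>))) ?S ?Zd) B" ..
    qed simp
    then have "(\<integral>z. F z \<partial>distr (density M (\<lambda>\<omega>. ennreal (?wd' \<omega>))) ?S ?Zd) = (\<integral>z. F z \<partial>distr (density M (\<lambda>\<omega>. ennreal (?wp' \<omega>))) ?S ?Zp)"
      by simp
    also have "(\<integral>z. F z \<partial>distr (density M (\<lambda>\<omega>. ennreal (?wd' \<omega>))) ?S ?Zd) = (\<integral>\<omega>. ?wd' \<omega> *\<^sub>R F (?Zd \<omega>) \<partial>M)"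
      by (subst integral_distr) (simp_all add: integral_density wd'[simplified])
    also have "(\<integral>z. F z \<partial>distr (density M (\<lambda>\<omega>. ennreal (?wp' \<omega>))) ?S ?Zp) = (\<integral>\<omega>. ?wp' \<omega> *\<^sub>R F (?Zp \<omega>) \<partial>M)"
      by (subst integral_distr) (simp_all add: integral_density wp'[simplified])
    finally have 1: "(\<integral>\<omega>. ?wd' \<omega> *\<^sub>R F (?Zd \<omega>) \<partial>M) = (\<integral>\<omega>. ?wp' \<omega> *\<^sub>R F (?Zp \<omega>) \<partial>M)" .
    have 2: "(\<integral>\<omega>. ?wd' \<omega> *\<^sub>R F (?Zd \<omega>) \<partial>M) = (\<integral>\<omega>. indicator (I -` {k} \<inter> space M) \<omega> * (F (?Zd \<omega>) * ?wd \<omega>) \<partial>M)"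
      by (intro Bochner_Integration.integral_cong refl) (simp only: wd_eq, simp)
    have 3: "(\<integral>\<omega>. ?wp' \<omega> *\<^sub>R F (?Zp \<omega>) \<partial>M) = c / real N"
    proof -
      have "(\<integral>\<omega>. ?wp' \<omega> *\<^sub>R F (?Zp \<omega>) \<partial>M) = (\<integral>\<omega>. 1 / real N * (F (?Zp \<omega>) * ?wp \<omega>) \<partial>M)"
        by (intro Bochner_Integration.integral_cong refl) simp
      then show ?thesis by (simp add: c_def)
    qed
    show "(\<integral>\<omega>. indicator (I -` {k} \<inter> space M) \<omega> * (F (?Zd \<omega>) * ?wd \<omega>) \<partial>M) = c / real N"
      using 1 2 3 by simp
  qed
  let ?vA = "vimage_algebra (space M) I (count_space {1..N})"
  let ?f = "\<lambda>\<omega>. F (?Zd \<omega>) * ?wd \<omega>"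
  have f_int: "integrable M ?f"
  proof -
    obtain K where K: "\<And>z. z \<in> space ?S \<Longrightarrow> \<bar>F z\<bar> \<le> K" using assms(17) by (auto simp: bounded_iff)
    \<comment> \<open>The weight of the dual is known to be measurable on each slice only; summing
      over the labels gives it on the whole space.\<close>
    have "(\<lambda>\<omega>. \<Sum>k\<in>{1..N}. (indicator (I -` {k} \<inter> space M) \<omega> * ?wd \<omega>) * F (?Zd \<omega>)) \<in> borel_measurable M"
      by (intro borel_measurable_sum borel_measurable_times wd_M) simp_all
    moreover have "(\<Sum>k\<in>{1..N}. (indicator (I -` {k} \<inter> space M) \<omega> * ?wd \<omega>) * F (?Zd \<omega>)) = ?f \<omega>" if \<omega>: "\<omega> \<in> space M" for \<omega>
    proof -
      have "(\<Sum>k\<in>{1..N}. (indicator (I -` {k} \<inter> space M) \<omega> * ?wd \<omega>) * F (?Zd \<omega>)) = (\<Sum>k\<in>{1..N}. if k = I \<omega> then ?f \<omega> else 0)"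
        using \<omega> by (intro sum.cong) (auto simp: indicator_def)
      also have "\<dots> = ?f \<omega>" using I_range[OF \<omega>] by simp
      finally show ?thesis .
    qed
    ultimately have fm: "?f \<in> borel_measurable M" by (simp cong: measurable_cong)
    have "\<bar>?f \<omega>\<bar> \<le> K" if \<omega>: "\<omega> \<in> space M" for \<omega>
    proof -
      have "0 \<le> (LINT s:{0..t}|lborel. fD \<omega> s)"
        unfolding set_lebesgue_integral_def using assms(4)
        by (intro integral_nonneg_AE) (auto simp: fD_def hist_potential_def indicator_def)
      then have w1: "?wd \<omega> \<le> 1" by simp
      have FK: "\<bar>F (?Zd \<omega>)\<bar> \<le> K" using K measurable_space[OF Zd \<omega>] by simp
      have "\<bar>?f \<omega>\<bar> = \<bar>F (?Zd \<omega>)\<bar> * ?wd \<omega>" by (simp add: abs_mult)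
      also have "\<dots> \<le> \<bar>F (?Zd \<omega>)\<bar> * 1" using w1 by (intro mult_left_mono) auto
      finally show ?thesis using FK by simp
    qed
    then show ?thesis using fm by (intro M.integrable_const_bound[where B=K]) auto
  qed
  have sub: "subalgebra M ?vA"
    using assms(11) unfolding subalgebra_def measurable_iff_sets by auto
  interpret sub: finite_measure_subalgebra M ?vA using sub by unfold_locales
  have decomp: "(LINT \<omega>:A|M. g \<omega>) = (\<Sum>k\<in>B. \<integral>\<omega>. indicator (I -` {k} \<inter> space M) \<omega> * g \<omega> \<partial>M)"
    if g: "integrable M g" and B: "B \<subseteq> {1..N}" and A: "A = I -` B \<inter> space M" for g :: "'w \<Rightarrow> real" and A B
  proof -
    have finB: "finite B" using B finite_subset by blast
    have "(LINT \<omega>:A|M. g \<omega>) = (\<integral>\<omega>. (\<Sum>k\<in>B. indicator (I -` {k} \<inter> space M) \<omega> * g \<omega>) \<partial>M)"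
      unfolding set_lebesgue_integral_def
    proof (intro Bochner_Integration.integral_cong refl)
      fix \<omega> assume \<omega>: "\<omega> \<in> space M"
      have "(\<Sum>k\<in>B. indicator (I -` {k} \<inter> space M) \<omega> * g \<omega>) = (\<Sum>k\<in>B. if k = I \<omega> then g \<omega> else 0)"
        using \<omega> by (intro sum.cong) (auto simp: indicator_def)
      also have "\<dots> = indicator A \<omega> *\<^sub>R g \<omega>" using finB \<omega> by (auto simp: A indicator_def)
      finally show "indicator A \<omega> *\<^sub>R g \<omega> = (\<Sum>k\<in>B. indicator (I -` {k} \<inter> space M) \<omega> * g \<omega>)" ..
    qed
    also have "\<dots> = (\<Sum>k\<in>B. \<integral>\<omega>. indicator (I -` {k} \<inter> space M) \<omega> * g \<omega> \<partial>M)"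
    proof (rule Bochner_Integration.integral_sum)
      fix k assume "k \<in> B"
      then have "I -` {k} \<inter> space M \<in> sets M" using B I_set_M by blast
      from integrable_mult_indicator[OF this g]
      show "integrable M (\<lambda>\<omega>. indicator (I -` {k} \<inter> space M) \<omega> * g \<omega>)" by simp
    qed
    finally show ?thesis .
  qed
  have "AE \<omega> in M. real_cond_exp M ?vA ?f \<omega> = c"
  proof (rule sub.real_cond_exp_charact)
    fix A assume "A \<in> sets ?vA"
    \<comment> \<open>The sigma-algebra of the label consists of the preimages of sets of labels,
      which are finite unions of slices.\<close>
    then obtain B where B: "B \<subseteq> {1..N}" and A: "A = I -` B \<inter> space M"
      using I_range by (subst (asm) sets_vimage_algebra2) auto
    have "(LINT \<omega>:A|M. ?f \<omega>) = (\<Sum>k\<in>B. c / real N)"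
      unfolding decomp[OF f_int B A] using B by (intro sum.cong refl slice) blast
    also have "\<dots> = (LINT \<omega>:A|M. c)"
      unfolding decomp[OF M.integrable_const B A]
    proof (rule sum.cong[OF refl])
      fix k assume "k \<in> B"
      with B have k: "k \<in> {1..N}" by blast
      have "(\<integral>\<omega>. indicator (I -` {k} \<inter> space M) \<omega> * c \<partial>M) = measure M (I -` {k} \<inter> space M) * c"
        by (simp add: Int_absorb2)
      then show "c / real N = (\<integral>\<omega>. indicator (I -` {k} \<inter> space M) \<omega> * c \<partial>M)"
        unfolding I_prob[OF k] by simp
    qed
    finally show "(LINT \<omega>:A|M. ?f \<omega>) = (LINT \<omega>:A|M. c)" .
  qed (use f_int in auto)
  then show ?thesis
    unfolding c_def fP_def fD_def by (elim eventually_mono) (rule sym)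
qed

end
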